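(* Let $K$ be a model of ACVF. Let $V$ be a definable $K$-vector space with $n=\dim_K V<\infty$, and let $N\subseteq V$ be a definable $\mathcal{O}$-submodule. Then $N$ is isomorphic (as an $\mathcal{O}$-module) to $K^{n_1}\times\mathcal{O}^{n_2}\times\mathfrak{M}^{n_3}$ for some $n_1,n_2,n_3\le n$.
   Context: ACVF is the theory of non-trivially valued algebraically closed valued fields; $\mathcal{O}$ is the valuation ring of $K$ and $\mathfrak{M}$ its maximal ideal. "Definable" means interpretable (with parameters). *)

theory Defs
  imports "Jordan_Normal_Form.VS_Connect"
begin

text \<open>
  The valuation is written additively and only its values at nonzero elements are meaningful: the
  convention \<open>v 0 = \<infinity>\<close> is built into the definitions below. The value group is the image
  of the nonzero elements, so \<open>'g\<close> may be larger.
\<close>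

locale acvf =
  fixes v :: "'k::alg_closed_field \<Rightarrow> 'g::linordered_ab_group_add"
  assumes val_mult: "x \<noteq> 0 \<Longrightarrow> y \<noteq> 0 \<Longrightarrow> v (x * y) = v x + v y"
    and val_add: "x \<noteq> 0 \<Longrightarrow> y \<noteq> 0 \<Longrightarrow> x + y \<noteq> 0 \<Longrightarrow> min (v x) (v y) \<le> v (x + y)"
    and val_nontrivial: "\<exists>x. x \<noteq> 0 \<and> v x \<noteq> 0"

definition val_le :: "('k::field \<Rightarrow> 'g::linordered_ab_group_add) \<Rightarrow> 'k \<Rightarrow> 'k \<Rightarrow> bool" where
  "val_le v x y \<longleftrightarrow> y = 0 \<or> (x \<noteq> 0 \<and> v x \<le> v y)"

definition val_integers :: "('k::field \<Rightarrow> 'g::linordered_ab_group_add) \<Rightarrow> 'k set" where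
  "val_integers v = {x. x = 0 \<or> 0 \<le> v x}"

definition val_maximal_ideal :: "('k::field \<Rightarrow> 'g::linordered_ab_group_add) \<Rightarrow> 'k set" where
  "val_maximal_ideal v = {x. x = 0 \<or> 0 < v x}"

definition valuation_ring :: "('k::field \<Rightarrow> 'g::linordered_ab_group_add) \<Rightarrow> 'k ring" where
  "valuation_ring v = class_ring\<lparr>carrier := val_integers v\<rparr>"

text \<open>
  First-order formulas in the language of rings with the binary relation \<open>v x \<le> v y\<close>,
  with de Bruijn indices. The value group and the residue field are quotients of definable sets of
  this one-sorted structure by definable equivalence relations, so adding them as sorts would not
  enlarge the class of interpretable sets.
\<close>

datatype vf_term =
    VF_Var nat | VF_Zero | VF_One | VF_Neg vf_term
  | VF_Add vf_term vf_term | VF_Mult vf_term vf_term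

datatype vf_form =
    VF_Eq vf_term vf_term | VF_ValLe vf_term vf_term
  | VF_Not vf_form | VF_And vf_form vf_form | VF_Ex vf_form

primrec vf_eval :: "(nat \<Rightarrow> 'k::field) \<Rightarrow> vf_term \<Rightarrow> 'k" where
  "vf_eval e (VF_Var i) = e i"
| "vf_eval e VF_Zero = 0"
| "vf_eval e VF_One = 1"
| "vf_eval e (VF_Neg s) = - vf_eval e s"
| "vf_eval e (VF_Add s t) = vf_eval e s + vf_eval e t"
| "vf_eval e (VF_Mult s t) = vf_eval e s * vf_eval e t"

primrec vf_sat ::
  "('k::field \<Rightarrow> 'g::linordered_ab_group_add) \<Rightarrow> vf_form \<Rightarrow> (nat \<Rightarrow> 'k) \<Rightarrow> bool" where
  "vf_sat v (VF_Eq s t) e \<longleftrightarrow> vf_eval e s = vf_eval e t"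
| "vf_sat v (VF_ValLe s t) e \<longleftrightarrow> val_le v (vf_eval e s) (vf_eval e t)"
| "vf_sat v (VF_Not p) e \<longleftrightarrow> \<not> vf_sat v p e"
| "vf_sat v (VF_And p q) e \<longleftrightarrow> vf_sat v p e \<and> vf_sat v q e"
| "vf_sat v (VF_Ex p) e \<longleftrightarrow> (\<exists>a. vf_sat v p (case_nat a e))"

text \<open>
  Points of \<open>K\<^sup>m\<close> are lists of length \<open>m\<close>. The variables from \<open>m\<close> on carry the
  parameters \<open>c\<close>, of which a formula can mention only finitely many.
\<close>

definition definable ::
  "('k::field \<Rightarrow> 'g::linordered_ab_group_add) \<Rightarrow> nat \<Rightarrow> 'k list set \<Rightarrow> bool" where
  "definable v m S \<longleftrightarrow>
    (\<exists>p c. S = {xs. length xs = m \<and> vf_sat v p (\<lambda>i. if i < m then xs ! i else c i)})"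

definition interpretable_set ::
  "('k::field \<Rightarrow> 'g::linordered_ab_group_add) \<Rightarrow> nat \<Rightarrow> 'k list set set \<Rightarrow> bool" where
  "interpretable_set v m X \<longleftrightarrow>
    (\<exists>D E. definable v m D \<and> equiv D E \<and>
      definable v (2 * m) {x @ y | x y. (x, y) \<in> E} \<and> X = D // E)"

text \<open>
  The elements of an interpretable set \<open>X\<close> are equivalence classes, so \<open>\<Union>Y\<close> is
  the preimage of \<open>Y \<subseteq> X\<close> under the quotient map.
\<close>

definition interpretable_subset ::
  "('k::field \<Rightarrow> 'g::linordered_ab_group_add) \<Rightarrow> nat \<Rightarrow> 'k list set set \<Rightarrow> 'k list set set \<Rightarrow> bool"
  where
  "interpretable_subset v m X Y \<longleftrightarrow> Y \<subseteq> X \<and> definable v m (\<Union>Y)"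

text \<open>
  In a definable vector space the preimages in powers of \<open>K\<close> of the graphs of addition and
  of scalar multiplication are definable.
\<close>

definition definable_vector_space ::
  "('k::field \<Rightarrow> 'g::linordered_ab_group_add) \<Rightarrow> nat \<Rightarrow> ('k, 'k list set) module \<Rightarrow> bool" where
  "definable_vector_space v m V \<longleftrightarrow>
    vectorspace class_ring V \<and>
    interpretable_set v m (carrier V) \<and>
    definable v (3 * m)
      {x @ y @ z | x y z. \<exists>A \<in> carrier V. \<exists>B \<in> carrier V. x \<in> A \<and> y \<in> B \<and> z \<in> A \<oplus>\<^bsub>V\<^esub> B} \<and>
    definable v (1 + 2 * m)
      {a # x @ y | a x y. \<exists>A \<in> carrier V. x \<in> A \<and> y \<in> a \<odot>\<^bsub>V\<^esub> A}"

definition module_isomorphic ::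
  "('a, 'r) ring_scheme \<Rightarrow> ('a, 'b, 'm) module_scheme \<Rightarrow> ('a, 'c, 'n) module_scheme \<Rightarrow> bool" where
  "module_isomorphic R M N \<longleftrightarrow> (\<exists>f. mod_hom R M N f \<and> bij_betw f (carrier M) (carrier N))"

definition power_module :: "'k::field set \<Rightarrow> nat \<Rightarrow> ('k, 'k vec) module" where
  "power_module S n =
    (module_vec TYPE('k) n)\<lparr>carrier := {x \<in> carrier_vec n. \<forall>i < n. x $ i \<in> S}\<rparr>"

end

theory Submission
  imports Defs
begin

text \<open>
  Quantifier elimination for algebraically closed valued fields is proved semantically: the truth of a
  formula at a point is determined by finitely many comparisons of valuations of polynomials. The
  back-and-forth step matches a new point \<open>a\<close> relative to the nearest root \<open>s\<close> of the polynomials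
  involved, around which their valuations at \<open>a\<close> are Gauss norms of radius \<open>v (a - s)\<close>. Algebraic
  points are matched by induction on the degree: the Newton polygon counts the roots of a polynomial
  in a ball around the (already matched) roots of the polynomials of smaller degree.

  Two consequences for definable \<open>\<O>\<close>-modules suffice. First, a definable submodule of \<open>K\<close> is
  \<open>0\<close>, \<open>K\<close>, \<open>a \<O>\<close> or \<open>a \<MM>\<close>, since its truth value as a function of the valuation changes at finitely
  many critical values only. Second, definable nested families of balls of the kind that arise below have a
  common point. In coordinates, \<open>N\<close> is an iterated extension of definable submodules of \<open>K\<close>, and the
  second fact says that each of these extensions splits.
\<close>

section \<open>Valuation inequalities\<close>

text \<open>Everything happens inside the one field \<open>K\<close>, without saturated extensions
  or compactness. Hence each back-and-forth step has to be uniform: a finite set of polynomial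
  functions is fixed in advance, and agreement on it must force the extension for all pairs of
  points at once; \<open>transfers\<close> expresses this. Two points that agree on finitely many
  comparisons need not generate isomorphic valued fields, so a root cannot be carried over by an
  embedding. What does carry over is the number of roots in a position described by comparisons, and
  a positive number provides the matching root.

  Splitting is where definability is essential. Without spherical completeness a nested family of
  balls can have empty intersection, and then an extension of submodules of \<open>K\<close> by one
  another need not split. Here the fibre of the module over a new coordinate \<open>t\<close> is a
  coset of a product of submodules of \<open>K\<close>. A splitting is a choice of a point in each
  fibre that is linear in \<open>t\<close>; such a choice can be made factor by factor, and in one
  factor the admissible slopes form exactly a nested family of balls.\<close>

context acvf
begin

text \<open>The relation absorbs the convention for 0, which is the top element; in particular
  \<open>x \<prec> y\<close> forces \<open>x \<noteq> 0\<close>.\<close>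

abbreviation vle :: "'k \<Rightarrow> 'k \<Rightarrow> bool" (infix "\<preceq>" 50) where "x \<preceq> y \<equiv> val_le v x y"
abbreviation vlt :: "'k \<Rightarrow> 'k \<Rightarrow> bool" (infix "\<prec>" 50) where "x \<prec> y \<equiv> \<not> val_le v y x"

lemma val_one [simp]: "v 1 = 0"
  using val_mult[of 1 1] by simp

lemma vle_refl [simp]: "x \<preceq> x"
  by (simp add: val_le_def)

lemma vle_trans: "x \<preceq> y \<Longrightarrow> y \<preceq> z \<Longrightarrow> x \<preceq> z"
  by (auto simp: val_le_def)

lemma vlt_imp_vle: "x \<prec> y \<Longrightarrow> x \<preceq> y"
  by (auto simp: val_le_def)

lemma vle_vlt_trans: "x \<preceq> y \<Longrightarrow> y \<prec> z \<Longrightarrow> x \<prec> z"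
  using vle_trans by blast

lemma vlt_vle_trans: "x \<prec> y \<Longrightarrow> y \<preceq> z \<Longrightarrow> x \<prec> z"
  using vle_trans by blast

lemma vle_zero [simp]: "x \<preceq> 0"
  by (simp add: val_le_def)

lemma zero_vle_iff [simp]: "0 \<preceq> x \<longleftrightarrow> x = 0"
  by (auto simp: val_le_def)

lemma vle_mult_cancel [simp]:
  "a * x \<preceq> a * y \<longleftrightarrow> a = 0 \<or> x \<preceq> y" "x * a \<preceq> y * a \<longleftrightarrow> a = 0 \<or> x \<preceq> y"
  by (cases "a = 0"; cases "x = 0"; cases "y = 0"; simp add: val_le_def val_mult)+

lemma vle_mult: "a \<preceq> b \<Longrightarrow> c \<preceq> d \<Longrightarrow> a * c \<preceq> b * d"
  by (metis vle_mult_cancel vle_trans)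

lemma val_minus_one: "v (- 1) = 0"
proof -
  have "v (- 1) + v (- 1) = 0" using val_mult[of "-1" "-1"] by simp
  thus ?thesis using double_zero by blast
qed

lemma val_minus [simp]: "v (- x) = v x"
  using val_mult[of "-1" x] val_minus_one by (cases "x = 0") auto

lemma vle_minus [simp]: "- x \<preceq> y \<longleftrightarrow> x \<preceq> y" "x \<preceq> - y \<longleftrightarrow> x \<preceq> y"
  by (auto simp: val_le_def)

lemma vle_minus_commute: "x \<preceq> y - z \<longleftrightarrow> x \<preceq> z - y" "y - z \<preceq> x \<longleftrightarrow> z - y \<preceq> x"
  by (metis minus_diff_eq vle_minus)+

lemma vle_add: "x \<preceq> y \<Longrightarrow> x \<preceq> z \<Longrightarrow> x \<preceq> y + z"
  using val_add[of y z] order_trans[of "v x" "min (v y) (v z)" "v (y + z)"]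
  by (cases "y = 0"; cases "z = 0") (auto simp: val_le_def)

lemma vle_diff: "x \<preceq> y \<Longrightarrow> x \<preceq> z \<Longrightarrow> x \<preceq> y - z"
  using vle_add[of x y "-z"] by simp

lemma vlt_add: "x \<prec> y \<Longrightarrow> x \<prec> z \<Longrightarrow> x \<prec> y + z"
  by (metis vle_add vle_trans vlt_imp_vle)

lemma vlt_diff: "x \<prec> y \<Longrightarrow> x \<prec> z \<Longrightarrow> x \<prec> y - z"
  using vlt_add[where x = x and y = y and z = "- z"] by simp

lemma vle_dominant:
  assumes "x \<prec> y" shows "x + y \<preceq> x" "x \<preceq> x + y" "x - y \<preceq> x" "x \<preceq> x - y"
proof -
  show "x \<preceq> x + y" using assms by (simp add: vle_add vlt_imp_vle)
  show "x \<preceq> x - y" using assms by (simp add: vle_diff vlt_imp_vle)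
  show "x + y \<preceq> x"
    using assms vlt_diff[where x = x and y = "x + y" and z = y] by (metis add_diff_cancel_right' vle_refl)
  show "x - y \<preceq> x"
    using assms vlt_add[where x = x and y = "x - y" and z = y] by (metis diff_add_cancel vle_refl)
qed

lemma vle_power: "x \<preceq> y \<Longrightarrow> x ^ n \<preceq> y ^ n"
  by (induction n) (auto intro: vle_mult)

lemma vlt_power: assumes "x \<prec> y" "n > 0" shows "x ^ n \<prec> y ^ n"
  using assms(2)
proof (induction n rule: nat_induct_non_zero)
  case 1 thus ?case using assms(1) by simp
next
  case (Suc n)
  have "x * x ^ n \<preceq> y * x ^ n" using assms by (simp add: vlt_imp_vle)
  show ?case
  proof
    assume "y ^ Suc n \<preceq> x ^ Suc n"
    moreover have "x * y ^ n \<preceq> y * y ^ n" using assms by (simp add: vlt_imp_vle)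
    ultimately have "x * y ^ n \<preceq> x * x ^ n" by (metis power_Suc vle_trans)
    thus False using Suc assms(1) by auto
  qed
qed

lemma vle_power_iff: "n > 0 \<Longrightarrow> x ^ n \<preceq> y ^ n \<longleftrightarrow> x \<preceq> y"
  using vle_power vlt_power by blast

text \<open>A square root of \<open>x * y\<close> has the midpoint of the two values as its value:
  value groups of algebraically closed fields are divisible.\<close>

lemma vle_dense: 
  assumes "x \<prec> y" "y \<noteq> 0" obtains u where "u \<noteq> 0" "x \<prec> u" "u \<prec> y"
proof -
  obtain u where u: "u ^ 2 = x * y" using nth_root_exists[of 2 "x * y"] by auto
  have "x * x \<prec> u ^ 2" "u ^ 2 \<prec> y * y" using assms u by auto
  hence "x \<prec> u" "u \<prec> y"
    unfolding power2_eq_square using vle_mult by blast+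
  moreover have "u \<noteq> 0" using u assms by auto
  ultimately show thesis using that by blast
qed

lemma vlt_unbounded: 
  obtains g where "g \<noteq> 0" "1 \<prec> g"
proof -
  obtain x where x: "x \<noteq> 0" "v x \<noteq> 0" using val_nontrivial by blast
  have "v x + v (1 / x) = 0" using val_mult[of x "1/x"] x by simp
  hence "v x > 0 \<or> v (1 / x) > 0" using x(2)
    by (metis add.inverse_unique neg_0_less_iff_less not_less_iff_gr_or_eq)
  thus thesis using that[of x] that[of "1/x"] x by (auto simp: val_le_def)
qed

lemma vlt_above: 
  assumes "x \<noteq> 0" obtains u where "u \<noteq> 0" "x \<prec> u"
proof -
  obtain g where g: "g \<noteq> 0" "1 \<prec> g" using vlt_unbounded by blast
  have "x * 1 \<prec> x * g" using g assms vle_mult_cancel(1)[of x g 1] by simp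
  thus thesis using that[of "x * g"] g assms by simp
qed

lemma vlt_below: 
  assumes "x \<noteq> 0" obtains u where "u \<noteq> 0" "u \<prec> x"
proof -
  obtain g where g: "g \<noteq> 0" "1 \<prec> g" using vlt_unbounded by blast
  have "(x / g) * 1 \<prec> (x / g) * g" using g assms vle_mult_cancel(1)[of "x/g" g 1] by auto
  thus thesis using that[of "x / g"] g assms by simp
qed

lemma finite_vle_minimum:
  assumes "finite A" "A \<noteq> {}" shows "\<exists>x\<in>A. \<forall>y\<in>A. f x \<preceq> f y"
  using assms
proof (induction rule: finite_ne_induct)
  case (insert x F)
  then obtain m where "m \<in> F" "\<forall>y\<in>F. f m \<preceq> f y" by blast
  thus ?case using vle_trans[of "f x" "f m"] vlt_imp_vle[of "f m" "f x"]
    by (cases "f x \<preceq> f m") auto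
qed simp

lemma finite_vle_maximum:
  assumes "finite A" "A \<noteq> {}" shows "\<exists>x\<in>A. \<forall>y\<in>A. f y \<preceq> f x"
  using assms
proof (induction rule: finite_ne_induct)
  case (insert x F)
  then obtain m where "m \<in> F" "\<forall>y\<in>F. f y \<preceq> f m" by blast
  thus ?case using vle_trans[of _ "f m" "f x"] vlt_imp_vle[of "f x" "f m"]
    by (cases "f m \<preceq> f x") auto
qed simp

text \<open>The back-and-forth step for dense linear orders without endpoints: \<open>w\<close>
  either has the value of some \<open>z i\<close> or falls into a gap, and the corresponding gap
  between the \<open>z' i\<close> is inhabited.\<close>

lemma value_group_extension:
  assumes fin: "finite I"
    and nz: "\<And>i. i \<in> I \<Longrightarrow> z i \<noteq> 0" "\<And>i. i \<in> I \<Longrightarrow> z' i \<noteq> 0"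
    and ord: "\<And>i j. i \<in> I \<Longrightarrow> j \<in> I \<Longrightarrow> z i \<preceq> z j \<longleftrightarrow> z' i \<preceq> z' j"
    and w: "w \<noteq> 0"
  shows "\<exists>w'. w' \<noteq> 0 \<and> (\<forall>i\<in>I. (z i \<preceq> w \<longleftrightarrow> z' i \<preceq> w') \<and> (w \<preceq> z i \<longleftrightarrow> w' \<preceq> z' i))"
proof (cases "\<exists>i\<in>I. z i \<preceq> w \<and> w \<preceq> z i")
  case True
  then obtain i where i: "i \<in> I" "z i \<preceq> w" "w \<preceq> z i" by blast
  have "\<forall>j\<in>I. (z j \<preceq> w \<longleftrightarrow> z' j \<preceq> z' i) \<and> (w \<preceq> z j \<longleftrightarrow> z' i \<preceq> z' j)"
    using i ord vle_trans by blast
  thus ?thesis using nz i by blast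
next
  case False
  let ?A = "{i\<in>I. z i \<preceq> w}" and ?B = "{i\<in>I. w \<preceq> z i}"
  have *: ?thesis if w': "w' \<noteq> 0" "\<forall>i\<in>?A. z' i \<prec> w'" "\<forall>i\<in>?B. w' \<prec> z' i" for w'
  proof -
    have "(z i \<preceq> w \<longleftrightarrow> z' i \<preceq> w') \<and> (w \<preceq> z i \<longleftrightarrow> w' \<preceq> z' i)" if "i \<in> I" for i
      using w' False that vlt_imp_vle[of "z' i" w'] vlt_imp_vle[of w' "z' i"]
        vlt_imp_vle[of "z i" w] vlt_imp_vle[of w "z i"] by blast
    thus ?thesis using w' by blast
  qed
  have lt: "z' i \<prec> z' j" if "i \<in> ?A" "j \<in> ?B" for i j
    using that False ord vle_trans by blast
  have fA: "finite ?A" "finite ?B" using fin by auto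
  show ?thesis
  proof (cases "?A = {}")
    case True
    show ?thesis
    proof (cases "?B = {}")
      case True
      show ?thesis by (rule *[OF w]) (simp_all only: True \<open>?A = {}\<close> ball_empty)
    next
      case False
      then obtain b where b: "b \<in> ?B" "\<forall>j\<in>?B. z' b \<preceq> z' j"
        using finite_vle_minimum[OF fA(2)] by blast
      obtain u where "u \<noteq> 0" "u \<prec> z' b" using vlt_below[of "z' b"] nz b by blast
      thus ?thesis using b True vlt_vle_trans by (intro *[of u]) blast+
    qed
  next
    case False
    then obtain a where a: "a \<in> ?A" "\<forall>j\<in>?A. z' j \<preceq> z' a"
      using finite_vle_maximum[OF fA(1)] by blast
    show ?thesis
    proof (cases "?B = {}")
      case True
      obtain u where "u \<noteq> 0" "z' a \<prec> u" using vlt_above[of "z' a"] nz a by blast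
      thus ?thesis using a True vle_vlt_trans by (intro *[of u]) blast+
    next
      case False
      then obtain b where b: "b \<in> ?B" "\<forall>j\<in>?B. z' b \<preceq> z' j"
        using finite_vle_minimum[OF fA(2)] by blast
      have "z' b \<noteq> 0" using nz b by blast
      then obtain u where "u \<noteq> 0" "z' a \<prec> u" "u \<prec> z' b" 
        using vle_dense[OF lt[OF a(1) b(1)]] by blast
      thus ?thesis using a b vlt_vle_trans vle_vlt_trans by (intro *[of u]) blast+
    qed
  qed
qed

end

section \<open>Newton polygons and roots in balls\<close>

context acvf
begin

text \<open>The vertices at the two ends of the Newton polygon edge of slope zero.\<close>

definition newton_edge :: "'k poly \<Rightarrow> nat \<Rightarrow> nat \<Rightarrow> bool" where
  "newton_edge q lo hi \<longleftrightarrow> (\<exists>\<mu>. \<mu> \<noteq> 0 \<and> (\<forall>j. \<mu> \<preceq> coeff q j) \<and> coeff q lo \<preceq> \<mu> \<and> coeff q hi \<preceq> \<mu> \<and>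
    (\<forall>j<lo. \<mu> \<prec> coeff q j) \<and> (\<forall>j>hi. \<mu> \<prec> coeff q j))"

text \<open>The coefficients of the product are \<open>p j - r * coeff q j\<close> with
  \<open>p\<close> the shift of \<open>coeff q\<close>. For \<open>r\<close> of positive value (or
  0) the shifted copy dominates and both ends move; for negative value the multiple by
  \<open>r\<close> dominates and scales the minimum; for value 0 the two terms compete and only the
  right end moves. So the ends count roots of positive and of nonnegative value.\<close>

lemma newton_edge_mult_linear:
  assumes "newton_edge q lo hi"
  shows "newton_edge ([:- r, 1:] * q) (if 1 \<prec> r then Suc lo else lo) (if 1 \<preceq> r then Suc hi else hi)"
proof -
  let ?q = "[:- r, 1:] * q"
  define p where "p j = (if j = 0 then 0 else coeff q (j - 1))" for j
  obtain \<mu> where \<mu>: "\<mu> \<noteq> 0" "\<And>j. \<mu> \<preceq> coeff q j" "coeff q lo \<preceq> \<mu>" "coeff q hi \<preceq> \<mu>"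
    "\<And>j. j < lo \<Longrightarrow> \<mu> \<prec> coeff q j" "\<And>j. j > hi \<Longrightarrow> \<mu> \<prec> coeff q j"
    using assms unfolding newton_edge_def by blast
  have c: "coeff ?q j = p j - r * coeff q j" for j
    by (cases j) (simp_all add: p_def)
  have p: "\<mu> \<preceq> p j" "j \<le> lo \<Longrightarrow> \<mu> \<prec> p j" "j > Suc hi \<Longrightarrow> \<mu> \<prec> p j" for j
    using \<mu> by (cases j; simp add: p_def)+
  have pS: "p (Suc lo) \<preceq> \<mu>" "p (Suc hi) \<preceq> \<mu>"
    using \<mu> by (simp_all add: p_def)
  consider "1 \<prec> r" | "1 \<preceq> r" "r \<preceq> 1" | "r \<prec> 1" using vlt_imp_vle by blast
  thus ?thesis
  proof cases
    case 1
    have r: "\<mu> \<prec> r * coeff q j" for j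
    proof -
      have "\<mu> \<prec> r * \<mu>" using 1 \<mu>(1) vle_mult_cancel(2)[of r \<mu> 1] by simp
      moreover have "r * \<mu> \<preceq> r * coeff q j" using \<mu>(2) by simp
      ultimately show ?thesis by (rule vlt_vle_trans)
    qed
    have *: "p j - r * coeff q j \<preceq> \<mu>" if "p j \<preceq> \<mu>" for j
      using vle_dominant(3)[OF vle_vlt_trans[OF that r]] that vle_trans by blast
    have "newton_edge ?q (Suc lo) (Suc hi)"
      unfolding newton_edge_def c
      by (intro exI[of _ \<mu>] conjI allI impI vle_diff vlt_diff * p pS r vlt_imp_vle[OF r] \<mu>(1)) auto
    thus ?thesis using 1 vlt_imp_vle by auto
  next
    case 2
    have r: "\<mu> \<preceq> r * coeff q j" for j
      using vle_mult[OF 2(1) \<mu>(2)] by simp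
    have r1: "\<mu> \<prec> r * coeff q j" if "\<mu> \<prec> coeff q j" for j
    proof
      assume "r * coeff q j \<preceq> \<mu>"
      moreover have "r \<noteq> 0" using 2 by auto
      moreover have "\<mu> \<preceq> r * \<mu>" using 2 vle_mult_cancel(2)[of 1 \<mu> r] by simp
      ultimately have "r * coeff q j \<preceq> r * \<mu>" using vle_trans by blast
      thus False using that \<open>r \<noteq> 0\<close> by simp
    qed
    have r2: "r * coeff q lo \<preceq> \<mu>"
      using vle_mult[OF 2(2) \<mu>(3)] by simp
    have "p lo - r * coeff q lo \<preceq> \<mu>"
      using vle_dominant(3)[OF vle_vlt_trans[OF r2 p(2)]] r2 vle_trans vle_minus_commute(2) by blast
    moreover have "p (Suc hi) - r * coeff q (Suc hi) \<preceq> \<mu>"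
      using vle_dominant(3)[OF vle_vlt_trans[OF pS(2) r1[OF \<mu>(6)]]] pS vle_trans by blast
    ultimately have "newton_edge ?q lo (Suc hi)"
      unfolding newton_edge_def c
      by (intro exI[of _ \<mu>] conjI allI impI vle_diff vlt_diff p r r1 \<mu>) (use Suc_lessD in auto)
    thus ?thesis using 2 by auto
  next
    case 3
    hence r: "r \<noteq> 0" by auto
    have mu: "r * \<mu> \<prec> \<mu>" 
    proof -
      show ?thesis using 3 \<mu>(1) vle_mult_cancel(2)[of 1 \<mu> r] by simp
    qed
    have p': "r * \<mu> \<prec> p j" for j using vlt_vle_trans[OF mu p(1)] .
    have *: "p j - r * coeff q j \<preceq> r * \<mu>" if "coeff q j \<preceq> \<mu>" for j
    proof -
      have "r * coeff q j \<preceq> r * \<mu>" using that by simp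
      thus ?thesis
        using vle_dominant(3)[OF vle_vlt_trans[OF _ p'[of j]]] vle_trans vle_minus_commute(2) by blast
    qed
    have "newton_edge ?q lo hi"
      unfolding newton_edge_def c
      by (intro exI[of _ "r * \<mu>"] conjI allI impI vle_diff vlt_diff * p' vlt_imp_vle[OF p'] \<mu>)
        (use \<mu> r in auto)
    thus ?thesis using 3 vlt_imp_vle by auto
  qed
qed

lemma newton_edge_smult: 
  assumes "newton_edge q lo hi" "c \<noteq> 0" shows "newton_edge (Polynomial.smult c q) lo hi"
proof -
  obtain \<mu> where \<mu>: "\<mu> \<noteq> 0" "\<And>j. \<mu> \<preceq> coeff q j" "coeff q lo \<preceq> \<mu>" "coeff q hi \<preceq> \<mu>"
    "\<And>j. j < lo \<Longrightarrow> \<mu> \<prec> coeff q j" "\<And>j. j > hi \<Longrightarrow> \<mu> \<prec> coeff q j"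
    using assms unfolding newton_edge_def by blast
  thus ?thesis unfolding newton_edge_def using assms(2)
    by (intro exI[of _ "c * \<mu>"]) auto
qed

lemma newton_edge_prod:
  "newton_edge (\<Prod>r\<in>#A. [:- r, 1:]) (size {#r \<in># A. 1 \<prec> r#}) (size {#r \<in># A. 1 \<preceq> r#})"
proof (induction A)
  case empty
  show ?case unfolding newton_edge_def by (intro exI[of _ 1]) (auto simp: coeff_1)
next
  case (add r A)
  show ?case using newton_edge_mult_linear[OF add.IH, of r]
    by (simp del: mult_pCons_left split: if_splits)
qed

text \<open>Defined by comparisons among coefficients alone, so that agreement on such comparisons
  makes these sets equal. For the zero polynomial all indices are dominant.\<close>

definition dominant_indices :: "'k poly \<Rightarrow> nat set" where
  "dominant_indices q = {j. \<forall>i. coeff q j \<preceq> coeff q i}"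

lemma dominant_indices_edge:
  assumes "newton_edge q lo hi"
  shows "Min (dominant_indices q) = lo" "Max (dominant_indices q) = hi" "coeff q lo \<noteq> 0" 
    "lo \<in> dominant_indices q" "hi \<in> dominant_indices q"
proof -
  obtain \<mu> where \<mu>: "\<mu> \<noteq> 0" "\<And>j. \<mu> \<preceq> coeff q j" "coeff q lo \<preceq> \<mu>" "coeff q hi \<preceq> \<mu>"
    "\<And>j. j < lo \<Longrightarrow> \<mu> \<prec> coeff q j" "\<And>j. j > hi \<Longrightarrow> \<mu> \<prec> coeff q j"
    using assms unfolding newton_edge_def by blast
  have eq: "dominant_indices q = {j. coeff q j \<preceq> \<mu>}"
    unfolding dominant_indices_def using \<mu> vle_trans by blast
  have sub: "dominant_indices q \<subseteq> {lo..hi}"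
    unfolding eq using \<mu> by (metis (mono_tags, lifting) atLeastAtMost_iff mem_Collect_eq not_less subsetI)
  show mem: "lo \<in> dominant_indices q" "hi \<in> dominant_indices q"
    unfolding eq using \<mu> by auto
  show "Min (dominant_indices q) = lo" "Max (dominant_indices q) = hi"
    using sub mem by (auto intro!: Min_eqI Max_eqI finite_subset[OF sub])
  show "coeff q lo \<noteq> 0" using \<mu> by auto
qed

lemma proots_factorization:
  assumes "(p :: 'k poly) \<noteq> 0"
  shows "p = Polynomial.smult (lead_coeff p) (\<Prod>r\<in>#proots p. [:- r, 1:])"
proof -
  obtain A where A: "p = Polynomial.smult (lead_coeff p) (\<Prod>x\<in>#A. [:-x, 1:])"
    using alg_closed_imp_factorization[OF assms] by blast
  have "proots p = proots (\<Prod>x\<in>#A. [:-x, 1:])"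
    using assms by (subst A) (simp only: proots_smult leading_coeff_0_iff not_False_eq_True)
  also have "\<dots> = A"
  proof (induction A)
    case (add x A)
    have "(\<Prod>x\<in>#A. [:-x, 1::'k:]) \<noteq> 0" by (auto simp: prod_mset_zero_iff)
    thus ?case using add by (simp add: proots_mult del: mult_pCons_left)
  qed simp
  finally show ?thesis using A by simp
qed

lemma pcompose_linear_factors:
  assumes "w \<noteq> 0"
  shows "(\<Prod>r\<in>#A. [:- r, 1:]) \<circ>\<^sub>p [:s, w:] =
    Polynomial.smult (w ^ size A) (\<Prod>r\<in>#image_mset (\<lambda>r. (r - s) / w) A. [:- r, 1 :: 'k:])"
proof (induction A)
  case (add r A)
  have r: "[:- r, 1:] \<circ>\<^sub>p [:s, w:] = Polynomial.smult w [:- ((r - s) / w), 1:]"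
    using assms by (simp add: pcompose_pCons)
  have "(\<Prod>r\<in>#add_mset r A. [:- r, 1:]) \<circ>\<^sub>p [:s, w:] =
    ([:- r, 1:] \<circ>\<^sub>p [:s, w:]) * ((\<Prod>r\<in>#A. [:- r, 1:]) \<circ>\<^sub>p [:s, w:])"
    by (simp only: image_mset_add_mset prod_mset.add_mset pcompose_mult)
  thus ?case unfolding r add.IH
    by (simp only: image_mset_add_mset prod_mset.add_mset size_add_mset mult_smult_left mult_smult_right
        smult_smult power_Suc mult.commute[of w])
qed (simp add: pcompose_1)

text \<open>Substituting \<open>s + w X\<close> turns the balls of radius \<open>v w\<close> around
  \<open>s\<close> into the valuation ring and its maximal ideal, so the ends of the edge count the
  roots in the open and in the closed ball.\<close>

lemma newton_edge_ball:
  assumes "p \<noteq> 0" "w \<noteq> 0"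
  shows "newton_edge (p \<circ>\<^sub>p [:s, w:])
    (size {#r \<in># proots p. w \<prec> r - s#}) (size {#r \<in># proots p. w \<preceq> r - s#})"
proof -
  define B where "B = image_mset (\<lambda>r. (r - s) / w) (proots p)"
  have "p \<circ>\<^sub>p [:s, w:] = Polynomial.smult (lead_coeff p * w ^ size (proots p)) (\<Prod>r\<in>#B. [:- r, 1:])"
    by (subst proots_factorization[OF assms(1)])
      (simp add: pcompose_smult pcompose_linear_factors[OF assms(2)] B_def)
  moreover have "newton_edge \<dots> (size {#r \<in># B. 1 \<prec> r#}) (size {#r \<in># B. 1 \<preceq> r#})"
    using assms by (intro newton_edge_smult newton_edge_prod) auto
  moreover have "1 \<preceq> x / w \<longleftrightarrow> w \<preceq> x" "x / w \<preceq> 1 \<longleftrightarrow> x \<preceq> w" for x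
    using vle_mult_cancel(1)[of w 1 "x / w"] vle_mult_cancel(1)[of w "x / w" 1] assms(2) by simp_all
  ultimately show ?thesis by (simp add: B_def filter_mset_image_mset o_def)
qed

section \<open>Gauss norms and points away from roots\<close>

lemma coeff_pcompose_shift_vle:
  assumes "\<And>j. \<mu> \<preceq> coeff q j" "1 \<preceq> d"
  shows "\<mu> \<preceq> coeff (q \<circ>\<^sub>p [:d, 1:]) j"
  using assms(1)
proof (induction q arbitrary: j)
  case (pCons a q)
  have IH: "\<mu> \<preceq> coeff (q \<circ>\<^sub>p [:d, 1:]) i" for i
    using pCons.IH pCons.prems by (metis coeff_pCons_Suc)
  have d: "\<mu> \<preceq> d * coeff (q \<circ>\<^sub>p [:d, 1:]) i" for i
    using vle_mult[OF assms(2) IH] by simp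
  have a: "\<mu> \<preceq> a" using pCons.prems[of 0] by simp
  have "\<mu> \<preceq> poly q d * d" using d[of 0] by (simp add: mult.commute)
  thus ?case by (cases j) (auto simp: pcompose_pCons mult.commute[of d] intro!: vle_add IH a d[unfolded mult.commute[of d]])
qed simp

text \<open>With no root closer to \<open>a\<close> than \<open>w\<close>, the edge of the expansion
  at \<open>a\<close> starts at index 0, so the constant term \<open>poly p a\<close> has minimal
  value. The centre \<open>s\<close> lies in the same closed ball, and moving the centre by an
  integral multiple of \<open>w\<close>, forth and back, preserves the minimum.\<close>

lemma poly_eq_gauss_norm:
  assumes "w \<noteq> 0" "w \<preceq> a - s" "\<And>r. p \<noteq> 0 \<Longrightarrow> poly p r = 0 \<Longrightarrow> \<not> w \<prec> r - a"
  shows "poly p a \<preceq> coeff (p \<circ>\<^sub>p [:s, w:]) j" "\<exists>j. coeff (p \<circ>\<^sub>p [:s, w:]) j \<preceq> poly p a"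
proof -
  have *: "(\<forall>j. poly p a \<preceq> coeff (p \<circ>\<^sub>p [:s, w:]) j) \<and> (\<exists>j. coeff (p \<circ>\<^sub>p [:s, w:]) j \<preceq> poly p a)"
    if p: "p \<noteq> 0"
  proof -
    define d where "d = (a - s) / w"
    have d: "1 \<preceq> d" using assms vle_mult_cancel(1)[of w 1 d] by (simp add: d_def)
    let ?q = "p \<circ>\<^sub>p [:s, w:]" and ?r = "p \<circ>\<^sub>p [:a, w:]"
    have "[:s, w:] \<circ>\<^sub>p [:d, 1:] = [:a, w:]" "[:a, w:] \<circ>\<^sub>p [:-d, 1:] = [:s, w:]"
      using assms(1) by (simp_all add: pcompose_pCons d_def)
    hence qr: "?q \<circ>\<^sub>p [:d, 1:] = ?r" "?r \<circ>\<^sub>p [:-d, 1:] = ?q"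
      by (simp_all flip: pcompose_assoc)
    have none: "{#r \<in># proots p. w \<prec> r - a#} = {#}"
      using assms(3) p by (auto simp: multiset_eq_iff order_root)
    have "0 \<in> dominant_indices ?r"
      using dominant_indices_edge(4)[OF newton_edge_ball[OF p assms(1), of a]]
      unfolding none size_empty .
    hence r: "\<And>j. poly p a \<preceq> coeff ?r j" by (simp add: dominant_indices_def)
    hence "\<And>j. poly p a \<preceq> coeff ?q j"
      using coeff_pcompose_shift_vle[of "poly p a" ?r "-d"] d by (simp add: qr)
    moreover obtain l where "\<And>j. coeff ?q l \<preceq> coeff ?q j"
      using dominant_indices_edge(4)[OF newton_edge_ball[OF p assms(1), of s]]
      by (auto simp: dominant_indices_def)
    moreover from this have "coeff ?q l \<preceq> poly p a"
      using coeff_pcompose_shift_vle[of "coeff ?q l" ?q d 0] d by (simp add: qr)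
    ultimately show ?thesis by blast
  qed
  thus "poly p a \<preceq> coeff (p \<circ>\<^sub>p [:s, w:]) j" "\<exists>j. coeff (p \<circ>\<^sub>p [:s, w:]) j \<preceq> poly p a"
    by (cases "p = 0"; simp)+
qed

lemma poly_vle_iff_gauss:
  assumes "w \<noteq> 0" "w \<preceq> a - s" "\<And>r. p \<noteq> 0 \<Longrightarrow> poly p r = 0 \<Longrightarrow> \<not> w \<prec> r - a"
    "\<And>r. q \<noteq> 0 \<Longrightarrow> poly q r = 0 \<Longrightarrow> \<not> w \<prec> r - a"
  shows "poly p a \<preceq> poly q a \<longleftrightarrow>
    (\<exists>j. \<forall>l. coeff (p \<circ>\<^sub>p [:s, w:]) j \<preceq> coeff (q \<circ>\<^sub>p [:s, w:]) l)"
  using poly_eq_gauss_norm[of w a s p] poly_eq_gauss_norm[of w a s q] assms vle_trans by meson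

text \<open>The residue field is infinite, so some residue avoids finitely many given ones.
  Concretely, after division by \<open>w\<close>, a root \<open>z\<close> of the product of all
  \<open>X - b\<close> minus 1 makes every \<open>z - b\<close> a unit.\<close>

lemma generic_point:
  assumes "finite A" "w \<noteq> 0"
  obtains u where "u \<preceq> w" "w \<preceq> u" "\<And>r. r \<in> A \<Longrightarrow> r - u \<preceq> w"
proof -
  have div: "1 \<preceq> x / w \<longleftrightarrow> w \<preceq> x" "x / w \<preceq> 1 \<longleftrightarrow> x \<preceq> w" for x
    using vle_mult_cancel(1)[of w 1 "x / w"] vle_mult_cancel(1)[of w "x / w" 1] assms(2) by simp_all
  \<comment> \<open>Elements with value below that of \<open>w\<close> can be left out, being far
    from \<open>w * z\<close> in any case. The element 0 makes \<open>z\<close> itself a unit and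
    the degree positive.\<close>
  define B where "B = insert 0 ((\<lambda>r. r / w) ` {r \<in> A. w \<preceq> r})"
  have B: "finite B" "0 \<in> B" "\<And>b. b \<in> B \<Longrightarrow> 1 \<preceq> b"
    using assms by (auto simp: B_def div)
  let ?f = "(\<Prod>b\<in>B. [:-b, 1:]) - 1"
  have "degree (\<Prod>b\<in>B. [:-b, 1::'k:]) = card B" by (simp add: degree_prod_eq_sum_degree)
  moreover have "card B > 0" using B by (auto simp: card_gt_0_iff)
  ultimately have "degree ?f > 0"
    by (subst diff_conv_add_uminus, subst degree_add_eq_left) (simp_all only: degree_minus degree_1)
  then obtain z where "poly ?f z = 0" using alg_closed_imp_poly_has_root by blast
  hence z: "(\<Prod>b\<in>B. z - b) = 1" by (simp add: poly_prod)
  \<comment> \<open>If \<open>z\<close> had negative value, so would every factor, and the product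
    could not be 1.\<close>
  have z1: "1 \<preceq> z"
  proof (rule ccontr)
    assume z1: "\<not> 1 \<preceq> z"
    have zb: "z - b \<prec> 1" if "b \<in> B" for b
      using vle_dominant(3)[OF vlt_vle_trans[OF z1 B(3)[OF that]]] z1 vle_trans by blast
    have "\<And>F. finite F \<Longrightarrow> F \<noteq> {} \<Longrightarrow> F \<subseteq> B \<Longrightarrow> (\<Prod>b\<in>F. z - b) \<prec> 1"
    proof -
      fix F assume "finite F" "F \<noteq> {}" "F \<subseteq> B"
      thus "(\<Prod>b\<in>F. z - b) \<prec> 1"
      proof (induction rule: finite_ne_induct)
        case (insert b F)
        hence IH: "(\<Prod>b\<in>F. z - b) \<prec> 1" and b: "z - b \<prec> 1" using zb by auto
        have "(z - b) * (\<Prod>b\<in>F. z - b) \<prec> z - b"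
          using IH b vle_mult_cancel(1)[of "z - b" 1 "\<Prod>b\<in>F. z - b"] by auto
        from vlt_vle_trans[OF this vlt_imp_vle[OF b]] show ?case using insert.hyps by simp
      qed (use zb in auto)
    qed
    from this[of B] show False using B z by auto
  qed
  \<comment> \<open>The other factors are integral and the whole product is 1, so no single factor
    has positive value.\<close>
  have zb: "z - b \<preceq> 1" if "b \<in> B" for b
  proof -
    have "1 \<preceq> (\<Prod>b\<in>F. z - b)" if "finite F" "F \<subseteq> B" for F
      using that
    proof (induction rule: finite_induct)
      case (insert b F)
      thus ?case using vle_mult[of 1 "z - b" 1 "\<Prod>b\<in>F. z - b"] vle_diff[OF z1 B(3)[of b]] by auto
    qed simp
    hence "1 \<preceq> (\<Prod>b\<in>B-{b}. z - b)" using B by auto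
    hence "(z - b) * 1 \<preceq> (z - b) * (\<Prod>b\<in>B-{b}. z - b)" unfolding vle_mult_cancel by simp
    also have "(z - b) * (\<Prod>b\<in>B-{b}. z - b) = 1" using z that B prod.remove[of B b] by metis
    finally show ?thesis by simp
  qed
  have wz: "w * z \<preceq> w" "w \<preceq> w * z"
    using zb[OF B(2)] z1 vle_mult_cancel(1)[of w z 1] vle_mult_cancel(1)[of w 1 z] by auto
  moreover have "r - w * z \<preceq> w" if "r \<in> A" for r
  proof (cases "w \<preceq> r")
    case True
    have "r / w \<in> B" using that True unfolding B_def by blast
    hence "w * (z - r / w) \<preceq> w * 1" unfolding vle_mult_cancel using zb by blast
    moreover have "w * (z - r / w) = w * z - r" using assms(2) by (simp add: algebra_simps)
    ultimately show ?thesis using vle_minus_commute(2)[of "w * z" r w] by simp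
  next
    case False
    hence "r \<prec> w * z" using wz vlt_vle_trans by blast
    thus ?thesis using vle_dominant(3) False vlt_imp_vle vle_trans by blast
  qed
  ultimately show thesis using that by blast
qed

section \<open>Counting the roots outside given open balls\<close>

text \<open>Open balls of the same radius are equal or disjoint; each of those inside the closed ball around
  \<open>s 0\<close> is represented by its first centre, so that its roots are counted once.\<close>

definition ball_representatives :: "(nat \<Rightarrow> 'k) \<Rightarrow> nat \<Rightarrow> 'k \<Rightarrow> nat set" where
  "ball_representatives s L w = {i. i < L \<and> w \<preceq> s i - s 0 \<and> (\<forall>j<i. \<not> w \<prec> s j - s i)}"

lemma ball_representatives_cover:
  assumes "w \<preceq> r - s 0" "c < L" "w \<prec> r - s c"
  shows "\<exists>!i. i \<in> ball_representatives s L w \<and> w \<prec> r - s i"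
proof -
  define i where "i = (LEAST i. w \<prec> r - s i)"
  have i: "w \<prec> r - s i" unfolding i_def by (rule LeastI[of _ c]) (rule assms)
  have least: "\<not> w \<prec> r - s j" if "j < i" for j
    using that not_less_Least unfolding i_def by blast
  have "i \<le> c" unfolding i_def by (rule Least_le) (rule assms)
  hence "i < L" using assms by simp
  have "s i - s 0 = (r - s 0) - (r - s i)" by simp
  hence "w \<preceq> s i - s 0" using vle_diff[OF assms(1) vlt_imp_vle[OF i]] by simp
  moreover have "\<not> w \<prec> s j - s i" if "j < i" for j
  proof
    assume "w \<prec> s j - s i"
    hence "w \<prec> (r - s i) - (s j - s i)" using i vlt_diff by blast
    thus False using least[OF that] by simp
  qed
  ultimately have "i \<in> ball_representatives s L w" 
    using \<open>i < L\<close> by (simp add: ball_representatives_def)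
  moreover have "j = i" if j: "j \<in> ball_representatives s L w" "w \<prec> r - s j" for j
  proof -
    have "w \<prec> (r - s j) - (r - s i)" "w \<prec> (r - s i) - (r - s j)" 
      using i j vlt_diff by blast+
    hence "w \<prec> s i - s j" "w \<prec> s j - s i" by simp_all
    hence "\<not> i < j" using j(1) by (auto simp: ball_representatives_def)
    moreover have "\<not> j < i" using least j(2) by blast
    ultimately show ?thesis by simp
  qed
  ultimately show ?thesis using i by blast
qed

text \<open>A root in the closed ball lies either in no open ball around a centre or in the ball of
  exactly one representative. Induction over the multiset keeps track of multiplicities.\<close>

lemma size_filter_ball:
  "size {#r \<in># A. w \<preceq> r - s 0#} = size {#r \<in># A. w \<preceq> r - s 0 \<and> (\<forall>c<L. \<not> w \<prec> r - s c)#} +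
    (\<Sum>i\<in>ball_representatives s L w. size {#r \<in># A. w \<prec> r - s i#})"
proof (induction A)
  case (add r A)
  let ?R = "ball_representatives s L w"
  have fin: "finite ?R" by (simp add: ball_representatives_def)
  have sub: "w \<preceq> r - s 0" if "i \<in> ?R" "w \<prec> r - s i" for i
  proof -
    have "w \<preceq> (r - s i) + (s i - s 0)" 
      using that vlt_imp_vle by (intro vle_add) (auto simp: ball_representatives_def)
    thus ?thesis by simp
  qed
  have "(\<Sum>i\<in>?R. size {#r \<in># add_mset r A. w \<prec> r - s i#}) =
    (\<Sum>i\<in>?R. size {#r \<in># A. w \<prec> r - s i#}) + (\<Sum>i\<in>?R. if w \<prec> r - s i then 1 else 0)"
    by (subst sum.distrib[symmetric]) (intro sum.cong, auto)
  also have "(\<Sum>i\<in>?R. if w \<prec> r - s i then 1 else 0) = card {i \<in> ?R. w \<prec> r - s i}"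
    using fin by (simp add: sum.If_cases Int_def)
  also have "\<dots> = (if w \<preceq> r - s 0 \<and> \<not> (\<forall>c<L. \<not> w \<prec> r - s c) then 1 else 0)"
  proof (cases "w \<preceq> r - s 0 \<and> \<not> (\<forall>c<L. \<not> w \<prec> r - s c)")
    case True
    then obtain c where "w \<preceq> r - s 0" "c < L" "w \<prec> r - s c" by blast
    from ball_representatives_cover[OF this] obtain i where "{i \<in> ?R. w \<prec> r - s i} = {i}" by blast
    thus ?thesis using True by simp
  next
    case False
    have "{i \<in> ?R. w \<prec> r - s i} = {}"
    proof (rule ccontr)
      assume "{i \<in> ?R. w \<prec> r - s i} \<noteq> {}"
      then obtain i where i: "i \<in> ?R" "w \<prec> r - s i" by blast
      hence "i < L" by (simp add: ball_representatives_def)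
      thus False using False sub[OF i] i by blast
    qed
    thus ?thesis using False by (simp only: card.empty if_False)
  qed
  finally show ?case using add.IH by auto
qed simp

text \<open>The count is expressed through dominant indices of expansions at the centres, hence
  through comparisons that can be transferred.\<close>

lemma size_free_roots:
  assumes "p \<noteq> 0" "w \<noteq> 0"
  shows "size {#r \<in># proots p. w \<preceq> r - s 0 \<and> (\<forall>c<L. \<not> w \<prec> r - s c)#} =
    Max (dominant_indices (p \<circ>\<^sub>p [:s 0, w:])) -
    (\<Sum>i\<in>ball_representatives s L w. Min (dominant_indices (p \<circ>\<^sub>p [:s i, w:])))"
  using size_filter_ball[of w s "proots p" L]
    dominant_indices_edge(1,2)[OF newton_edge_ball[OF assms]] by simp

text \<open>The free roots of \<open>P\<close>, those in the closed ball but in no open ball around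
  a centre, are as many as those of \<open>P'\<close>. As \<open>a\<close> is one of them,
  \<open>P'\<close> has one too, and it serves as \<open>a'\<close>. Near neither point do the
  \<open>S\<close> polynomials have roots, so their values there are Gauss norms, which are compared
  through coefficients.\<close>

lemma root_transfer:
  fixes s s' :: "nat \<Rightarrow> 'k" and S S' :: "'i \<Rightarrow> 'k poly"
  assumes w: "w \<noteq> 0" "w' \<noteq> 0" and P: "P \<noteq> 0" "P' \<noteq> 0"
    and a: "poly P a = 0" "w \<preceq> a - s 0" "\<And>c. c < L \<Longrightarrow> \<not> w \<prec> a - s c" and L: "L > 0"
    and domP: "\<And>c. c < L \<Longrightarrow> dominant_indices (P \<circ>\<^sub>p [:s c, w:]) = dominant_indices (P' \<circ>\<^sub>p [:s' c, w':])"
    and S0: "\<And>k. k \<in> I \<Longrightarrow> S k = 0 \<longleftrightarrow> S' k = 0"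
    and domS: "\<And>k c. k \<in> I \<Longrightarrow> c < L \<Longrightarrow>
      dominant_indices (S k \<circ>\<^sub>p [:s c, w:]) = dominant_indices (S' k \<circ>\<^sub>p [:s' c, w':])"
    and cmp: "\<And>k l i j. k \<in> I \<Longrightarrow> l \<in> I \<Longrightarrow>
      coeff (S k \<circ>\<^sub>p [:s 0, w:]) i \<preceq> coeff (S l \<circ>\<^sub>p [:s 0, w:]) j \<longleftrightarrow>
      coeff (S' k \<circ>\<^sub>p [:s' 0, w':]) i \<preceq> coeff (S' l \<circ>\<^sub>p [:s' 0, w':]) j"
    and centres: "\<And>k r. k \<in> I \<Longrightarrow> S k \<noteq> 0 \<Longrightarrow> poly (S k) r = 0 \<Longrightarrow> \<exists>c<L. r = s c"
    and diffs: "\<And>i j. i < L \<Longrightarrow> j < L \<Longrightarrow> w \<preceq> s i - s j \<longleftrightarrow> w' \<preceq> s' i - s' j"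
      "\<And>i j. i < L \<Longrightarrow> j < L \<Longrightarrow> s i - s j \<preceq> w \<longleftrightarrow> s' i - s' j \<preceq> w'"
  shows "\<exists>a'. poly P' a' = 0 \<and>
    (\<forall>k\<in>I. \<forall>l\<in>I. poly (S k) a \<preceq> poly (S l) a \<longleftrightarrow> poly (S' k) a' \<preceq> poly (S' l) a')"
proof -
  let ?free = "\<lambda>p. {#r \<in># proots p. w \<preceq> r - s 0 \<and> (\<forall>c<L. \<not> w \<prec> r - s c)#}"
  let ?free' = "\<lambda>p. {#r \<in># proots p. w' \<preceq> r - s' 0 \<and> (\<forall>c<L. \<not> w' \<prec> r - s' c)#}"
  have reps: "ball_representatives s L w = ball_representatives s' L w'"
    unfolding ball_representatives_def using diffs L by auto
  have repsL: "i < L" if "i \<in> ball_representatives s' L w'" for i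
    using that by (simp add: ball_representatives_def)
  have count: "size (?free p) = size (?free' p')" if "p \<noteq> 0" "p' \<noteq> 0"
    "\<And>c. c < L \<Longrightarrow> dominant_indices (p \<circ>\<^sub>p [:s c, w:]) = dominant_indices (p' \<circ>\<^sub>p [:s' c, w':])" for p p'
    using that(3) L repsL unfolding size_free_roots[OF that(1) w(1)] size_free_roots[OF that(2) w(2)] reps
    by (auto intro!: arg_cong2[where f = "(-)"] sum.cong)
  have "a \<in># ?free P" using a P(1) by (simp add: order_root)
  hence "size (?free P) \<noteq> 0" by auto
  hence "size (?free' P') \<noteq> 0" by (subst count[OF P domP, symmetric])
  hence "?free' P' \<noteq> {#}" by (simp only: size_eq_0_iff_empty not_False_eq_True)
  then obtain a' where "a' \<in># ?free' P'" by blast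
  hence a': "poly P' a' = 0" "w' \<preceq> a' - s' 0" "\<And>c. c < L \<Longrightarrow> \<not> w' \<prec> a' - s' c"
    using P(2) by auto
  have noS: "\<not> w \<prec> r - a" if "k \<in> I" "S k \<noteq> 0" "poly (S k) r = 0" for k r
  proof -
    from centres[OF that] obtain c where "c < L" "r = s c" by blast
    thus ?thesis using a(3) vle_minus_commute(2) by metis
  qed
  \<comment> \<open>The roots of \<open>S' k\<close> are not assumed to be among the
    \<open>s'\<close>. But a root this close to \<open>a'\<close> would be free like
    \<open>a'\<close>, whereas \<open>S k\<close> has no free root and the counts coincide.\<close>
  have noS': "\<not> w' \<prec> r - a'" if k: "k \<in> I" "S' k \<noteq> 0" "poly (S' k) r = 0" for k r
  proof
    assume r: "w' \<prec> r - a'"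
    have Sk: "S k \<noteq> 0" using S0 k by blast
    have "?free (S k) = {#}"
    proof (rule ccontr)
      assume "?free (S k) \<noteq> {#}"
      then obtain x where "x \<in># ?free (S k)" by blast
      hence x: "poly (S k) x = 0" "\<And>c. c < L \<Longrightarrow> \<not> w \<prec> x - s c" using Sk by auto
      then obtain c where "c < L" "x = s c" using centres[OF k(1) Sk] by blast
      thus False using x(2)[of c] w by simp
    qed
    hence "?free' (S' k) = {#}"
      using count[OF Sk k(2) domS[OF k(1)]] by (simp only: size_empty size_eq_0_iff_empty[symmetric])
    hence "r \<notin># ?free' (S' k)" by simp
    moreover have "w' \<preceq> (r - a') + (a' - s' 0)" using r a' vlt_imp_vle by (intro vle_add) auto
    moreover have "\<not> w' \<prec> r - s' c" if "c < L" for c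
    proof
      assume "w' \<prec> r - s' c"
      hence "w' \<prec> (r - s' c) - (r - a')" using r vlt_diff by blast
      thus False using a'(3)[OF that] by simp
    qed
    ultimately show False using k by auto
  qed
  have "poly (S k) a \<preceq> poly (S l) a \<longleftrightarrow> poly (S' k) a' \<preceq> poly (S' l) a'" if "k \<in> I" "l \<in> I" for k l
  proof -
    have "poly (S k) a \<preceq> poly (S l) a \<longleftrightarrow> (\<exists>i. \<forall>j. 
      coeff (S k \<circ>\<^sub>p [:s 0, w:]) i \<preceq> coeff (S l \<circ>\<^sub>p [:s 0, w:]) j)"
      by (rule poly_vle_iff_gauss[OF w(1) a(2)]) (erule (1) noS[OF that(1)] noS[OF that(2)])+
    moreover have "poly (S' k) a' \<preceq> poly (S' l) a' \<longleftrightarrow> (\<exists>i. \<forall>j. 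
      coeff (S' k \<circ>\<^sub>p [:s' 0, w':]) i \<preceq> coeff (S' l \<circ>\<^sub>p [:s' 0, w':]) j)"
      by (rule poly_vle_iff_gauss[OF w(2) a'(2)]) (erule (1) noS'[OF that(1)] noS'[OF that(2)])+
    ultimately show ?thesis by (simp only: cmp[OF that])
  qed
  thus ?thesis using a'(1) by blast
qed

section \<open>Transfer of radii\<close>

lemma vle_mult_equiv:
  "c \<preceq> c' \<Longrightarrow> c' \<preceq> c \<Longrightarrow> d \<preceq> d' \<Longrightarrow> d' \<preceq> d \<Longrightarrow> A * c \<preceq> B * d \<longleftrightarrow> A * c' \<preceq> B * d'"
  using vle_mult[of A A c c'] vle_mult[of A A c' c] vle_mult[of B B d d'] vle_mult[of B B d' d]
  by (meson vle_refl vle_trans)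

text \<open>Here \<open>w\<close> is an \<open>n\<close>-th root of \<open>x / y\<close> up to a
  unit. Taking \<open>n\<close>-th powers and multiplying by \<open>y ^ (j + l)\<close> clears
  denominators and eliminates \<open>w\<close>.\<close>

lemma monomial_vle_root_iff:
  assumes n: "n > 0" and y: "y \<noteq> 0" and w: "y * w ^ n \<preceq> x" "x \<preceq> y * w ^ n"
  shows "A * w ^ j \<preceq> B * w ^ l \<longleftrightarrow> A ^ n * x ^ j * y ^ l \<preceq> B ^ n * x ^ l * y ^ j"
proof -
  have "A * w ^ j \<preceq> B * w ^ l \<longleftrightarrow> y ^ (j + l) * (A * w ^ j) ^ n \<preceq> y ^ (j + l) * (B * w ^ l) ^ n"
    using vle_power_iff[OF n] y by simp
  also have "y ^ (j + l) * (A * w ^ j) ^ n = (A ^ n * y ^ l) * (y * w ^ n) ^ j"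
    by (simp add: power_mult_distrib power_add flip: power_mult) (simp add: mult_ac)
  also have "y ^ (j + l) * (B * w ^ l) ^ n = (B ^ n * y ^ j) * (y * w ^ n) ^ l"
    by (simp add: power_mult_distrib power_add flip: power_mult) (simp add: mult_ac)
  also have "(A ^ n * y ^ l) * (y * w ^ n) ^ j \<preceq> (B ^ n * y ^ j) * (y * w ^ n) ^ l \<longleftrightarrow>
    (A ^ n * y ^ l) * x ^ j \<preceq> (B ^ n * y ^ j) * x ^ l"
    by (intro vle_mult_equiv vle_power w)
  finally show ?thesis by (simp add: mult_ac)
qed

text \<open>If the terms at two indices \<open>lo < hi\<close> tie, the value of \<open>w\<close> is
  a slope of the Newton polygon and is determined by two coefficients. The same slope is formed on
  the other side, and \<open>w\<close> can be eliminated from all comparisons.\<close>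

lemma radius_transfer_algebraic:
  fixes f f' :: "'i \<Rightarrow> 'k"
  assumes agree: "\<And>A B C A' B' C' n j l n' j' l'. A \<in> \<B> \<Longrightarrow> B \<in> \<B> \<Longrightarrow> C \<in> \<B> \<Longrightarrow> A' \<in> \<B> \<Longrightarrow> B' \<in> \<B> \<Longrightarrow> C' \<in> \<B> \<Longrightarrow>
      n \<le> D \<Longrightarrow> j \<le> D \<Longrightarrow> l \<le> D \<Longrightarrow> n' \<le> D \<Longrightarrow> j' \<le> D \<Longrightarrow> l' \<le> D \<Longrightarrow>
      f A ^ n * f B ^ j * f C ^ l \<preceq> f A' ^ n' * f B' ^ j' * f C' ^ l' \<longleftrightarrow>
      f' A ^ n * f' B ^ j * f' C ^ l \<preceq> f' A' ^ n' * f' B' ^ j' * f' C' ^ l'"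
    and zero: "z \<in> \<B>" "f z = 0" "f' z = 0"
    and lh: "lo < hi" "hi \<le> D"
    and xy: "x \<in> \<B>" "y \<in> \<B>" "f x \<noteq> 0" "f x * w ^ lo \<preceq> f y * w ^ hi" "f y * w ^ hi \<preceq> f x * w ^ lo"
    and w: "w \<noteq> 0"
  shows "\<exists>w'. w' \<noteq> 0 \<and> (\<forall>A\<in>\<B>. \<forall>B\<in>\<B>. \<forall>j\<le>D. \<forall>l\<le>D.
    f A * w ^ j \<preceq> f B * w ^ l \<longleftrightarrow> f' A * w' ^ j \<preceq> f' B * w' ^ l)"
proof -
  define n where "n = hi - lo"
  have n: "n > 0" "n \<le> D" "hi = lo + n" using lh by (auto simp: n_def)
  have D: "1 \<le> D" "0 \<le> D" using lh by auto
  have nz: "f A \<noteq> 0 \<longleftrightarrow> f' A \<noteq> 0" if "A \<in> \<B>" for A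
    using agree[of z A A A A A 1 0 0 1 0 0, OF zero(1) that that that that that D(1) D(2) D(2) D(1) D(2) D(2)]
    by (simp add: zero)
  have y: "f y \<noteq> 0" using xy w by auto
  obtain w' where w': "w' ^ n = f' x / f' y" using nth_root_exists[OF n(1)] by blast
  have nz': "f' x \<noteq> 0" "f' y \<noteq> 0" using nz xy y by auto
  have "w' ^ n \<noteq> 0" using w' nz' by simp
  hence "w' \<noteq> 0" using n by (metis power_0_left less_not_refl)
  have "w ^ lo * (f y * w ^ n) \<preceq> w ^ lo * f x" "w ^ lo * f x \<preceq> w ^ lo * (f y * w ^ n)"
    using xy n by (simp_all add: power_add mult_ac)
  hence wx: "f y * w ^ n \<preceq> f x" "f x \<preceq> f y * w ^ n" using w by auto
  have wx': "f' y * w' ^ n \<preceq> f' x" "f' x \<preceq> f' y * w' ^ n" using w' nz' by auto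
  have "f A * w ^ j \<preceq> f B * w ^ l \<longleftrightarrow> f' A * w' ^ j \<preceq> f' B * w' ^ l"
    if "A \<in> \<B>" "B \<in> \<B>" "j \<le> D" "l \<le> D" for A B j l
    unfolding monomial_vle_root_iff[OF n(1) y wx] monomial_vle_root_iff[OF n(1) nz'(2) wx']
    using that xy n by (intro agree) auto
  thus ?thesis using \<open>w' \<noteq> 0\<close> by blast
qed

lemma root_vle_iff:
  assumes "z ^ n = A / B" "B \<noteq> 0" "n > 0"
  shows "z \<preceq> w \<longleftrightarrow> A \<preceq> B * w ^ n" "w \<preceq> z \<longleftrightarrow> B * w ^ n \<preceq> A"
proof -
  have A: "A = B * z ^ n" using assms by simp
  show "z \<preceq> w \<longleftrightarrow> A \<preceq> B * w ^ n" "w \<preceq> z \<longleftrightarrow> B * w ^ n \<preceq> A"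
    unfolding A vle_mult_cancel using assms vle_power_iff[of n z w] vle_power_iff[of n w z] by simp_all
qed

text \<open>Comparisons of monomials in \<open>w\<close> switch only at the values of the roots
  \<open>\<zeta> (A, B, n)\<close> of \<open>f A / f B\<close>. By agreement these critical values
  are ordered alike on both sides, so \<open>w'\<close> can be placed among them as \<open>w\<close>
  is.\<close>

lemma radius_transfer_transcendental:
  fixes f f' :: "'i \<Rightarrow> 'k"
  assumes agree: "\<And>A B C A' B' C' n j l n' j' l'. A \<in> \<B> \<Longrightarrow> B \<in> \<B> \<Longrightarrow> C \<in> \<B> \<Longrightarrow> A' \<in> \<B> \<Longrightarrow> B' \<in> \<B> \<Longrightarrow> C' \<in> \<B> \<Longrightarrow>
      n \<le> D \<Longrightarrow> j \<le> D \<Longrightarrow> l \<le> D \<Longrightarrow> n' \<le> D \<Longrightarrow> j' \<le> D \<Longrightarrow> l' \<le> D \<Longrightarrow>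
      f A ^ n * f B ^ j * f C ^ l \<preceq> f A' ^ n' * f B' ^ j' * f C' ^ l' \<longleftrightarrow>
      f' A ^ n * f' B ^ j * f' C ^ l \<preceq> f' A' ^ n' * f' B' ^ j' * f' C' ^ l'"
    and zero: "z \<in> \<B>" "f z = 0" "f' z = 0" and fin: "finite \<B>" and D: "1 \<le> D" and w: "w \<noteq> 0"
  shows "\<exists>w'. w' \<noteq> 0 \<and> (\<forall>A\<in>\<B>. \<forall>B\<in>\<B>. \<forall>j\<le>D. \<forall>l\<le>D.
    f A * w ^ j \<preceq> f B * w ^ l \<longleftrightarrow> f' A * w' ^ j \<preceq> f' B * w' ^ l)"
proof -
  have D0: "0 \<le> D" by simp
  have AB: "f A \<preceq> f B \<longleftrightarrow> f' A \<preceq> f' B" if "A \<in> \<B>" "B \<in> \<B>" for A B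
    using agree[of A A A B B B 1 0 0 1 0 0, OF that(1) that(1) that(1) that(2) that(2) that(2) D D0 D0 D D0 D0]
    by simp
  have nz: "f A \<noteq> 0 \<longleftrightarrow> f' A \<noteq> 0" if "A \<in> \<B>" for A
    using AB[OF zero(1) that] by (simp add: zero)
  define I where "I = {(A, B, n). A \<in> \<B> \<and> B \<in> \<B> \<and> f A \<noteq> 0 \<and> f B \<noteq> 0 \<and> n \<in> {1..D}}"
  have I: "finite I"
    by (rule finite_subset[of _ "\<B> \<times> \<B> \<times> {1..D}"]) (auto simp: I_def fin)
  have "\<forall>i\<in>I. \<exists>z. case i of (A, B, n) \<Rightarrow> z ^ n = f A / f B"
    by (auto simp: I_def intro!: nth_root_exists)
  then obtain \<zeta> where "\<forall>i\<in>I. case i of (A, B, n) \<Rightarrow> \<zeta> i ^ n = f A / f B" by metis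
  hence \<zeta>: "\<zeta> (A, B, n) ^ n = f A / f B" if "(A, B, n) \<in> I" for A B n using that by fastforce
  have "\<forall>i\<in>I. \<exists>z. case i of (A, B, n) \<Rightarrow> z ^ n = f' A / f' B"
    by (auto simp: I_def intro!: nth_root_exists)
  then obtain \<zeta>' where "\<forall>i\<in>I. case i of (A, B, n) \<Rightarrow> \<zeta>' i ^ n = f' A / f' B" by metis
  hence \<zeta>': "\<zeta>' (A, B, n) ^ n = f' A / f' B" if "(A, B, n) \<in> I" for A B n using that by fastforce
  have \<zeta>nz: "\<zeta> i \<noteq> 0" "\<zeta>' i \<noteq> 0" if "i \<in> I" for i
    using \<zeta>[of "fst i" "fst (snd i)" "snd (snd i)"] \<zeta>'[of "fst i" "fst (snd i)" "snd (snd i)"] that nz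
    by (auto simp: I_def power_0_left)
  have ord: "\<zeta> i \<preceq> \<zeta> j \<longleftrightarrow> \<zeta>' i \<preceq> \<zeta>' j" if "i \<in> I" "j \<in> I" for i j
  proof -
    obtain A B n C E m where ij: "i = (A, B, n)" "j = (C, E, m)" by (metis prod_cases3)
    have *: "A \<in> \<B>" "B \<in> \<B>" "C \<in> \<B>" "E \<in> \<B>" "n \<in> {1..D}" "m \<in> {1..D}"
      "f A \<noteq> 0" "f B \<noteq> 0" "f C \<noteq> 0" "f E \<noteq> 0" using that by (auto simp: ij I_def)
    hence **: "f' A \<noteq> 0" "f' B \<noteq> 0" "f' C \<noteq> 0" "f' E \<noteq> 0" using nz by auto
    \<comment> \<open>Raising to the power \<open>n * m\<close> and clearing denominators leaves
      monomials; the factor \<open>b ^ 0\<close> fills the third slot of the shape on which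
      agreement is assumed.\<close>
    have gen: "x \<preceq> y \<longleftrightarrow> a ^ m * e ^ n * b ^ 0 \<preceq> c ^ n * b ^ m * b ^ 0"
      if x: "x ^ n = a / b" and y: "y ^ m = c / e" and nz: "b \<noteq> 0" "e \<noteq> 0" for x y a b c e :: 'k
    proof -
      have "n * m > 0" using * by auto
      hence "x \<preceq> y \<longleftrightarrow> x ^ (n * m) \<preceq> y ^ (n * m)" by (simp add: vle_power_iff)
      also have "x ^ (n * m) = a ^ m / b ^ m" by (simp add: power_mult x power_divide)
      also have "y ^ (n * m) = c ^ n / e ^ n" by (simp add: power_mult y power_divide mult.commute[of n])
      also have "a ^ m / b ^ m \<preceq> c ^ n / e ^ n \<longleftrightarrow>
        (b ^ m * e ^ n) * (a ^ m / b ^ m) \<preceq> (b ^ m * e ^ n) * (c ^ n / e ^ n)" 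
        unfolding vle_mult_cancel using nz by simp
      also have "(b ^ m * e ^ n) * (a ^ m / b ^ m) = a ^ m * e ^ n" using nz by (simp add: field_simps)
      also have "(b ^ m * e ^ n) * (c ^ n / e ^ n) = c ^ n * b ^ m" using nz by (simp add: field_simps)
      finally show ?thesis by simp
    qed
    have "\<zeta> i \<preceq> \<zeta> j \<longleftrightarrow> f A ^ m * f E ^ n * f B ^ 0 \<preceq> f C ^ n * f B ^ m * f B ^ 0"
      using \<zeta> that * unfolding ij by (intro gen) auto
    also have "\<dots> \<longleftrightarrow> f' A ^ m * f' E ^ n * f' B ^ 0 \<preceq> f' C ^ n * f' B ^ m * f' B ^ 0"
      using * by (intro agree) auto
    also have "\<dots> \<longleftrightarrow> \<zeta>' i \<preceq> \<zeta>' j"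
      using \<zeta>' that ** unfolding ij by (intro gen[symmetric]) auto
    finally show ?thesis .
  qed
  obtain w' where w'0: "w' \<noteq> 0" and
    all: "\<forall>i\<in>I. (\<zeta> i \<preceq> w \<longleftrightarrow> \<zeta>' i \<preceq> w') \<and> (w \<preceq> \<zeta> i \<longleftrightarrow> w' \<preceq> \<zeta>' i)"
  proof -
    have "\<exists>w'. w' \<noteq> 0 \<and> (\<forall>i\<in>I. (\<zeta> i \<preceq> w \<longleftrightarrow> \<zeta>' i \<preceq> w') \<and> (w \<preceq> \<zeta> i \<longleftrightarrow> w' \<preceq> \<zeta>' i))"
      by (rule value_group_extension[where z = \<zeta> and z' = \<zeta>', OF I \<zeta>nz ord w])
    thus thesis using that by (elim exE conjE)
  qed
  note w' = w'0 all[THEN bspec]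
  have "f A * w ^ j \<preceq> f B * w ^ l \<longleftrightarrow> f' A * w' ^ j \<preceq> f' B * w' ^ l"
    if *: "A \<in> \<B>" "B \<in> \<B>" "j \<le> D" "l \<le> D" for A B j l
  proof (cases "f A = 0 \<or> f B = 0")
    case True
    thus ?thesis using nz[of A] nz[of B] * w w'(1) by auto
  next
    case False
    hence F: "f A \<noteq> 0" "f B \<noteq> 0" "f' A \<noteq> 0" "f' B \<noteq> 0" using nz * by auto
    consider "j < l" | "j = l" | "l < j" by linarith
    thus ?thesis
    proof cases
      case 1
      define n where "n = l - j"
      have n: "l = j + n" "n > 0" "(A, B, n) \<in> I" using 1 * F by (auto simp: n_def I_def)
      have "u \<noteq> 0 \<Longrightarrow> a * u ^ j \<preceq> b * u ^ l \<longleftrightarrow> a \<preceq> b * u ^ n" for u a b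
        using vle_mult_cancel(1)[of "u ^ j" a "b * u ^ n"] by (simp add: n power_add mult_ac)
      thus ?thesis
        using root_vle_iff(1)[OF \<zeta>[OF n(3)] F(2) n(2), of w] root_vle_iff(1)[OF \<zeta>'[OF n(3)] F(4) n(2), of w']
          w'(2)[OF n(3)] w w'(1) by simp
    next
      case 2
      thus ?thesis using AB[OF *(1,2)] w w'(1) by simp
    next
      case 3
      define n where "n = j - l"
      have n: "j = l + n" "n > 0" "(B, A, n) \<in> I" using 3 * F by (auto simp: n_def I_def)
      have "u \<noteq> 0 \<Longrightarrow> a * u ^ j \<preceq> b * u ^ l \<longleftrightarrow> a * u ^ n \<preceq> b" for u a b
        using vle_mult_cancel(1)[of "u ^ l" "a * u ^ n" b] by (simp add: n power_add mult_ac)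
      thus ?thesis
        using root_vle_iff(2)[OF \<zeta>[OF n(3)] F(1) n(2), of w] root_vle_iff(2)[OF \<zeta>'[OF n(3)] F(3) n(2), of w']
          w'(2)[OF n(3)] w w'(1) by simp
    qed
  qed
  thus ?thesis using w'(1) by blast
qed

end

section \<open>Polynomial functions and finite types\<close>

text \<open>Constants account for the parameters of formulas.\<close>

inductive_set polyfun :: "((nat \<Rightarrow> 'a::field) \<Rightarrow> 'a) set" where
  const: "(\<lambda>e. c) \<in> polyfun"
| var: "(\<lambda>e. e i) \<in> polyfun"
| add: "f \<in> polyfun \<Longrightarrow> g \<in> polyfun \<Longrightarrow> (\<lambda>e. f e + g e) \<in> polyfun"
| mult: "f \<in> polyfun \<Longrightarrow> g \<in> polyfun \<Longrightarrow> (\<lambda>e. f e * g e) \<in> polyfun"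

lemma polyfun_uminus: "f \<in> polyfun \<Longrightarrow> (\<lambda>e. - f e) \<in> polyfun"
  using polyfun.mult[OF polyfun.const[of "-1"], of f] by simp

lemma polyfun_diff: "f \<in> polyfun \<Longrightarrow> g \<in> polyfun \<Longrightarrow> (\<lambda>e. f e - g e) \<in> polyfun"
  using polyfun.add[OF _ polyfun_uminus, of f g] by simp

lemma polyfun_power: "f \<in> polyfun \<Longrightarrow> (\<lambda>e. f e ^ n) \<in> polyfun"
  by (induction n) (auto intro: polyfun.intros)

lemma polyfun_sum: "(\<And>i. i \<in> A \<Longrightarrow> f i \<in> polyfun) \<Longrightarrow> (\<lambda>e. \<Sum>i\<in>A. f i e) \<in> polyfun"
  by (induction A rule: infinite_finite_induct) (auto intro: polyfun.intros)

lemma polyfun_subst: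
  "f \<in> polyfun \<Longrightarrow> (\<And>i. (\<lambda>e. \<sigma> e i) \<in> polyfun) \<Longrightarrow> (\<lambda>e. f (\<sigma> e)) \<in> polyfun"
  by (induction rule: polyfun.induct) (auto intro: polyfun.intros)

section \<open>Univariate polynomials depending polynomially on parameters\<close>

definition polyfam :: "nat \<Rightarrow> ((nat \<Rightarrow> 'a::field) \<Rightarrow> 'a poly) \<Rightarrow> bool" where
  "polyfam d F \<longleftrightarrow> (\<forall>j. (\<lambda>e. coeff (F e) j) \<in> polyfun) \<and> (\<forall>e. degree (F e) \<le> d)"

lemma polyfam_coeff: "polyfam d F \<Longrightarrow> (\<lambda>e. coeff (F e) j) \<in> polyfun"
  by (simp add: polyfam_def)

lemma polyfam_degree: "polyfam d F \<Longrightarrow> degree (F e) \<le> d"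
  by (simp add: polyfam_def)

lemma polyfam_mono: "polyfam d F \<Longrightarrow> d \<le> d' \<Longrightarrow> polyfam d' F"
  unfolding polyfam_def using le_trans by blast

lemma polyfam_add: "polyfam d F \<Longrightarrow> polyfam d G \<Longrightarrow> polyfam d (\<lambda>e. F e + G e)"
  by (auto simp: polyfam_def intro: polyfun.add degree_add_le)

lemma polyfam_diff: "polyfam d F \<Longrightarrow> polyfam d G \<Longrightarrow> polyfam d (\<lambda>e. F e - G e)"
  by (auto simp: polyfam_def intro: polyfun_diff degree_diff_le)

lemma polyfam_mult: "polyfam d F \<Longrightarrow> polyfam d' G \<Longrightarrow> polyfam (d + d') (\<lambda>e. F e * G e)"
  by (auto simp: polyfam_def coeff_mult intro!: polyfun_sum polyfun.mult 
      intro: order_trans[OF degree_mult_le add_mono])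

lemma polyfam_smult:
  "f \<in> polyfun \<Longrightarrow> polyfam d F \<Longrightarrow> polyfam d (\<lambda>e. Polynomial.smult (f e) (F e))"
  by (auto simp: polyfam_def intro!: polyfun.mult intro: order_trans[OF degree_smult_le])

lemma polyfam_monom: 
  assumes "f \<in> polyfun" "n \<le> d" shows "polyfam d (\<lambda>e. Polynomial.monom (f e) n)"
proof -
  have "(\<lambda>e. coeff (Polynomial.monom (f e) n) j) \<in> polyfun" for j
    using assms by (cases "n = j") (auto simp: coeff_monom polyfun.const)
  thus ?thesis using assms(2) by (auto simp: polyfam_def intro: order_trans[OF degree_monom_le])
qed

lemma polyfam_linear: 
  assumes "f \<in> polyfun" shows "polyfam 1 (\<lambda>e. [:f e, c:])"
proof -
  have "(\<lambda>e. coeff [:f e, c:] j) \<in> polyfun" for j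
  proof (cases j)
    case (Suc i)
    thus ?thesis by (cases i) (simp_all add: polyfun.const)
  qed (simp add: assms)
  thus ?thesis by (simp add: polyfam_def)
qed

lemma polyfam_power: "polyfam d F \<Longrightarrow> polyfam (n * d) (\<lambda>e. F e ^ n)"
proof (induction n)
  case 0
  show ?case using polyfam_monom[OF polyfun.const[of 1], of 0 0] by (simp add: monom_0 one_pCons)
next
  case (Suc n)
  thus ?case using polyfam_mult[of d F "n * d" "\<lambda>e. F e ^ n"] by simp
qed

lemma polyfam_subst:
  "polyfam d F \<Longrightarrow> (\<And>i. (\<lambda>e. \<sigma> e i) \<in> polyfun) \<Longrightarrow> polyfam d (\<lambda>e. F (\<sigma> e))"
  by (auto simp: polyfam_def intro: polyfun_subst[where \<sigma> = \<sigma>])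

lemma poly_eq_sum_le: 
  "degree p \<le> d \<Longrightarrow> poly p x = (\<Sum>i\<le>d. coeff p i * (x :: 'a::comm_ring_1) ^ i)"
  unfolding poly_altdef[of p] by (rule sum.mono_neutral_left) (auto simp: coeff_eq_0)

lemma polyfam_poly: 
  assumes "polyfam d F" "g \<in> polyfun" shows "(\<lambda>e. poly (F e) (g e)) \<in> polyfun"
  unfolding poly_eq_sum_le[OF polyfam_degree[OF assms(1)]]
  by (intro polyfun_sum polyfun.mult polyfam_coeff[OF assms(1)] polyfun_power assms)

lemma pcompose_eq_sum_le:
  fixes p q :: "'a::comm_ring_1 poly"
  assumes "degree p \<le> d" shows "p \<circ>\<^sub>p q = (\<Sum>i\<le>d. Polynomial.smult (coeff p i) (q ^ i))"
proof -
  have "degree (map_poly (\<lambda>x. [:x:]) p) \<le> d" 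
    using assms by (intro degree_le) (auto simp: coeff_map_poly coeff_eq_0)
  thus ?thesis unfolding pcompose_altdef by (simp add: poly_eq_sum_le coeff_map_poly)
qed

lemma polyfam_taylor:
  assumes "polyfam d F" "g \<in> polyfun" shows "polyfam d (\<lambda>e. F e \<circ>\<^sub>p [:g e, 1:])"
proof -
  have "(\<lambda>e. coeff (F e \<circ>\<^sub>p [:g e, 1:]) j) \<in> polyfun" for j
    unfolding pcompose_eq_sum_le[OF polyfam_degree[OF assms(1)]] coeff_sum coeff_smult
    by (intro polyfun_sum polyfun.mult polyfam_coeff[OF assms(1)]
        polyfam_coeff[OF polyfam_power[OF polyfam_linear[OF assms(2)]]])
  thus ?thesis
    using polyfam_degree[OF assms(1)] degree_pcompose_le[of "F e" "[:g e, 1:]" for e]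
    by (auto simp: polyfam_def intro: le_trans[of _ "degree (F _)"])
qed

text \<open>Variable 0, the one a quantifier binds, is singled out; the others become parameters of
  the coefficients.\<close>

lemma polyfun_case_nat:
  assumes "f \<in> polyfun" obtains d F where "polyfam d F" "\<And>e a. f (case_nat a e) = poly (F e) a"
proof -
  have "\<exists>d F. polyfam d F \<and> (\<forall>e a. f (case_nat a e) = poly (F e) a)"
    using assms
  proof induction
    case (const c)
    show ?case
      by (intro exI[of _ 1] exI[of _ "\<lambda>_. [:c, 0:]"]) (simp add: polyfam_linear[OF polyfun.const, of c 0, simplified])
  next
    case (var i)
    show ?case
    proof (cases i)
      case 0
      thus ?thesis
        using polyfam_linear[OF polyfun.const[of 0], of 1] 
        by (intro exI[of _ 1] exI[of _ "\<lambda>_. [:0, 1:]"]) simp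
    next
      case (Suc j)
      thus ?thesis
        by (intro exI[of _ 1] exI[of _ "\<lambda>e. [:e j, 0:]"]) (simp add: polyfam_linear[OF polyfun.var, of j 0, simplified])
    qed
  next
    case (add f g)
    then obtain d F d' G where *: "polyfam d F" "polyfam d' G"
      "\<And>e a. f (case_nat a e) = poly (F e) a" "\<And>e a. g (case_nat a e) = poly (G e) a" by blast
    show ?case
      using * polyfam_add[of "max d d'" F G] polyfam_mono[of d F "max d d'"] polyfam_mono[of d' G "max d d'"]
      by (intro exI[of _ "max d d'"] exI[of _ "\<lambda>e. F e + G e"]) auto
  next
    case (mult f g)
    then obtain d F d' G where *: "polyfam d F" "polyfam d' G"
      "\<And>e a. f (case_nat a e) = poly (F e) a" "\<And>e a. g (case_nat a e) = poly (G e) a" by blast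
    show ?case
      using * polyfam_mult by (intro exI[of _ "d + d'"] exI[of _ "\<lambda>e. F e * G e"]) auto
  qed
  thus thesis using that by blast
qed

text \<open>The leading coefficient depends on \<open>e\<close> and has no inverse among polynomial
  functions, hence a pseudo-remainder. At a root of \<open>F e\<close> the subtracted multiple of
  \<open>F e\<close> disappears, so the identity holds there even when the leading coefficient is
  0.\<close>

lemma polyfam_pseudo_remainder:
  assumes "polyfam (Suc d) F" "polyfam m G"
  shows "\<exists>N R. polyfam d R \<and>
    (\<forall>e a. poly (F e) a = 0 \<longrightarrow> coeff (F e) (Suc d) ^ N * poly (G e) a = poly (R e) a)"
  using assms(2)
proof (induction m arbitrary: G)
  case 0
  thus ?case using polyfam_mono[of 0 G d] by (intro exI[of _ 0] exI[of _ G]) auto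
next
  case (Suc m)
  show ?case
  proof (cases "Suc m \<le> d")
    case True
    thus ?thesis using polyfam_mono[OF Suc.prems True] by (intro exI[of _ 0] exI[of _ G]) auto
  next
    case False
    let ?lc = "\<lambda>e. coeff (F e) (Suc d)"
    \<comment> \<open>Cross-multiplication by the leading coefficients cancels the term of degree
      \<open>Suc m\<close>.\<close>
    define H where "H = (\<lambda>e. Polynomial.smult (?lc e) (G e) - 
      Polynomial.monom (coeff (G e) (Suc m)) (m - d) * F e)"
    have lc: "?lc \<in> polyfun" by (rule polyfam_coeff[OF assms(1)])
    have "polyfam (m - d + Suc d) (\<lambda>e. Polynomial.monom (coeff (G e) (Suc m)) (m - d) * F e)"
      by (intro polyfam_mult polyfam_monom polyfam_coeff[OF Suc.prems] assms) simp
    hence H: "polyfam (Suc m) H"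
      unfolding H_def using False by (intro polyfam_diff polyfam_smult lc Suc.prems) simp
    have "coeff (H e) (Suc m) = 0" for e
    proof -
      have "Suc m = (m - d) + Suc d" using False by simp
      hence "coeff (Polynomial.monom (coeff (G e) (Suc m)) (m - d) * F e) (Suc m) = 
        coeff (G e) (Suc m) * ?lc e"
        using coeff_monom_mult[of "coeff (G e) (Suc m)" "m - d" "F e" "Suc m"] by simp
      thus ?thesis by (simp add: H_def)
    qed
    hence "degree (H e) \<le> m" for e
      using polyfam_degree[OF H] eq_zero_or_degree_less[of "H e" "Suc m"] by (auto simp: less_Suc_eq_le)
    hence "polyfam m H" using H by (simp add: polyfam_def)
    from Suc.IH[OF this] obtain N R where R: "polyfam d R"
      "\<And>e a. poly (F e) a = 0 \<Longrightarrow> ?lc e ^ N * poly (H e) a = poly (R e) a" by blast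
    have "?lc e ^ Suc N * poly (G e) a = poly (R e) a" if "poly (F e) a = 0" for e a
      using R(2)[OF that] that by (simp add: H_def mult_ac)
    thus ?thesis using R(1) by blast
  qed
qed

section \<open>Environments extended by centres\<close>

definition prepend :: "'a list \<Rightarrow> (nat \<Rightarrow> 'a) \<Rightarrow> nat \<Rightarrow> 'a" where
  "prepend xs e i = (if i < length xs then xs ! i else e (i - length xs))"

lemma prepend_Nil [simp]: "prepend [] e = e"
  by (simp add: prepend_def fun_eq_iff)

lemma prepend_Cons: "prepend (x # xs) e = case_nat x (prepend xs e)"
  by (auto simp: prepend_def fun_eq_iff split: nat.split)

lemma prepend_shift [simp]: "length xs = l \<Longrightarrow> prepend xs e (i + l) = e i"
  by (simp add: prepend_def)

lemma prepend_nth [simp]: "i < length xs \<Longrightarrow> prepend xs e i = xs ! i"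
  by (simp add: prepend_def)

text \<open>The first \<open>L\<close> variables of \<open>X\<close> are centres and the original
  parameters follow them, so the Taylor coefficient at a centre is again a polynomial
  function.\<close>

definition taylor_fun :: "nat \<Rightarrow> ((nat \<Rightarrow> 'a::field) \<Rightarrow> 'a poly) \<Rightarrow> nat \<Rightarrow> nat \<Rightarrow> (nat \<Rightarrow> 'a) \<Rightarrow> 'a" where
  "taylor_fun L G c j X = coeff (G (\<lambda>i. X (i + L)) \<circ>\<^sub>p [:X c, 1:]) j"

lemma polyfun_taylor_fun: "polyfam d G \<Longrightarrow> taylor_fun L G c j \<in> polyfun"
  unfolding taylor_fun_def
  by (intro polyfam_coeff polyfam_taylor polyfun.var polyfam_subst[where \<sigma> = "\<lambda>X i. X (i + L)"])

text \<open>Three factors are what remains when an algebraic radius is eliminated: a base function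
  and the two coefficients that determine the radius.\<close>

definition monomials :: "nat \<Rightarrow> ((nat \<Rightarrow> 'a::field) \<Rightarrow> 'a) set \<Rightarrow> ((nat \<Rightarrow> 'a) \<Rightarrow> 'a) set" where
  "monomials D \<B> = (\<lambda>(A, B, C, n, j, l) X. A X ^ n * B X ^ j * C X ^ l) `
    (\<B> \<times> \<B> \<times> \<B> \<times> {..D} \<times> {..D} \<times> {..D})"

lemma monomials_polyfun: "\<B> \<subseteq> polyfun \<Longrightarrow> monomials D \<B> \<subseteq> polyfun"
  by (auto simp: monomials_def intro!: polyfun.mult polyfun_power)

lemma finite_monomials: "finite \<B> \<Longrightarrow> finite (monomials D \<B>)"
  by (simp add: monomials_def)

lemma monomialsI: 
  "A \<in> \<B> \<Longrightarrow> B \<in> \<B> \<Longrightarrow> C \<in> \<B> \<Longrightarrow> n \<le> D \<Longrightarrow> j \<le> D \<Longrightarrow> l \<le> D \<Longrightarrow> 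
    (\<lambda>X. A X ^ n * B X ^ j * C X ^ l) \<in> monomials D \<B>"
  unfolding monomials_def by (rule image_eqI[of _ _ "(A, B, C, n, j, l)"]) auto

lemma coeff_pcompose_scale: "coeff (p \<circ>\<^sub>p [:s, w:]) j = coeff (p \<circ>\<^sub>p [:s, 1:]) j * (w :: 'a::field) ^ j"
proof -
  have "[:s, w:] = [:s, 1:] \<circ>\<^sub>p [:0, w:]" by (simp add: pcompose_pCons)
  thus ?thesis by (simp add: pcompose_assoc coeff_pcompose_linear mult.commute)
qed

section \<open>Uniform transfer along agreement\<close>

context acvf
begin

text \<open>A finite fragment of the quantifier-free type. If \<open>\<lambda>_. 0\<close> is in
  \<open>T\<close>, the members of \<open>T\<close> also vanish at the same time.\<close>

definition agree :: "((nat \<Rightarrow> 'k) \<Rightarrow> 'k) set \<Rightarrow> (nat \<Rightarrow> 'k) \<Rightarrow> (nat \<Rightarrow> 'k) \<Rightarrow> bool" where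
  "agree T e e' \<longleftrightarrow> (\<forall>s\<in>T. \<forall>t\<in>T. s e \<preceq> t e \<longleftrightarrow> s e' \<preceq> t e')"

lemma agree_mono: "agree T e e' \<Longrightarrow> T' \<subseteq> T \<Longrightarrow> agree T' e e'"
  by (auto simp: agree_def)

lemma agree_sym: "agree T e e' \<Longrightarrow> agree T e' e"
  by (auto simp: agree_def)

lemma agreeD: "agree T e e' \<Longrightarrow> s \<in> T \<Longrightarrow> t \<in> T \<Longrightarrow> s e \<preceq> t e \<longleftrightarrow> s e' \<preceq> t e'"
  by (auto simp: agree_def)

lemma agree_zero_iff: "agree T e e' \<Longrightarrow> (\<lambda>_. 0) \<in> T \<Longrightarrow> t \<in> T \<Longrightarrow> t e = 0 \<longleftrightarrow> t e' = 0"
  using agreeD[of T e e' "\<lambda>_. 0" t] by simp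

definition transfers :: "((nat \<Rightarrow> 'k) \<Rightarrow> (nat \<Rightarrow> 'k) \<Rightarrow> bool) \<Rightarrow> bool" where
  "transfers Q \<longleftrightarrow> (\<exists>T. finite T \<and> T \<subseteq> polyfun \<and> (\<forall>e e'. agree T e e' \<longrightarrow> Q e e'))"

lemma transfersI:
  "finite T \<Longrightarrow> T \<subseteq> polyfun \<Longrightarrow> (\<And>e e'. agree T e e' \<Longrightarrow> Q e e') \<Longrightarrow> transfers Q"
  unfolding transfers_def by (rule exI[of _ T]) simp

lemma transfersE:
  assumes "transfers Q"
  obtains T where "finite T" "T \<subseteq> polyfun" "\<And>e e'. agree T e e' \<Longrightarrow> Q e e'"
  using assms unfolding transfers_def by (elim exE conjE) simp

lemma transfers_agree: "finite T \<Longrightarrow> T \<subseteq> polyfun \<Longrightarrow> transfers (agree T)"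
  by (rule transfersI)

lemma transfers_mono: 
  assumes "transfers Q" "\<And>e e'. Q e e' \<Longrightarrow> R e e'" shows "transfers R"
proof (rule transfersE[OF assms(1)])
  fix T assume T: "finite T" "T \<subseteq> polyfun" "\<And>e e'. agree T e e' \<Longrightarrow> Q e e'"
  show ?thesis by (rule transfersI[OF T(1,2)]) (rule assms(2), rule T(3))
qed

lemma transfers_ball:
  assumes "finite I" "\<And>i. i \<in> I \<Longrightarrow> transfers (Q i)"
  shows "transfers (\<lambda>e e'. \<forall>i\<in>I. Q i e e')"
proof -
  have "\<forall>i\<in>I. \<exists>T. finite T \<and> T \<subseteq> polyfun \<and> (\<forall>e e'. agree T e e' \<longrightarrow> Q i e e')"
    using assms(2) unfolding transfers_def by blast
  from bchoice[OF this] obtain U where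
    U: "\<forall>i\<in>I. finite (U i) \<and> U i \<subseteq> polyfun \<and> (\<forall>e e'. agree (U i) e e' \<longrightarrow> Q i e e')" ..
  show ?thesis
  proof (rule transfersI[of "\<Union>i\<in>I. U i"])
    fix e e' assume *: "agree (\<Union>i\<in>I. U i) e e'"
    have "agree (U i) e e'" if "i \<in> I" for i
      using * by (rule agree_mono) (use that in blast)
    thus "\<forall>i\<in>I. Q i e e'" using U by simp
  qed (use U assms(1) in auto)
qed

lemma transfers_conj:
  assumes "transfers Q" "transfers R" shows "transfers (\<lambda>e e'. Q e e' \<and> R e e')"
proof -
  have "transfers (if b then Q else R)" for b using assms by simp
  hence "transfers (\<lambda>e e'. \<forall>b\<in>{True, False}. (if b then Q else R) e e')"
    by (intro transfers_ball) simp_all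
  thus ?thesis by (rule transfers_mono) auto
qed

lemma transfers_zero_iff:
  assumes "t \<in> polyfun" shows "transfers (\<lambda>e e'. t e = 0 \<longleftrightarrow> t e' = 0)"
  by (rule transfersI[of "{\<lambda>_. 0, t}"]) (auto simp: agree_def intro: assms polyfun.const)

lemma transfers_sym: "transfers Q \<Longrightarrow> transfers (\<lambda>e e'. Q e' e)"
  by (erule transfersE, rule transfersI) (auto dest: agree_sym)

text \<open>That \<open>a'\<close> is again a root need not be demanded: it is enforced, where
  wanted, by putting the value of \<open>F\<close> and the zero function into
  \<open>T\<close>.\<close>

definition root_matching :: "nat \<Rightarrow> bool" where
  "root_matching d \<longleftrightarrow> (\<forall>F T. polyfam d F \<longrightarrow> finite T \<longrightarrow> T \<subseteq> polyfun \<longrightarrow>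
    transfers (\<lambda>e e'. \<forall>a. F e \<noteq> 0 \<longrightarrow> poly (F e) a = 0 \<longrightarrow>
      (\<exists>a'. agree T (case_nat a e) (case_nat a' e'))))"

lemma root_matchingD:
  "root_matching d \<Longrightarrow> polyfam d F \<Longrightarrow> finite T \<Longrightarrow> T \<subseteq> polyfun \<Longrightarrow>
    transfers (\<lambda>e e'. \<forall>a. F e \<noteq> 0 \<longrightarrow> poly (F e) a = 0 \<longrightarrow>
      (\<exists>a'. agree T (case_nat a e) (case_nat a' e')))"
  by (simp add: root_matching_def)

lemma polyfun_case_nat_subst:
  assumes "f \<in> polyfun" "g \<in> polyfun" shows "(\<lambda>e. f (case_nat (g e) e)) \<in> polyfun"
proof -
  have "(\<lambda>e. (case i of 0 \<Rightarrow> g e | Suc j \<Rightarrow> e j)) \<in> polyfun" for i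
    using assms by (cases i) (auto intro: polyfun.var)
  thus ?thesis using polyfun_subst[OF assms(1), of "\<lambda>e. case_nat (g e) e"] by simp
qed

text \<open>All entries are roots over the same \<open>e\<close>. The entry 0 is always allowed; it
  serves as padding and as a centre when there is no root.\<close>

definition lists_match :: "nat \<Rightarrow> ((nat \<Rightarrow> 'k) \<Rightarrow> 'k poly) set \<Rightarrow> ((nat \<Rightarrow> 'k) \<Rightarrow> 'k) set \<Rightarrow>
    (nat \<Rightarrow> 'k) \<Rightarrow> (nat \<Rightarrow> 'k) \<Rightarrow> bool" where
  "lists_match l \<F> T e e' \<longleftrightarrow> (\<forall>xs. length xs = l \<longrightarrow>
    (\<forall>x\<in>set xs. x = 0 \<or> (\<exists>F\<in>\<F>. F e \<noteq> 0 \<and> poly (F e) x = 0)) \<longrightarrow>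
    (\<exists>xs'. length xs' = l \<and> agree T (prepend xs e) (prepend xs' e')))"

text \<open>Entries are matched one at a time: what is needed to match the front entry is pulled
  back to a finite set \<open>T1\<close>, on which the remaining entries are required to
  agree.\<close>

lemma transfers_lists_match:
  assumes "root_matching d" "finite \<F>" "\<And>F. F \<in> \<F> \<Longrightarrow> polyfam d F" "finite T" "T \<subseteq> polyfun"
  shows "transfers (lists_match l \<F> T)"
  unfolding lists_match_def[abs_def]
  using assms(4,5)
proof (induction l arbitrary: T)
  case 0
  show ?case
    by (rule transfers_mono[OF transfers_agree[OF 0]]) simp
next
  case (Suc l)
  \<comment> \<open>The \<open>l\<close> entries already matched precede the parameters, so
    \<open>F\<close> reads the environment behind them.\<close>
  let ?Q = "\<lambda>F e e'. \<forall>a. F (\<lambda>i. e (i + l)) \<noteq> 0 \<longrightarrow> poly (F (\<lambda>i. e (i + l))) a = 0 \<longrightarrow>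
      (\<exists>a'. agree T (case_nat a e) (case_nat a' e'))"
  have "transfers (?Q F)" if "F \<in> \<F>" for F
  proof (rule root_matchingD[OF assms(1) _ Suc.prems])
    show "polyfam d (\<lambda>e. F (\<lambda>i. e (i + l)))"
      by (rule polyfam_subst[where \<sigma> = "\<lambda>e i. e (i + l)"]) (rule assms(3)[OF that], rule polyfun.var)
  qed
  from transfers_ball[OF assms(2) this] 
  have Q: "transfers (\<lambda>e e'. \<forall>F\<in>\<F>. ?Q F e e')" by simp
  \<comment> \<open>A padding entry 0 is matched by 0, which requires agreement after substituting 0
    for the new variable.\<close>
  have "(\<lambda>s e. s (case_nat 0 e)) ` T \<subseteq> polyfun"
    using Suc.prems polyfun_case_nat_subst[OF _ polyfun.const] by auto
  hence Z: "transfers (agree ((\<lambda>s e. s (case_nat 0 e)) ` T))"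
    by (intro transfers_agree) (simp add: Suc.prems)
  obtain T1 where T1: "finite T1" "T1 \<subseteq> polyfun"
    "\<And>e e'. agree T1 e e' \<Longrightarrow> (\<forall>F\<in>\<F>. ?Q F e e') \<and> agree ((\<lambda>s e. s (case_nat 0 e)) ` T) e e'"
    by (rule transfersE[OF transfers_conj[OF Q Z]]) (rule that)
  show ?case
  proof (rule transfers_mono[OF Suc.IH[OF T1(1,2)]], intro allI impI)
    fix e e' xs
    assume IH: "\<forall>xs. length xs = l \<longrightarrow>
      (\<forall>x\<in>set xs. x = 0 \<or> (\<exists>F\<in>\<F>. F e \<noteq> 0 \<and> poly (F e) x = 0)) \<longrightarrow>
      (\<exists>xs'. length xs' = l \<and> agree T1 (prepend xs e) (prepend xs' e'))"
      and len: "length xs = Suc l"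
      and roots: "\<forall>x\<in>set xs. x = 0 \<or> (\<exists>F\<in>\<F>. F e \<noteq> 0 \<and> poly (F e) x = 0)"
    obtain x ys where xs: "xs = x # ys" "length ys = l" using len by (cases xs) auto
    obtain ys' where ys': "length ys' = l" "agree T1 (prepend ys e) (prepend ys' e')"
      using IH[rule_format, OF xs(2)] roots xs(1) by auto
    have "\<exists>x'. agree T (case_nat x (prepend ys e)) (case_nat x' (prepend ys' e'))"
    proof (cases "x = 0")
      case True
      thus ?thesis using T1(3)[OF ys'(2)] by (intro exI[of _ 0]) (simp add: agree_def)
    next
      case False
      then obtain F where F: "F \<in> \<F>" "F e \<noteq> 0" "poly (F e) x = 0" using roots xs(1) by auto
      have "F (\<lambda>i. prepend ys e (i + l)) = F e" using xs(2) by simp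
      thus ?thesis using T1(3)[OF ys'(2)] F by simp
    qed
    then obtain x' where "agree T (case_nat x (prepend ys e)) (case_nat x' (prepend ys' e'))" ..
    thus "\<exists>xs'. length xs' = Suc l \<and> agree T (prepend xs e) (prepend xs' e')"
      using xs(1) ys'(1) by (intro exI[of _ "x' # ys'"]) (simp add: prepend_Cons)
  qed
qed

end

section \<open>Matching one further point\<close>

definition step_base ::
  "nat \<Rightarrow> nat \<Rightarrow> ((nat \<Rightarrow> 'a::field) \<Rightarrow> 'a poly) set \<Rightarrow> ((nat \<Rightarrow> 'a) \<Rightarrow> 'a) set" where
  "step_base L D \<G> = {\<lambda>_. 0, \<lambda>_. 1} \<union> (\<lambda>(i, j) X. X i - X j) ` ({..<L} \<times> {..<L}) \<union>
    (\<lambda>(G, c, j). taylor_fun L G c j) ` (\<G> \<times> {..<L} \<times> {..D})"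

lemma finite_step_base: "finite \<G> \<Longrightarrow> finite (step_base L D \<G>)"
  by (simp add: step_base_def)

lemma step_base_polyfun: 
  "(\<And>G. G \<in> \<G> \<Longrightarrow> polyfam D G) \<Longrightarrow> step_base L D \<G> \<subseteq> polyfun"
  by (auto simp: step_base_def intro!: polyfun.const polyfun_diff polyfun.var polyfun_taylor_fun)

lemma step_base_memI:
  "(\<lambda>_. 0) \<in> step_base L D \<G>" "(\<lambda>_. 1) \<in> step_base L D \<G>"
  "i < L \<Longrightarrow> j < L \<Longrightarrow> (\<lambda>X. X i - X j) \<in> step_base L D \<G>"
  "G \<in> \<G> \<Longrightarrow> c < L \<Longrightarrow> k \<le> D \<Longrightarrow> taylor_fun L G c k \<in> step_base L D \<G>"
  unfolding step_base_def by (blast, blast, force, force)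

lemma coeff_taylor_prepend:
  assumes "length xs = L" "c < L"
  shows "coeff (G e \<circ>\<^sub>p [:xs ! c, w:]) j = taylor_fun L G c j (prepend xs e) * w ^ j"
  using assms by (subst coeff_pcompose_scale) (simp add: taylor_fun_def)

context acvf
begin

definition radius_agree ::
  "nat \<Rightarrow> ((nat \<Rightarrow> 'k) \<Rightarrow> 'k) set \<Rightarrow> (nat \<Rightarrow> 'k) \<Rightarrow> 'k \<Rightarrow> (nat \<Rightarrow> 'k) \<Rightarrow> 'k \<Rightarrow> bool" where
  "radius_agree D \<B> X w X' w' \<longleftrightarrow> (\<forall>A\<in>\<B>. \<forall>B\<in>\<B>. \<forall>j\<le>D. \<forall>l\<le>D.
    A X * w ^ j \<preceq> B X * w ^ l \<longleftrightarrow> A X' * w' ^ j \<preceq> B X' * w' ^ l)"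

text \<open>A coefficient of the expansion in the scaled variable is a base function times a power
  of the radius; those of index above \<open>D\<close> vanish and are represented by the base
  function 0.\<close>

lemma taylor_cmp:
  assumes W: "radius_agree D (step_base L D \<G>) (prepend xs e) w (prepend xs' e') w'"
    and len: "length xs = L" "length xs' = L" and G: "\<And>G. G \<in> \<G> \<Longrightarrow> polyfam D G"
    and GH: "G \<in> \<G>" "H \<in> \<G>" and cd: "c < L" "d < L"
  shows "coeff (G e \<circ>\<^sub>p [:xs ! c, w:]) i \<preceq> coeff (H e \<circ>\<^sub>p [:xs ! d, w:]) j \<longleftrightarrow>
    coeff (G e' \<circ>\<^sub>p [:xs' ! c, w':]) i \<preceq> coeff (H e' \<circ>\<^sub>p [:xs' ! d, w':]) j"
proof -
  have *: "\<exists>A\<in>step_base L D \<G>. \<exists>m\<le>D. coeff (G e \<circ>\<^sub>p [:xs ! c, w:]) i = A (prepend xs e) * w ^ m \<and>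
    coeff (G e' \<circ>\<^sub>p [:xs' ! c, w':]) i = A (prepend xs' e') * w' ^ m"
    if "G \<in> \<G>" "c < L" for G c i
  proof (cases "i \<le> D")
    case True
    show ?thesis
      by (rule bexI[of _ "taylor_fun L G c i"], rule exI[of _ i])
        (simp_all add: coeff_taylor_prepend len that True step_base_memI)
  next
    case False
    have "coeff (G x \<circ>\<^sub>p [:y, z:]) i = 0" for x y z
      using False polyfam_degree[OF G[OF that(1)], of x] degree_pcompose_le[of "G x" "[:y, z:]"]
      by (intro coeff_eq_0) (auto split: if_splits)
    thus ?thesis by (intro bexI[of _ "\<lambda>_. 0"] exI[of _ 0]) (simp_all add: step_base_memI)
  qed
  obtain A m where A: "A \<in> step_base L D \<G>" "m \<le> D" "coeff (G e \<circ>\<^sub>p [:xs ! c, w:]) i = A (prepend xs e) * w ^ m"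
    "coeff (G e' \<circ>\<^sub>p [:xs' ! c, w':]) i = A (prepend xs' e') * w' ^ m"
    using *[OF GH(1) cd(1), of i] by (elim bexE exE conjE)
  obtain B k where B: "B \<in> step_base L D \<G>" "k \<le> D" "coeff (H e \<circ>\<^sub>p [:xs ! d, w:]) j = B (prepend xs e) * w ^ k"
    "coeff (H e' \<circ>\<^sub>p [:xs' ! d, w':]) j = B (prepend xs' e') * w' ^ k"
    using *[OF GH(2) cd(2), of j] by (elim bexE exE conjE)
  show ?thesis unfolding A(3,4) B(3,4) using W A(1,2) B(1,2) by (simp add: radius_agree_def)
qed

lemma agree_monomials:
  assumes "agree (monomials D \<B>) X X'"
    "A \<in> \<B>" "B \<in> \<B>" "C \<in> \<B>" "A' \<in> \<B>" "B' \<in> \<B>" "C' \<in> \<B>"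
    "n \<le> D" "j \<le> D" "l \<le> D" "n' \<le> D" "j' \<le> D" "l' \<le> D"
  shows "A X ^ n * B X ^ j * C X ^ l \<preceq> A' X ^ n' * B' X ^ j' * C' X ^ l' \<longleftrightarrow>
      A X' ^ n * B X' ^ j * C X' ^ l \<preceq> A' X' ^ n' * B' X' ^ j' * C' X' ^ l'"
  by (rule agreeD[OF assms(1) monomialsI monomialsI]) (rule assms)+

lemma lists_matchE:
  assumes "lists_match l \<F> T e e'" "length xs = l"
    "\<And>x. x \<in> set xs \<Longrightarrow> x = 0 \<or> (\<exists>F\<in>\<F>. F e \<noteq> 0 \<and> poly (F e) x = 0)"
  obtains xs' where "length xs' = l" "agree T (prepend xs e) (prepend xs' e')"
  using assms(1)[unfolded lists_match_def, rule_format, OF assms(2,3)] that by blast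

text \<open>The centres are 0 and the roots of the \<open>S t\<close>. If \<open>a\<close> is a
  centre, root matching applies. Otherwise \<open>a\<close> is at radius \<open>w\<close> from its
  nearest centre \<open>s0\<close>, where each \<open>S t\<close> takes its Gauss norm: the centre
  is matched, the radius is transferred, and a generic point at the new radius serves as
  \<open>a'\<close>.\<close>

lemma generic_step:
  assumes "root_matching d" "finite T" "\<And>t. t \<in> T \<Longrightarrow> polyfam d (S t)"
  shows "transfers (\<lambda>e e'. \<forall>a. \<exists>a'. \<forall>s\<in>T. \<forall>t\<in>T.
    poly (S s e) a \<preceq> poly (S t e) a \<longleftrightarrow> poly (S s e') a' \<preceq> poly (S t e') a')"
proof -
  \<comment> \<open>The bound is \<open>Suc d\<close> because the transfer of the radius needs
    exponents up to at least 1, even for \<open>d = 0\<close>.\<close>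
  define \<B> where "\<B> = step_base 1 (Suc d) (S ` T)"
  have ST: "polyfam (Suc d) G" if "G \<in> S ` T" for G
    using assms(3) that polyfam_mono[of d G "Suc d"] by auto
  have \<B>: "finite \<B>" "\<B> \<subseteq> polyfun"
    unfolding \<B>_def using assms(2) by (intro finite_step_base step_base_polyfun ST; simp)+
  define V where "V = (\<lambda>t X. poly (S t (\<lambda>i. X (i + 1))) (X 0)) ` T"
  have V: "finite V" "V \<subseteq> polyfun"
    unfolding V_def using assms(2,3)
    by (auto intro!: polyfam_poly[where d = d] polyfun.var polyfam_subst[where \<sigma> = "\<lambda>X i. X (Suc i)"])
  have ST': "polyfam d G" if "G \<in> S ` T" for G using that assms(3) by auto
  have m1: "transfers (lists_match 1 (S ` T) (monomials (Suc d) \<B>))"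
    by (intro transfers_lists_match[OF assms(1)] finite_imageI assms(2) ST' finite_monomials
        monomials_polyfun \<B>)
  have m2: "transfers (lists_match 1 (S ` T) V)"
    by (intro transfers_lists_match[OF assms(1)] finite_imageI assms(2) ST' V)
  show ?thesis
  proof (rule transfers_mono[OF transfers_conj[OF m1 m2]])
    fix e e'
    let ?centre = "\<lambda>x. x = 0 \<or> (\<exists>G\<in>S ` T. G e \<noteq> 0 \<and> poly (G e) x = 0)"
    assume *: "lists_match 1 (S ` T) (monomials (Suc d) \<B>) e e' \<and> lists_match 1 (S ` T) V e e'"
    show "\<forall>a. \<exists>a'. \<forall>s\<in>T. \<forall>t\<in>T.
      poly (S s e) a \<preceq> poly (S t e) a \<longleftrightarrow> poly (S s e') a' \<preceq> poly (S t e') a'"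
    proof
      fix a
      show "\<exists>a'. \<forall>s\<in>T. \<forall>t\<in>T.
        poly (S s e) a \<preceq> poly (S t e) a \<longleftrightarrow> poly (S s e') a' \<preceq> poly (S t e') a'"
      proof (cases "?centre a")
        case True
        obtain xs' where xs': "length xs' = 1" "agree V (prepend [a] e) (prepend xs' e')"
          by (rule lists_matchE[OF conjunct2[OF *], of "[a]"]) (use True in auto)
        then obtain a' where "xs' = [a']" by (auto simp: length_Suc_conv)
        hence "agree V (case_nat a e) (case_nat a' e')" using xs' by (simp add: prepend_Cons)
        thus ?thesis by (intro exI[of _ a']) (simp add: agree_def V_def)
      next
        case False
        define C where "C = {x. ?centre x}"
        have "C = {0} \<union> (\<Union>t\<in>{t\<in>T. S t e \<noteq> 0}. {x. poly (S t e) x = 0})"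
          by (auto simp: C_def)
        hence C: "finite C" "0 \<in> C" using assms(2) poly_roots_finite by auto
        \<comment> \<open>A maximal value of \<open>a - c\<close> means that \<open>s0\<close> is a
          nearest centre.\<close>
        obtain s0 where s0: "s0 \<in> C" "\<And>c. c \<in> C \<Longrightarrow> a - c \<preceq> a - s0"
          using finite_vle_maximum[OF C(1), of "\<lambda>c. a - c"] C(2) by auto
        define w where "w = a - s0"
        have w: "w \<noteq> 0" using False s0(1) by (auto simp: C_def w_def)
        obtain xs' where xs': "length xs' = 1" "agree (monomials (Suc d) \<B>) (prepend [s0] e) (prepend xs' e')"
          by (rule lists_matchE[OF conjunct1[OF *], of "[s0]"]) (use s0(1) in \<open>auto simp: C_def\<close>)
        then obtain s0' where s0': "xs' = [s0']" by (auto simp: length_Suc_conv)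
        have ag: "agree (monomials (Suc d) \<B>) (prepend [s0] e) (prepend [s0'] e')" using xs' s0' by simp
        have "\<exists>w'. w' \<noteq> 0 \<and> (\<forall>A\<in>\<B>. \<forall>B\<in>\<B>. \<forall>j\<le>Suc d. \<forall>l\<le>Suc d.
            A (prepend [s0] e) * w ^ j \<preceq> B (prepend [s0] e) * w ^ l \<longleftrightarrow>
            A (prepend [s0'] e') * w' ^ j \<preceq> B (prepend [s0'] e') * w' ^ l)"
          by (rule radius_transfer_transcendental[where f = "\<lambda>A. A (prepend [s0] e)" 
                and f' = "\<lambda>A. A (prepend [s0'] e')" and z = "\<lambda>_. 0", OF agree_monomials[OF ag]])
            (simp_all add: w \<B>_def step_base_memI finite_step_base assms(2))
        then obtain w' where w': "w' \<noteq> 0"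
          "radius_agree (Suc d) (step_base 1 (Suc d) (S ` T)) (prepend [s0] e) w (prepend [s0'] e') w'"
          unfolding radius_agree_def \<B>_def by (elim exE conjE)
        \<comment> \<open>The roots over \<open>e'\<close> to be avoided, seen from the matched
          centre.\<close>
        have fin: "finite ((\<lambda>r. r - s0') ` (\<Union>t\<in>{t\<in>T. S t e' \<noteq> 0}. {r. poly (S t e') r = 0}))"
          using assms(2) poly_roots_finite by auto
        obtain u where u: "u \<preceq> w'" "w' \<preceq> u"
          "\<And>r. r \<in> (\<lambda>r. r - s0') ` (\<Union>t\<in>{t\<in>T. S t e' \<noteq> 0}. {r. poly (S t e') r = 0}) \<Longrightarrow> r - u \<preceq> w'"
          by (rule generic_point[OF fin w'(1)]) (rule that)
        \<comment> \<open>Such a root would be a centre nearer to \<open>a\<close> than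
          \<open>s0\<close>.\<close>
        have noS: "\<not> w \<prec> r - a" if "t \<in> T" "S t e \<noteq> 0" "poly (S t e) r = 0" for t r
          using s0(2)[of r] that vle_minus_commute(2)[of r a w] by (auto simp: C_def w_def)
        have noS': "\<not> w' \<prec> r - (s0' + u)" if "t \<in> T" "S t e' \<noteq> 0" "poly (S t e') r = 0" for t r
          using u(3)[of "r - s0'"] that by (auto simp: algebra_simps)
        have "poly (S s e) a \<preceq> poly (S t e) a \<longleftrightarrow> poly (S s e') (s0' + u) \<preceq> poly (S t e') (s0' + u)"
          if "s \<in> T" "t \<in> T" for s t
        proof -
          have "poly (S s e) a \<preceq> poly (S t e) a \<longleftrightarrow> (\<exists>i. \<forall>j.
            coeff (S s e \<circ>\<^sub>p [:[s0] ! 0, w:]) i \<preceq> coeff (S t e \<circ>\<^sub>p [:[s0] ! 0, w:]) j)"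
            by (rule poly_vle_iff_gauss[OF w]) 
              (simp add: w_def, (erule (1) noS[OF that(1)] noS[OF that(2)])+)
          moreover have "poly (S s e') (s0' + u) \<preceq> poly (S t e') (s0' + u) \<longleftrightarrow> (\<exists>i. \<forall>j.
            coeff (S s e' \<circ>\<^sub>p [:[s0'] ! 0, w':]) i \<preceq> coeff (S t e' \<circ>\<^sub>p [:[s0'] ! 0, w':]) j)"
            by (rule poly_vle_iff_gauss[OF w'(1)]) 
              (simp add: u, (erule (1) noS'[OF that(1)] noS'[OF that(2)])+)
          moreover have "coeff (S s e \<circ>\<^sub>p [:[s0] ! 0, w:]) i \<preceq> coeff (S t e \<circ>\<^sub>p [:[s0] ! 0, w:]) j \<longleftrightarrow>
            coeff (S s e' \<circ>\<^sub>p [:[s0'] ! 0, w':]) i \<preceq> coeff (S t e' \<circ>\<^sub>p [:[s0'] ! 0, w':]) j" for i j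
            by (rule taylor_cmp[OF w'(2)]) (use that ST in auto)
          ultimately show ?thesis by (simp only:)
        qed
        thus ?thesis by blast
      qed
    qed
  qed
qed

text \<open>Unlike for a generic point, the radius is not free: the Newton polygon of
  \<open>F e\<close> at the nearest centre fixes it as a slope. The centres are roots of polynomials
  of degree at most \<open>d\<close>, which can be matched by hypothesis; the root of
  \<open>F e'\<close> is found by counting.\<close>

lemma algebraic_step:
  assumes "root_matching d" "polyfam (Suc d) F" "finite T" "\<And>t. t \<in> T \<Longrightarrow> polyfam d (S t)"
  shows "transfers (\<lambda>e e'. \<forall>a. coeff (F e) (Suc d) \<noteq> 0 \<longrightarrow> poly (F e) a = 0 \<longrightarrow>
    (\<exists>a'. poly (F e') a' = 0 \<and> (\<forall>s\<in>T. \<forall>t\<in>T.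
      poly (S s e) a \<preceq> poly (S t e) a \<longleftrightarrow> poly (S s e') a' \<preceq> poly (S t e') a')))"
proof -
  \<comment> \<open>At most \<open>card T * d\<close> roots of the \<open>S t\<close>, together with
    0 and a second copy of the nearest centre, which is kept at index 0. The bound does not depend
    on \<open>e\<close>.\<close>
  define L where "L = card T * d + 2"
  define \<G> where "\<G> = insert F (S ` T)"
  define \<B> where "\<B> = step_base L (Suc d) \<G>"
  have G: "polyfam (Suc d) G" if "G \<in> \<G>" for G
    using assms(2,4) that polyfam_mono[of d G "Suc d"] by (auto simp: \<G>_def)
  have \<B>: "finite \<B>" "\<B> \<subseteq> polyfun"
    unfolding \<B>_def using assms(3) by (intro finite_step_base step_base_polyfun G; simp add: \<G>_def)+
  \<comment> \<open>Including 0 and the value of \<open>F\<close> makes the point matched to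
    \<open>a\<close> a root of \<open>F e'\<close>.\<close>
  define V where "V = {\<lambda>_. 0, \<lambda>X. poly (F (\<lambda>i. X (i + 1))) (X 0)} \<union> (\<lambda>t X. poly (S t (\<lambda>i. X (i + 1))) (X 0)) ` T"
  have "(\<lambda>X. poly (G (\<lambda>i. X (i + 1))) (X 0)) \<in> polyfun" if "G \<in> \<G>" for G
    by (intro polyfam_poly[where d = "Suc d"] polyfun.var polyfam_subst[where \<sigma> = "\<lambda>X i. X (i + 1)"] G that)
  hence V: "finite V" "V \<subseteq> polyfun"
    unfolding V_def using assms(3) by (auto simp: \<G>_def polyfun.const)
  have ST': "polyfam d G" if "G \<in> S ` T" for G using that assms(4) by auto
  have m1: "transfers (lists_match L (S ` T) (monomials (Suc d) \<B>))"
    by (intro transfers_lists_match[OF assms(1)] finite_imageI assms(3) ST' finite_monomials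
        monomials_polyfun \<B>)
  have m2: "transfers (lists_match 1 (S ` T) V)"
    by (intro transfers_lists_match[OF assms(1)] finite_imageI assms(3) ST' V)
  \<comment> \<open>Agreement here transfers the vanishing of the leading coefficient and of each
    whole polynomial \<open>S t e\<close>.\<close>
  define Z where "Z = {\<lambda>_. 0, \<lambda>e. coeff (F e) (Suc d)} \<union> (\<lambda>(t, j) e. coeff (S t e) j) ` (T \<times> {..d})"
  have Z: "finite Z" "Z \<subseteq> polyfun"
    unfolding Z_def using assms(3) polyfam_coeff[OF assms(2)] polyfam_coeff[OF assms(4)] by (auto simp: polyfun.const)
  show ?thesis
  proof (rule transfers_mono[OF transfers_conj[OF transfers_agree[OF Z] transfers_conj[OF m1 m2]]])
    fix e e'
    let ?centre = "\<lambda>x. x = 0 \<or> (\<exists>G\<in>S ` T. G e \<noteq> 0 \<and> poly (G e) x = 0)"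
    assume *: "agree Z e e' \<and> lists_match L (S ` T) (monomials (Suc d) \<B>) e e' \<and> lists_match 1 (S ` T) V e e'"
    show "\<forall>a. coeff (F e) (Suc d) \<noteq> 0 \<longrightarrow> poly (F e) a = 0 \<longrightarrow>
      (\<exists>a'. poly (F e') a' = 0 \<and> (\<forall>s\<in>T. \<forall>t\<in>T.
        poly (S s e) a \<preceq> poly (S t e) a \<longleftrightarrow> poly (S s e') a' \<preceq> poly (S t e') a'))"
    proof (intro allI impI)
      fix a assume lc: "coeff (F e) (Suc d) \<noteq> 0" and root: "poly (F e) a = 0"
      show "\<exists>a'. poly (F e') a' = 0 \<and> (\<forall>s\<in>T. \<forall>t\<in>T.
        poly (S s e) a \<preceq> poly (S t e) a \<longleftrightarrow> poly (S s e') a' \<preceq> poly (S t e') a')"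
      proof (cases "?centre a")
        case True
        obtain xs' where xs': "length xs' = 1" "agree V (prepend [a] e) (prepend xs' e')"
          by (rule lists_matchE[OF conjunct2[OF conjunct2[OF *]], of "[a]"]) (use True in auto)
        then obtain a' where "xs' = [a']" by (auto simp: length_Suc_conv)
        hence "agree V (case_nat a e) (case_nat a' e')" using xs' by (simp add: prepend_Cons)
        thus ?thesis using root by (intro exI[of _ a']) (simp add: agree_def V_def)
      next
        case False
        define C where "C = {x. ?centre x}"
        have Ceq: "C = insert 0 (\<Union>t\<in>{t\<in>T. S t e \<noteq> 0}. {x. poly (S t e) x = 0})"
          by (auto simp: C_def)
        hence C: "finite C" "0 \<in> C" using assms(3) poly_roots_finite by auto
        have "card (\<Union>t\<in>{t\<in>T. S t e \<noteq> 0}. {x. poly (S t e) x = 0}) \<le> 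
            (\<Sum>t\<in>{t\<in>T. S t e \<noteq> 0}. card {x. poly (S t e) x = 0})"
          using assms(3) by (intro card_UN_le) auto
        also have "\<dots> \<le> (\<Sum>t\<in>{t\<in>T. S t e \<noteq> 0}. d)"
          by (intro sum_mono) (use card_poly_roots_bound polyfam_degree[OF assms(4)] le_trans in blast)
        also have "\<dots> \<le> card T * d" using assms(3) by (simp add: card_mono)
        finally have cardC: "card C \<le> Suc (card T * d)"
          unfolding Ceq using card_insert_le_m1[of "Suc (card T * d)"] by simp
        obtain s0 where s0: "s0 \<in> C" "\<And>c. c \<in> C \<Longrightarrow> a - c \<preceq> a - s0"
          using finite_vle_maximum[OF C(1), of "\<lambda>c. a - c"] C(2) by auto
        obtain ys where ys: "set ys = C" "length ys = card C" 
          using finite_distinct_list[OF C(1)] distinct_card by metis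
        \<comment> \<open>Padding with the centre 0 gives the list its uniform length
          \<open>L\<close>.\<close>
        define xs where "xs = s0 # ys @ replicate (L - 1 - card C) 0"
        have xs: "length xs = L" "set xs = C" "xs ! 0 = s0"
          using ys cardC s0(1) C(2) by (auto simp: xs_def L_def)
        define w where "w = a - s0"
        have w: "w \<noteq> 0" using False s0(1) by (auto simp: C_def w_def)
        obtain xs' where xs': "length xs' = L" "agree (monomials (Suc d) \<B>) (prepend xs e) (prepend xs' e')"
          by (rule lists_matchE[OF conjunct1[OF conjunct2[OF *]] xs(1)]) (use xs(2) in \<open>auto simp: C_def\<close>)
        have F0: "F e \<noteq> 0" "F e' \<noteq> 0"
          using lc agree_zero_iff[OF conjunct1[OF *], of "\<lambda>e. coeff (F e) (Suc d)"] by (auto simp: Z_def)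
        have L0: "L > 0" by (simp add: L_def)
        define lo where "lo = size {#r \<in># proots (F e). w \<prec> r - s0#}"
        define hi where "hi = size {#r \<in># proots (F e). w \<preceq> r - s0#}"
        \<comment> \<open>The root \<open>a\<close> lies in the closed ball around \<open>s0\<close>
          but not in the open one; hence the edge is proper and determines the radius.\<close>
        have "{#r \<in># proots (F e). w \<prec> r - s0#} \<subset># {#r \<in># proots (F e). w \<preceq> r - s0#}"
        proof (rule subset_mset.le_neq_trans)
          show "{#r \<in># proots (F e). w \<prec> r - s0#} \<subseteq># {#r \<in># proots (F e). w \<preceq> r - s0#}"
            by (rule mset_subset_eqI) (simp add: vlt_imp_vle)
          have "a \<in># {#r \<in># proots (F e). w \<preceq> r - s0#}" "a \<notin># {#r \<in># proots (F e). w \<prec> r - s0#}"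
            using root F0(1) by (auto simp: w_def order_root)
          thus "{#r \<in># proots (F e). w \<prec> r - s0#} \<noteq> {#r \<in># proots (F e). w \<preceq> r - s0#}" by metis
        qed
        hence lohi: "lo < hi" unfolding lo_def hi_def by (rule mset_subset_size)
        have hi: "hi \<le> Suc d"
          unfolding hi_def using size_filter_mset_lesseq size_proots_le polyfam_degree[OF assms(2)] le_trans by blast
        have edge: "newton_edge (F e \<circ>\<^sub>p [:xs ! 0, w:]) lo hi"
          unfolding lo_def hi_def xs(3) by (rule newton_edge_ball[OF F0(1) w])
        have dom: "coeff (F e \<circ>\<^sub>p [:xs ! 0, w:]) lo \<preceq> coeff (F e \<circ>\<^sub>p [:xs ! 0, w:]) hi"
          "coeff (F e \<circ>\<^sub>p [:xs ! 0, w:]) hi \<preceq> coeff (F e \<circ>\<^sub>p [:xs ! 0, w:]) lo"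
          "coeff (F e \<circ>\<^sub>p [:xs ! 0, w:]) lo \<noteq> 0"
          using dominant_indices_edge[OF edge] by (auto simp: dominant_indices_def)
        have "\<exists>w'. w' \<noteq> 0 \<and> (\<forall>A\<in>\<B>. \<forall>B\<in>\<B>. \<forall>j\<le>Suc d. \<forall>l\<le>Suc d.
            A (prepend xs e) * w ^ j \<preceq> B (prepend xs e) * w ^ l \<longleftrightarrow>
            A (prepend xs' e') * w' ^ j \<preceq> B (prepend xs' e') * w' ^ l)"
          by (rule radius_transfer_algebraic[where f = "\<lambda>A. A (prepend xs e)" 
                and f' = "\<lambda>A. A (prepend xs' e')" and z = "\<lambda>_. 0" and x = "taylor_fun L F 0 lo" and
                y = "taylor_fun L F 0 hi" and lo = lo and hi = hi, OF agree_monomials[OF xs'(2)]])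
            (use lohi hi w L0 dom coeff_taylor_prepend[OF xs(1) L0, of F e w] 
              in \<open>simp_all add: \<B>_def \<G>_def step_base_memI\<close>)
        then obtain w' where w': "w' \<noteq> 0"
          "radius_agree (Suc d) (step_base L (Suc d) \<G>) (prepend xs e) w (prepend xs' e') w'"
          unfolding radius_agree_def \<B>_def by (elim exE conjE)
        note cmp = taylor_cmp[OF w'(2) xs(1) xs'(1) G]
        have diff: "w \<preceq> xs ! i - xs ! j \<longleftrightarrow> w' \<preceq> xs' ! i - xs' ! j"
          "xs ! i - xs ! j \<preceq> w \<longleftrightarrow> xs' ! i - xs' ! j \<preceq> w'" if "i < L" "j < L" for i j
        proof -
          have m: "(\<lambda>_. 1) \<in> step_base L (Suc d) \<G>" "(\<lambda>X. X i - X j) \<in> step_base L (Suc d) \<G>"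
            by (rule step_base_memI that)+
          show "w \<preceq> xs ! i - xs ! j \<longleftrightarrow> w' \<preceq> xs' ! i - xs' ! j"
            using w'(2)[unfolded radius_agree_def, rule_format, OF m, of 1 0] that xs(1) xs'(1) by simp
          show "xs ! i - xs ! j \<preceq> w \<longleftrightarrow> xs' ! i - xs' ! j \<preceq> w'"
            using w'(2)[unfolded radius_agree_def, rule_format, OF m(2,1), of 0 1] that xs(1) xs'(1) by simp
        qed
        show ?thesis
        proof (rule root_transfer[of w w' "F e" "F e'" a "\<lambda>c. xs ! c" L "\<lambda>c. xs' ! c" T "\<lambda>t. S t e" "\<lambda>t. S t e'"])
          show "w \<preceq> a - xs ! 0" by (simp add: xs w_def)
          show "\<not> w \<prec> a - xs ! c" if "c < L" for c
            using s0(2)[of "xs ! c"] that xs nth_mem unfolding w_def by blast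
          show "dominant_indices (F e \<circ>\<^sub>p [:xs ! c, w:]) = dominant_indices (F e' \<circ>\<^sub>p [:xs' ! c, w':])"
            if "c < L" for c
            unfolding dominant_indices_def by (subst cmp) (simp_all add: that \<G>_def)
          show "S t e = 0 \<longleftrightarrow> S t e' = 0" if "t \<in> T" for t
          proof -
            have c0: "coeff (S t e) j = 0 \<longleftrightarrow> coeff (S t e') j = 0" if "j \<le> d" for j
              using that \<open>t \<in> T\<close> by (intro agree_zero_iff[OF conjunct1[OF *], of "\<lambda>e. coeff (S t e) j"])
                (auto simp: Z_def)
            have "S t x = 0 \<longleftrightarrow> (\<forall>j\<le>d. coeff (S t x) j = 0)" for x
              using polyfam_degree[OF assms(4)[OF that], of x]
              by (metis coeff_0 leading_coeff_0_iff)
            thus ?thesis using c0 by simp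
          qed
          show "dominant_indices (S t e \<circ>\<^sub>p [:xs ! c, w:]) = dominant_indices (S t e' \<circ>\<^sub>p [:xs' ! c, w':])"
            if "t \<in> T" "c < L" for t c
            unfolding dominant_indices_def by (subst cmp) (simp_all add: that \<G>_def)
          show "coeff (S k e \<circ>\<^sub>p [:xs ! 0, w:]) i \<preceq> coeff (S l e \<circ>\<^sub>p [:xs ! 0, w:]) j \<longleftrightarrow>
            coeff (S k e' \<circ>\<^sub>p [:xs' ! 0, w':]) i \<preceq> coeff (S l e' \<circ>\<^sub>p [:xs' ! 0, w':]) j"
            if "k \<in> T" "l \<in> T" for k l i j
            by (rule cmp) (simp_all add: that L0 \<G>_def)
          show "\<exists>c<L. r = xs ! c" if "t \<in> T" "S t e \<noteq> 0" "poly (S t e) r = 0" for t r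
          proof -
            have "r \<in> set xs" using that by (auto simp: xs(2) C_def)
            thus ?thesis using xs(1) by (metis in_set_conv_nth)
          qed
        qed (use w w'(1) F0 root L0 diff in auto)
      qed
    qed
  qed
qed

end

section \<open>Quantifier elimination\<close>

context acvf
begin

text \<open>At the roots of \<open>F e\<close>, every member of \<open>T\<close> is, up to a power
  of the leading coefficient, a polynomial of degree at most \<open>d\<close>. Where that
  coefficient vanishes, \<open>F e\<close> itself has smaller degree.\<close>

theorem root_matching_all: "root_matching d"
proof (induction d)
  case 0
  show ?case unfolding root_matching_def
  proof (intro allI impI)
    fix F :: "(nat \<Rightarrow> 'k) \<Rightarrow> 'k poly" and T :: "((nat \<Rightarrow> 'k) \<Rightarrow> 'k) set"
    assume F: "polyfam 0 F"
    have "poly (F e) a \<noteq> 0" if "F e \<noteq> 0" for e a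
      using polyfam_degree[OF F, of e] that by (auto elim: degree_eq_zeroE)
    thus "transfers (\<lambda>e e'. \<forall>a. F e \<noteq> 0 \<longrightarrow> poly (F e) a = 0 \<longrightarrow>
      (\<exists>a'. agree T (case_nat a e) (case_nat a' e')))"
      by (intro transfersI[of "{}"]) auto
  qed
next
  case (Suc d)
  show ?case unfolding root_matching_def
  proof (intro allI impI)
    fix F :: "(nat \<Rightarrow> 'k) \<Rightarrow> 'k poly" and T :: "((nat \<Rightarrow> 'k) \<Rightarrow> 'k) set"
    assume F: "polyfam (Suc d) F" and T: "finite T" "T \<subseteq> polyfun"
    let ?lc = "\<lambda>e. coeff (F e) (Suc d)"
    have lc: "?lc \<in> polyfun" by (rule polyfam_coeff[OF F])
    have "\<forall>t\<in>T. \<exists>N R. polyfam d R \<and>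
      (\<forall>e a. poly (F e) a = 0 \<longrightarrow> ?lc e ^ N * t (case_nat a e) = poly (R e) a)"
    proof
      fix t assume "t \<in> T"
      then obtain m G where "polyfam m G" and G: "\<And>e a. t (case_nat a e) = poly (G e) a"
        using T polyfun_case_nat[of t] by blast
      from polyfam_pseudo_remainder[OF F this(1)]
      show "\<exists>N R. polyfam d R \<and> (\<forall>e a. poly (F e) a = 0 \<longrightarrow> ?lc e ^ N * t (case_nat a e) = poly (R e) a)"
        unfolding G .
    qed
    from bchoice[OF this] obtain N where "\<forall>t\<in>T. \<exists>R. polyfam d R \<and>
      (\<forall>e a. poly (F e) a = 0 \<longrightarrow> ?lc e ^ N t * t (case_nat a e) = poly (R e) a)" ..
    from bchoice[OF this] obtain R where R: "\<forall>t\<in>T. polyfam d (R t) \<and>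
      (\<forall>e a. poly (F e) a = 0 \<longrightarrow> ?lc e ^ N t * t (case_nat a e) = poly (R t e) a)" ..
    \<comment> \<open>A common exponent: all members of \<open>T\<close> get multiplied by the same
      power of the leading coefficient, so comparisons are unchanged when it is nonzero.\<close>
    define M where "M = sum N T"
    define S where "S = (\<lambda>t e. Polynomial.smult (?lc e ^ (M - N t)) (R t e))"
    have S: "polyfam d (S t)" if "t \<in> T" for t
      unfolding S_def using R that by (intro polyfam_smult polyfun_power lc) auto
    have poly_S: "poly (S t e) a = ?lc e ^ M * t (case_nat a e)" if "t \<in> T" "poly (F e) a = 0" for t e a
    proof -
      have "N t \<le> M" unfolding M_def using that(1) T(1) by (intro member_le_sum) auto
      hence "?lc e ^ M = ?lc e ^ (M - N t) * ?lc e ^ N t" by (simp flip: power_add)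
      thus ?thesis using R that by (simp add: S_def mult.assoc)
    qed
    \<comment> \<open>\<open>F\<close> without its leading term, equal to \<open>F\<close> where the
      leading coefficient vanishes.\<close>
    define F' where "F' = (\<lambda>e. F e - Polynomial.monom (?lc e) (Suc d))"
    have F': "polyfam (Suc d) F'"
      unfolding F'_def by (intro polyfam_diff F polyfam_monom lc) simp
    have "degree (F' e) \<le> d" for e
    proof -
      have "coeff (F' e) (Suc d) = 0" by (simp add: F'_def)
      thus ?thesis using polyfam_degree[OF F', of e] eq_zero_or_degree_less[of "F' e" "Suc d"] 
        by (auto simp: less_Suc_eq_le)
    qed
    hence F'd: "polyfam d F'" using F' by (simp add: polyfam_def)
    have step: "transfers (\<lambda>e e'. \<forall>a. ?lc e \<noteq> 0 \<longrightarrow> poly (F e) a = 0 \<longrightarrow>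
      (\<exists>a'. poly (F e') a' = 0 \<and> (\<forall>s\<in>T. \<forall>t\<in>T.
        poly (S s e) a \<preceq> poly (S t e) a \<longleftrightarrow> poly (S s e') a' \<preceq> poly (S t e') a')))"
      by (rule algebraic_step[OF Suc.IH F T(1)]) (rule S)
    show "transfers (\<lambda>e e'. \<forall>a. F e \<noteq> 0 \<longrightarrow> poly (F e) a = 0 \<longrightarrow>
      (\<exists>a'. agree T (case_nat a e) (case_nat a' e')))"
    proof (rule transfers_mono[OF transfers_conj[OF transfers_zero_iff[OF lc]
            transfers_conj[OF root_matchingD[OF Suc.IH F'd T] step]]],
          intro allI impI)
      fix e e' a
      assume *: "(?lc e = 0 \<longleftrightarrow> ?lc e' = 0) \<and>
        (\<forall>a. F' e \<noteq> 0 \<longrightarrow> poly (F' e) a = 0 \<longrightarrow> (\<exists>a'. agree T (case_nat a e) (case_nat a' e'))) \<and>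
        (\<forall>a. ?lc e \<noteq> 0 \<longrightarrow> poly (F e) a = 0 \<longrightarrow>
          (\<exists>a'. poly (F e') a' = 0 \<and> (\<forall>s\<in>T. \<forall>t\<in>T.
            poly (S s e) a \<preceq> poly (S t e) a \<longleftrightarrow> poly (S s e') a' \<preceq> poly (S t e') a')))"
        and F0: "F e \<noteq> 0" and a: "poly (F e) a = 0"
      show "\<exists>a'. agree T (case_nat a e) (case_nat a' e')"
      proof (cases "?lc e = 0")
        case True
        hence "F' e = F e" by (simp add: F'_def)
        thus ?thesis using * F0 a by simp
      next
        case False
        hence lc0: "?lc e \<noteq> 0" "?lc e' \<noteq> 0" using * by auto
        obtain a' where a': "poly (F e') a' = 0" "\<And>s t. s \<in> T \<Longrightarrow> t \<in> T \<Longrightarrow>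
          poly (S s e) a \<preceq> poly (S t e) a \<longleftrightarrow> poly (S s e') a' \<preceq> poly (S t e') a'"
          using * lc0(1) a by blast
        have "agree T (case_nat a e) (case_nat a' e')"
          unfolding agree_def
        proof (intro ballI)
          fix s t assume st: "s \<in> T" "t \<in> T"
          show "s (case_nat a e) \<preceq> t (case_nat a e) \<longleftrightarrow> s (case_nat a' e') \<preceq> t (case_nat a' e')"
            using a'(2)[OF st] st a a'(1) lc0 by (simp add: poly_S)
        qed
        thus ?thesis ..
      qed
    qed
  qed
qed

theorem transfers_extension:
  assumes "finite T" "T \<subseteq> polyfun"
  shows "transfers (\<lambda>e e'. \<forall>a. \<exists>a'. agree T (case_nat a e) (case_nat a' e'))"
proof -
  have "\<forall>t\<in>T. \<exists>d F. polyfam d F \<and> (\<forall>e a. t (case_nat a e) = poly (F e) a)"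
    using polyfun_case_nat assms(2) by (metis subsetD)
  from bchoice[OF this] obtain d where 
    "\<forall>t\<in>T. \<exists>F. polyfam (d t) F \<and> (\<forall>e a. t (case_nat a e) = poly (F e) a)" ..
  from bchoice[OF this] obtain F where 
    F: "\<forall>t\<in>T. polyfam (d t) (F t) \<and> (\<forall>e a. t (case_nat a e) = poly (F t e) a)" ..
  have "polyfam (sum d T) (F t)" if "t \<in> T" for t
    using F that assms(1) by (intro polyfam_mono[of "d t" _ "sum d T"] member_le_sum) auto
  from generic_step[OF root_matching_all assms(1) this]
  have "transfers (\<lambda>e e'. \<forall>a. \<exists>a'. \<forall>s\<in>T. \<forall>t\<in>T.
    poly (F s e) a \<preceq> poly (F t e) a \<longleftrightarrow> poly (F s e') a' \<preceq> poly (F t e') a')" .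
  thus ?thesis by (rule transfers_mono) (use F in \<open>simp add: agree_def\<close>)
qed

text \<open>A predicate is quantifier-free, with parameters, if and only if it is invariant under agreement on
  a finite set of polynomial functions.\<close>

definition qf :: "((nat \<Rightarrow> 'k) \<Rightarrow> bool) \<Rightarrow> bool" where
  "qf P \<longleftrightarrow> transfers (\<lambda>e e'. P e = P e')"

lemma qf_not: "qf P \<Longrightarrow> qf (\<lambda>e. \<not> P e)"
  by (simp add: qf_def)

lemma qf_conj: "qf P \<Longrightarrow> qf Q \<Longrightarrow> qf (\<lambda>e. P e \<and> Q e)"
  unfolding qf_def by (drule (1) transfers_conj) (erule transfers_mono, blast)

lemma qf_vle: "f \<in> polyfun \<Longrightarrow> g \<in> polyfun \<Longrightarrow> qf (\<lambda>e. f e \<preceq> g e)"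
  unfolding qf_def by (rule transfersI[of "{f, g}"]) (auto simp: agree_def)

lemma qf_eq: "f \<in> polyfun \<Longrightarrow> g \<in> polyfun \<Longrightarrow> qf (\<lambda>e. f e = g e)"
  using qf_vle[OF polyfun.const[of 0] polyfun_diff[of f g]] by simp

text \<open>A witness over \<open>e\<close> is matched over \<open>e'\<close> by the extension
  property, and conversely by the same property with the roles exchanged.\<close>

theorem qf_ex: assumes "qf P" shows "qf (\<lambda>e. \<exists>a. P (case_nat a e))"
proof -
  obtain T where T: "finite T" "T \<subseteq> polyfun" "\<And>e e'. agree T e e' \<Longrightarrow> P e = P e'"
    by (rule transfersE[OF assms[unfolded qf_def]]) (rule that)
  have "transfers (\<lambda>e e'. \<forall>a. \<exists>a'. agree T (case_nat a e) (case_nat a' e'))"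
    by (rule transfers_extension[OF T(1,2)])
  from transfers_conj[OF this transfers_sym[OF this]]
  show ?thesis unfolding qf_def by (rule transfers_mono) (metis T(3))
qed

lemma qf_subst:
  assumes "qf P" "\<And>i. (\<lambda>e. \<sigma> e i) \<in> polyfun"
  shows "qf (\<lambda>e. P (\<sigma> e))"
proof -
  obtain T where T: "finite T" "T \<subseteq> polyfun" "\<And>e e'. agree T e e' \<Longrightarrow> P e = P e'"
    by (rule transfersE[OF assms(1)[unfolded qf_def]]) (rule that)
  show ?thesis unfolding qf_def
    by (rule transfersI[of "(\<lambda>t e. t (\<sigma> e)) ` T"])
      (use T(1,2) in \<open>auto simp: agree_def intro!: T(3) polyfun_subst[where \<sigma> = \<sigma>] assms(2)\<close>)
qed

lemma qf_ex_list: "qf P \<Longrightarrow> qf (\<lambda>e. \<exists>xs. length xs = l \<and> P (prepend xs e))"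
proof (induction l arbitrary: P)
  case (Suc l)
  have "(\<exists>xs. length xs = Suc l \<and> P (prepend xs e)) \<longleftrightarrow>
    (\<exists>xs. length xs = l \<and> (\<exists>a. P (case_nat a (prepend xs e))))" for e
    by (metis (no_types, lifting) prepend_Cons length_Suc_conv)
  thus ?case using Suc.IH[OF qf_ex[OF Suc.prems]] by simp
qed simp

section \<open>From formulas and definable sets to quantifier-free predicates\<close>

lemma polyfun_vf_eval: "(\<lambda>e. vf_eval e t) \<in> polyfun"
  by (induction t) (auto intro: polyfun.intros polyfun_uminus)

theorem qf_vf_sat: "qf (vf_sat v p)"
proof (induction p)
  case (VF_Ex p)
  show ?case using qf_ex[OF VF_Ex] by simp
qed (auto intro: qf_eq qf_vle qf_not qf_conj polyfun_vf_eval)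

lemma qf_definable:
  assumes "definable v m S" "\<And>i. i < m \<Longrightarrow> f i \<in> polyfun"
  shows "qf (\<lambda>e. map (\<lambda>i. f i e) [0..<m] \<in> S)"
proof -
  obtain p c where S: "S = {xs. length xs = m \<and> vf_sat v p (\<lambda>i. if i < m then xs ! i else c i)}"
    using assms(1) unfolding definable_def by blast
  define \<sigma> where "\<sigma> e i = (if i < m then f i e else c i)" for e i
  have "map (\<lambda>i. f i e) [0..<m] \<in> S \<longleftrightarrow> vf_sat v p (\<sigma> e)" for e
    unfolding S \<sigma>_def by (auto cong: if_cong)
  moreover have "(\<lambda>e. \<sigma> e i) \<in> polyfun" for i
    using assms(2) by (cases "i < m") (auto simp: \<sigma>_def polyfun.const)
  ultimately show ?thesis using qf_subst[OF qf_vf_sat] by simp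
qed

end

section \<open>Definable submodules of the line\<close>

context acvf
begin

text \<open>No two nonzero monomials of \<open>f\<close> tie at \<open>t\<close>: its value is not a
  tropical root of \<open>f\<close>.\<close>

definition noncritical :: "'k poly \<Rightarrow> 'k \<Rightarrow> bool" where
  "noncritical f t \<longleftrightarrow> (\<forall>j l. j \<noteq> l \<longrightarrow> coeff f j \<noteq> 0 \<longrightarrow> coeff f l \<noteq> 0 \<longrightarrow>
    \<not> (coeff f j * t ^ j \<preceq> coeff f l * t ^ l \<and> coeff f l * t ^ l \<preceq> coeff f j * t ^ j))"

text \<open>Without ties, the monomial of least value is strictly least and dominates the sum of all
  the others.\<close>

lemma noncritical_poly:
  assumes "noncritical f t" "t \<noteq> 0"
  shows "poly f t \<preceq> coeff f j * t ^ j" "\<exists>j. coeff f j * t ^ j \<preceq> poly f t"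
proof -
  have *: "(\<forall>j. poly f t \<preceq> coeff f j * t ^ j) \<and> (\<exists>j. coeff f j * t ^ j \<preceq> poly f t)"
  proof (cases "f = 0")
    case False
    define J where "J = {j. j \<le> degree f \<and> coeff f j \<noteq> 0}"
    have J: "finite J" "degree f \<in> J" using False by (auto simp: J_def)
    obtain i where i: "i \<in> J" "\<And>j. j \<in> J \<Longrightarrow> coeff f i * t ^ i \<preceq> coeff f j * t ^ j"
      using finite_vle_minimum[OF J(1), of "\<lambda>j. coeff f j * t ^ j"] J(2) by auto
    have strict: "coeff f i * t ^ i \<prec> coeff f j * t ^ j" if "j \<in> J" "j \<noteq> i" for j
      using assms(1) i that unfolding noncritical_def J_def by blast
    have "poly f t = (\<Sum>j\<in>J. coeff f j * t ^ j)"
      unfolding poly_altdef by (rule sum.mono_neutral_right) (auto simp: J_def)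
    also have "\<dots> = coeff f i * t ^ i + (\<Sum>j\<in>J-{i}. coeff f j * t ^ j)"
      using J(1) i(1) by (rule sum.remove)
    finally have eq: "poly f t = coeff f i * t ^ i + (\<Sum>j\<in>J-{i}. coeff f j * t ^ j)" .
    have "coeff f i * t ^ i \<noteq> 0" using i(1) assms(2) by (auto simp: J_def)
    have "coeff f i * t ^ i \<prec> (\<Sum>j\<in>F. coeff f j * t ^ j)" if "finite F" "F \<subseteq> J - {i}" for F
      using that
    proof (induction rule: finite_induct)
      case empty
      thus ?case using \<open>coeff f i * t ^ i \<noteq> 0\<close> by simp
    next
      case (insert j F)
      thus ?case using vlt_add[OF strict[of j]] by auto
    qed
    from this[of "J - {i}"] have "coeff f i * t ^ i \<prec> (\<Sum>j\<in>J-{i}. coeff f j * t ^ j)" using J(1) by simp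
    from vle_dominant(1,2)[OF this] have d: "poly f t \<preceq> coeff f i * t ^ i" "coeff f i * t ^ i \<preceq> poly f t"
      unfolding eq by auto
    have "poly f t \<preceq> coeff f j * t ^ j" for j
    proof (cases "j \<in> J")
      case True
      thus ?thesis using vle_trans[OF d(1) i(2)] by blast
    next
      case False
      hence "coeff f j = 0" using le_degree[of f j] by (auto simp: J_def)
      thus ?thesis by simp
    qed
    thus ?thesis using d by blast
  qed simp
  thus "poly f t \<preceq> coeff f j * t ^ j" "\<exists>j. coeff f j * t ^ j \<preceq> poly f t" by blast+
qed

lemma noncritical_vle_iff:
  assumes "noncritical f t" "noncritical g t" "t \<noteq> 0"
  shows "poly f t \<preceq> poly g t \<longleftrightarrow> (\<exists>j. \<forall>l. coeff f j * t ^ j \<preceq> coeff g l * t ^ l)"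
  using noncritical_poly[OF assms(1,3)] noncritical_poly[OF assms(2,3)] vle_trans by meson

text \<open>For \<open>j < l\<close> the comparison of \<open>A * t ^ j\<close> with
  \<open>B * t ^ l\<close> switches exactly at the value of an \<open>(l - j)\<close>-th root of
  \<open>A / B\<close>.\<close>

lemma critical_values:
  assumes "finite M" "0 \<notin> M"
  obtains Z where "finite Z" "0 \<notin> Z"
    "\<And>A B j l. A \<in> M \<Longrightarrow> B \<in> M \<Longrightarrow> j < l \<Longrightarrow> l \<le> D \<Longrightarrow> \<exists>z\<in>Z. \<forall>t. t \<noteq> 0 \<longrightarrow>
      (A * t ^ j \<preceq> B * t ^ l \<longleftrightarrow> z \<preceq> t) \<and> (B * t ^ l \<preceq> A * t ^ j \<longleftrightarrow> t \<preceq> z)"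
proof -
  have "\<forall>i\<in>M \<times> M \<times> {1..D}. \<exists>z. z ^ snd (snd i) = fst i / fst (snd i)"
    by (auto intro!: nth_root_exists)
  from bchoice[OF this] obtain \<zeta> where \<zeta>: "\<forall>i\<in>M \<times> M \<times> {1..D}. \<zeta> i ^ snd (snd i) = fst i / fst (snd i)" ..
  show thesis
  proof (rule that[of "\<zeta> ` (M \<times> M \<times> {1..D})"])
    show "0 \<notin> \<zeta> ` (M \<times> M \<times> {1..D})"
    proof
      assume "0 \<in> \<zeta> ` (M \<times> M \<times> {1..D})"
      then obtain A B n where "A \<in> M" "B \<in> M" "n \<in> {1..D}" "\<zeta> (A, B, n) = 0" by auto
      thus False using \<zeta>[rule_format, of "(A, B, n)"] assms(2) by (auto simp: power_0_left)
    qed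
    fix A B j l assume *: "A \<in> M" "B \<in> M" "j < l" "l \<le> D"
    define n where "n = l - j"
    have n: "l = j + n" "n > 0" "(A, B, n) \<in> M \<times> M \<times> {1..D}" using * by (auto simp: n_def)
    have z: "\<zeta> (A, B, n) ^ n = A / B" "B \<noteq> 0" using \<zeta> n(3) assms(2) by auto
    have "(A * t ^ j \<preceq> B * t ^ l \<longleftrightarrow> \<zeta> (A, B, n) \<preceq> t) \<and> (B * t ^ l \<preceq> A * t ^ j \<longleftrightarrow> t \<preceq> \<zeta> (A, B, n))"
      if "t \<noteq> 0" for t
      using vle_mult_cancel(2)[of A "t ^ j" "B * t ^ n"] vle_mult_cancel(2)[of "B * t ^ n" "t ^ j" A]
        root_vle_iff[OF z n(2), of t] that by (simp add: n(1) power_add mult_ac)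
    thus "\<exists>z\<in>\<zeta> ` (M \<times> M \<times> {1..D}). \<forall>t. t \<noteq> 0 \<longrightarrow>
      (A * t ^ j \<preceq> B * t ^ l \<longleftrightarrow> z \<preceq> t) \<and> (B * t ^ l \<preceq> A * t ^ j \<longleftrightarrow> t \<preceq> z)"
      using n(3) by blast
  qed (use assms(1) in simp)
qed

lemma critical_values_polys:
  assumes fin: "finite T" and deg: "\<And>\<tau>. \<tau> \<in> T \<Longrightarrow> degree (f \<tau>) \<le> D"
  obtains Z where "finite Z" "0 \<notin> Z"
    "\<And>\<tau> t. \<tau> \<in> T \<Longrightarrow> t \<noteq> 0 \<Longrightarrow> \<forall>z\<in>Z. \<not> (z \<preceq> t \<and> t \<preceq> z) \<Longrightarrow> noncritical (f \<tau>) t"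
    "\<And>\<tau> \<sigma> j l s t. \<tau> \<in> T \<Longrightarrow> \<sigma> \<in> T \<Longrightarrow> s \<noteq> 0 \<Longrightarrow> t \<noteq> 0 \<Longrightarrow>
      \<forall>z\<in>Z. (z \<preceq> t \<longleftrightarrow> z \<preceq> s) \<and> (t \<preceq> z \<longleftrightarrow> s \<preceq> z) \<Longrightarrow>
      coeff (f \<tau>) j * t ^ j \<preceq> coeff (f \<sigma>) l * t ^ l \<longleftrightarrow> coeff (f \<tau>) j * s ^ j \<preceq> coeff (f \<sigma>) l * s ^ l"
proof -
  define M where "M = (\<lambda>(\<tau>, j). coeff (f \<tau>) j) ` (T \<times> {..D}) - {0}"
  have M: "finite M" "0 \<notin> M" using fin by (auto simp: M_def)
  have le: "j \<le> D" if "coeff (f \<tau>) j \<noteq> 0" "\<tau> \<in> T" for \<tau> j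
    using le_degree[OF that(1)] deg[OF that(2)] by simp
  have mem: "coeff (f \<tau>) j \<in> M" if "coeff (f \<tau>) j \<noteq> 0" "\<tau> \<in> T" for \<tau> j
    using that le[OF that] by (force simp: M_def)
  obtain Z where Z: "finite Z" "0 \<notin> Z"
    "\<And>A B j l. A \<in> M \<Longrightarrow> B \<in> M \<Longrightarrow> j < l \<Longrightarrow> l \<le> D \<Longrightarrow> \<exists>z\<in>Z. \<forall>t. t \<noteq> 0 \<longrightarrow>
      (A * t ^ j \<preceq> B * t ^ l \<longleftrightarrow> z \<preceq> t) \<and> (B * t ^ l \<preceq> A * t ^ j \<longleftrightarrow> t \<preceq> z)"
    by (rule critical_values[OF M, of D]) (rule that)
  show thesis
  proof (rule that[OF Z(1,2)])
    fix \<tau> t assume *: "\<tau> \<in> T" "t \<noteq> 0" "\<forall>z\<in>Z. \<not> (z \<preceq> t \<and> t \<preceq> z)"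
    have neq: "\<not> (coeff (f \<tau>) j * t ^ j \<preceq> coeff (f \<tau>) l * t ^ l \<and> coeff (f \<tau>) l * t ^ l \<preceq> coeff (f \<tau>) j * t ^ j)"
      if "j < l" "coeff (f \<tau>) j \<noteq> 0" "coeff (f \<tau>) l \<noteq> 0" for j l
      using Z(3)[OF mem[OF that(2) *(1)] mem[OF that(3) *(1)] that(1) le[OF that(3) *(1)]] *(2,3) by blast
    show "noncritical (f \<tau>) t"
      unfolding noncritical_def
    proof (intro allI impI)
      fix j l :: nat assume "j \<noteq> l" "coeff (f \<tau>) j \<noteq> 0" "coeff (f \<tau>) l \<noteq> 0"
      thus "\<not> (coeff (f \<tau>) j * t ^ j \<preceq> coeff (f \<tau>) l * t ^ l \<and> coeff (f \<tau>) l * t ^ l \<preceq> coeff (f \<tau>) j * t ^ j)"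
        using neq[of j l] neq[of l j] by (cases "j < l") auto
    qed
  next
    fix \<tau> \<sigma> j l s t
    assume *: "\<tau> \<in> T" "\<sigma> \<in> T" "s \<noteq> 0" "t \<noteq> 0" 
      "\<forall>z\<in>Z. (z \<preceq> t \<longleftrightarrow> z \<preceq> s) \<and> (t \<preceq> z \<longleftrightarrow> s \<preceq> z)"
    show "coeff (f \<tau>) j * t ^ j \<preceq> coeff (f \<sigma>) l * t ^ l \<longleftrightarrow> coeff (f \<tau>) j * s ^ j \<preceq> coeff (f \<sigma>) l * s ^ l"
    proof (cases "coeff (f \<tau>) j = 0 \<or> coeff (f \<sigma>) l = 0")
      case True
      thus ?thesis using *(3,4) by auto
    next
      case False
      hence nz: "coeff (f \<tau>) j \<noteq> 0" "coeff (f \<sigma>) l \<noteq> 0" by auto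
      consider "j < l" | "j = l" | "l < j" by linarith
      thus ?thesis
      proof cases
        case 1
        show ?thesis 
          using Z(3)[OF mem[OF nz(1) *(1)] mem[OF nz(2) *(2)] 1 le[OF nz(2) *(2)]] *(3-5) by blast
      next
        case 2
        thus ?thesis using *(3,4) by simp
      next
        case 3
        show ?thesis
          using Z(3)[OF mem[OF nz(2) *(2)] mem[OF nz(1) *(1)] 3 le[OF nz(1) *(1)]] *(3-5) by blast
      qed
    qed
  qed
qed

section \<open>Classification of definable submodules of the field\<close>

definition integral_submodule :: "'k set \<Rightarrow> bool" where
  "integral_submodule I \<longleftrightarrow> 0 \<in> I \<and> (\<forall>x\<in>I. \<forall>y\<in>I. x + y \<in> I) \<and> (\<forall>x\<in>I. \<forall>a. 1 \<preceq> a \<longrightarrow> a * x \<in> I)"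

lemma integral_quotient: "x \<preceq> y \<Longrightarrow> x \<noteq> 0 \<Longrightarrow> 1 \<preceq> y / x"
  using vle_mult_cancel(1)[of x 1 "y / x"] by simp

lemma integral_submodule_upward:
  assumes "integral_submodule I" "x \<in> I" "x \<preceq> y" shows "y \<in> I"
proof (cases "x = 0")
  case False
  thus ?thesis using assms integral_quotient[of x y] unfolding integral_submodule_def
    by (metis nonzero_divide_eq_eq)
qed (use assms in auto)

text \<open>A nonzero element of least value in \<open>I\<close>, or an element of greatest value
  outside, would produce one of the four forms. Otherwise \<open>I\<close> is a cut without
  endpoints, and points sufficiently close to it on its two sides are separated by no critical
  value, hence indistinguishable.\<close>

theorem qf_submodule_cases:
  assumes I: "integral_submodule I" and qf: "qf (\<lambda>e. e 0 \<in> I)"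
  shows "I = {0} \<or> I = UNIV \<or> (\<exists>a. a \<noteq> 0 \<and> I = {x. a \<preceq> x}) \<or> (\<exists>a. a \<noteq> 0 \<and> I = {x. a \<prec> x})"
proof (rule ccontr)
  assume neg: "\<not> ?thesis"
  have 0: "0 \<in> I" using I by (simp add: integral_submodule_def)
  note up = integral_submodule_upward[OF I]
  have nomin: "\<exists>x\<in>I. x \<noteq> 0 \<and> x \<prec> a" if "a \<in> I" "a \<noteq> 0" for a
  proof -
    have "\<not> (\<forall>x\<in>I. a \<preceq> x)"
    proof
      assume "\<forall>x\<in>I. a \<preceq> x"
      hence "I = {x. a \<preceq> x}" using up[OF that(1)] by blast
      thus False using neg that by blast
    qed
    thus ?thesis by force
  qed
  have nomax: "\<exists>x. x \<notin> I \<and> a \<prec> x" if "a \<notin> I" for a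
  proof -
    have "a \<noteq> 0" using 0 that by blast
    have "\<not> (\<forall>x. x \<notin> I \<longrightarrow> x \<preceq> a)"
    proof
      assume "\<forall>x. x \<notin> I \<longrightarrow> x \<preceq> a"
      hence "I = {x. a \<prec> x}" using up that by blast
      thus False using neg \<open>a \<noteq> 0\<close> by blast
    qed
    thus ?thesis by blast
  qed
  obtain T where T: "finite T" "T \<subseteq> polyfun" "\<And>e e'. agree T e e' \<Longrightarrow> e 0 \<in> I \<longleftrightarrow> e' 0 \<in> I"
    by (rule transfersE[OF qf[unfolded qf_def]]) (rule that)
  have "\<forall>\<tau>\<in>T. \<exists>d F. polyfam d F \<and> (\<forall>e a. \<tau> (case_nat a e) = poly (F e) a)"
    using polyfun_case_nat T(2) by (metis subsetD)
  from bchoice[OF this] obtain d where 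
    "\<forall>\<tau>\<in>T. \<exists>F. polyfam (d \<tau>) F \<and> (\<forall>e a. \<tau> (case_nat a e) = poly (F e) a)" ..
  from bchoice[OF this] obtain F where 
    F: "\<forall>\<tau>\<in>T. polyfam (d \<tau>) (F \<tau>) \<and> (\<forall>e a. \<tau> (case_nat a e) = poly (F \<tau> e) a)" ..
  define f where "f \<tau> = F \<tau> (\<lambda>_. 0)" for \<tau>
  have deg: "degree (f \<tau>) \<le> sum d T" if "\<tau> \<in> T" for \<tau>
  proof -
    have "degree (f \<tau>) \<le> d \<tau>" using F that polyfam_degree unfolding f_def by blast
    also have "d \<tau> \<le> sum d T" using that T(1) by (intro member_le_sum) auto
    finally show ?thesis .
  qed
  obtain Z where Z: "finite Z" "0 \<notin> Z"
    "\<And>\<tau> t. \<tau> \<in> T \<Longrightarrow> t \<noteq> 0 \<Longrightarrow> \<forall>z\<in>Z. \<not> (z \<preceq> t \<and> t \<preceq> z) \<Longrightarrow> noncritical (f \<tau>) t"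
    "\<And>\<tau> \<sigma> j l s t. \<tau> \<in> T \<Longrightarrow> \<sigma> \<in> T \<Longrightarrow> s \<noteq> 0 \<Longrightarrow> t \<noteq> 0 \<Longrightarrow>
      \<forall>z\<in>Z. (z \<preceq> t \<longleftrightarrow> z \<preceq> s) \<and> (t \<preceq> z \<longleftrightarrow> s \<preceq> z) \<Longrightarrow>
      coeff (f \<tau>) j * t ^ j \<preceq> coeff (f \<sigma>) l * t ^ l \<longleftrightarrow> coeff (f \<tau>) j * s ^ j \<preceq> coeff (f \<sigma>) l * s ^ l"
    by (rule critical_values_polys[of T f "sum d T", OF T(1) deg]) (assumption, rule that)
  \<comment> \<open>A point of \<open>I\<close> closer to the cut than all critical values in
    \<open>I\<close>; its counterpart \<open>s\<close> is closer than all those outside.\<close>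
  obtain t where t: "t \<in> I" "t \<noteq> 0" "\<And>z. z \<in> Z \<Longrightarrow> z \<in> I \<Longrightarrow> t \<prec> z"
  proof (cases "Z \<inter> I = {}")
    case True
    obtain t where "t \<in> I" "t \<noteq> 0" using neg 0 by blast
    thus thesis using that True by blast
  next
    case False
    obtain m where m: "m \<in> Z" "m \<in> I" "\<And>z. z \<in> Z \<Longrightarrow> z \<in> I \<Longrightarrow> m \<preceq> z"
      using finite_vle_minimum[of "Z \<inter> I" "\<lambda>z. z"] Z(1) False by auto
    hence "m \<noteq> 0" using Z(2) by auto
    obtain t where "t \<in> I" "t \<noteq> 0" "t \<prec> m" using nomin[OF m(2) \<open>m \<noteq> 0\<close>] by blast
    thus thesis using that m(3) vlt_vle_trans by blast
  qed
  obtain s where s: "s \<notin> I" "\<And>z. z \<in> Z \<Longrightarrow> z \<notin> I \<Longrightarrow> z \<prec> s"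
  proof (cases "Z - I = {}")
    case True
    obtain s where "s \<notin> I" using neg by blast
    thus thesis using that True by blast
  next
    case False
    obtain m where m: "m \<in> Z" "m \<notin> I" "\<And>z. z \<in> Z \<Longrightarrow> z \<notin> I \<Longrightarrow> z \<preceq> m"
      using finite_vle_maximum[of "Z - I" "\<lambda>z. z"] Z(1) False by auto
    obtain s where "s \<notin> I" "m \<prec> s" using nomax[OF m(2)] by blast
    thus thesis using that m(3) vle_vlt_trans by blast
  qed
  have s0: "s \<noteq> 0" using s(1) 0 by auto
  \<comment> \<open>Critical values in \<open>I\<close> lie strictly above both points, the others
    strictly below both.\<close>
  have cut: "(z \<preceq> t \<longleftrightarrow> z \<preceq> s) \<and> (t \<preceq> z \<longleftrightarrow> s \<preceq> z) \<and> \<not> (z \<preceq> t \<and> t \<preceq> z) \<and> \<not> (z \<preceq> s \<and> s \<preceq> z)"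
    if "z \<in> Z" for z
  proof (cases "z \<in> I")
    case True
    have "s \<prec> z" using up[OF True] s(1) by blast
    thus ?thesis using t(3)[OF that True] vlt_imp_vle by blast
  next
    case False
    have "z \<prec> t" using up[OF t(1)] False by blast
    thus ?thesis using s(2)[OF that False] vlt_imp_vle by blast
  qed
  have "agree T (case_nat t (\<lambda>_. 0)) (case_nat s (\<lambda>_. 0))"
    unfolding agree_def
  proof (intro ballI)
    fix \<tau> \<sigma> assume *: "\<tau> \<in> T" "\<sigma> \<in> T"
    have "poly (f \<tau>) t \<preceq> poly (f \<sigma>) t \<longleftrightarrow> (\<exists>j. \<forall>l. coeff (f \<tau>) j * t ^ j \<preceq> coeff (f \<sigma>) l * t ^ l)"
      by (intro noncritical_vle_iff Z(3) * t(2)) (use cut in blast)+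
    also have "\<dots> \<longleftrightarrow> (\<exists>j. \<forall>l. coeff (f \<tau>) j * s ^ j \<preceq> coeff (f \<sigma>) l * s ^ l)"
      using Z(4)[OF * s0 t(2)] cut by simp
    also have "\<dots> \<longleftrightarrow> poly (f \<tau>) s \<preceq> poly (f \<sigma>) s"
      by (intro noncritical_vle_iff[symmetric] Z(3) * s0) (use cut in blast)+
    finally show "\<tau> (case_nat t (\<lambda>_. 0)) \<preceq> \<sigma> (case_nat t (\<lambda>_. 0)) \<longleftrightarrow>
      \<tau> (case_nat s (\<lambda>_. 0)) \<preceq> \<sigma> (case_nat s (\<lambda>_. 0))"
      using F * by (simp add: f_def)
  qed
  from T(3)[OF this] show False using t(1) s(1) by simp
qed

section \<open>Common points of definable families of balls\<close>

lemma poly_vle_const: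
  assumes "\<And>r. r \<in># proots q \<Longrightarrow> c - r \<preceq> c' - r"
  shows "poly q c \<preceq> poly q c'"
proof (cases "q = 0")
  case False
  have prod: "(\<Prod>r\<in>#A. c - r) \<preceq> (\<Prod>r\<in>#A. c' - r)" if "\<And>r. r \<in># A \<Longrightarrow> c - r \<preceq> c' - r" for A
    using that by (induction A) (auto intro: vle_mult)
  have "poly q x = lead_coeff q * (\<Prod>r\<in>#proots q. x - r)" for x
    by (subst proots_factorization[OF False])
      (simp add: poly_prod_mset image_mset.compositionality o_def)
  thus ?thesis using prod[of "proots q"] assms by (simp add: vle_mult)
qed simp

text \<open>Definable spherical completeness: the sets \<open>C t = {c. R (c * t) t}\<close> form a nested
  definable family of balls. If their intersection were empty, then the valuation of every polynomial
  in \<open>c\<close> would be eventually constant along the family, and hence membership in \<open>C t\<close> could not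
  distinguish points deep in the family.\<close>

theorem qf_linear_section:
  assumes zero: "R 0 0" and add: "\<And>x y s t. R x s \<Longrightarrow> R y t \<Longrightarrow> R (x + y) (s + t)"
    and scale: "\<And>x t a. 1 \<preceq> a \<Longrightarrow> R x t \<Longrightarrow> R (a * x) (a * t)"
    and qf: "qf (\<lambda>e. R (e 0) (e 1))"
  shows "\<exists>c. \<forall>x t. R x t \<longrightarrow> R (c * t) t"
proof (rule ccontr)
  assume neg: "\<not> ?thesis"
  define J where "J = {t. \<exists>x. R x t}"
  define C where "C t = {c. R (c * t) t}" for t
  have neg': "\<exists>t\<in>J. c \<notin> C t" for c using neg unfolding J_def C_def by blast
  have C0: "C 0 = UNIV" using zero by (simp add: C_def)
  have J: "integral_submodule J"
    unfolding integral_submodule_def J_def using zero add scale by blast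
  have diff: "R (x - y) (s - t)" if "R x s" "R y t" for x y s t
    using add[OF that(1) scale[OF _ that(2), of "-1"]] by simp
  have ne: "C t \<noteq> {}" if t: "t \<in> J" for t
  proof (cases "t = 0")
    case False
    obtain x where "R x t" using t by (auto simp: J_def)
    hence "x / t \<in> C t" using False by (simp add: C_def)
    thus ?thesis by blast
  qed (simp add: C0)
  \<comment> \<open>Multiplying by the integral element \<open>t / s\<close> shows that the balls
    shrink as the value of \<open>t\<close> decreases.\<close>
  have mono: "C s \<subseteq> C t" if "s \<preceq> t" for s t
  proof (cases "s = 0")
    case False
    have "R (c * t) t" if "R (c * s) s" for c
      using scale[OF integral_quotient[OF \<open>s \<preceq> t\<close> False] that] False by (simp add: mult.commute)
    thus ?thesis by (auto simp: C_def)
  qed (use that in simp)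
  \<comment> \<open>\<open>C t\<close> is a coset of the submodule of all \<open>z\<close> with
    \<open>R (z * t) 0\<close>. If the value of \<open>c - c'\<close> were at most that of
    \<open>c' - r\<close>, then \<open>c' - r\<close> would be in this submodule and
    \<open>r\<close> in \<open>C t\<close>. So \<open>c - c'\<close> is negligible.\<close>
  have ball: "c - r \<preceq> c' - r" if c: "c \<in> C t" "c' \<in> C t" "r \<notin> C t" for c c' r t
  proof (cases "c - c' \<preceq> c' - r \<and> c \<noteq> c'")
    case True
    have "R ((c - c') * t) 0" using diff[of "c * t" t "c' * t" t] c by (simp add: C_def algebra_simps)
    moreover have "1 \<preceq> (c' - r) / (c - c')" using True by (intro integral_quotient) auto
    ultimately have "R ((c' - r) / (c - c') * ((c - c') * t)) ((c' - r) / (c - c') * 0)" by (intro scale)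
    moreover have "(c' - r) / (c - c') * ((c - c') * t) = (c' - r) * t" using True by simp
    ultimately have "R ((c' - r) * t) 0" by simp
    from diff[OF _ this, of "c' * t" t] have "r \<in> C t" using c by (simp add: C_def algebra_simps)
    thus ?thesis using c by simp
  next
    case False
    hence "c' - r \<preceq> c' - r + (c - c') \<and> c' - r + (c - c') \<preceq> c' - r"
      using vle_dominant(1,2)[of "c - c'" "c' - r"] by (cases "c = c'") auto
    thus ?thesis by simp
  qed
  \<comment> \<open>A least \<open>s\<close> would have the smallest ball, whose points would be
    common to the whole family.\<close>
  have nomin: "\<exists>t\<in>J. t \<noteq> 0 \<and> t \<prec> s" if s: "s \<in> J" "s \<noteq> 0" for s
  proof -
    obtain c where "c \<in> C s" using ne[OF s(1)] by blast
    moreover obtain t where "t \<in> J" "c \<notin> C t" using neg' by blast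
    ultimately have "t \<prec> s" "t \<noteq> 0" using mono[of s t] C0 by auto
    thus ?thesis using \<open>t \<in> J\<close> by blast
  qed
  \<comment> \<open>Each of the finitely many roots of \<open>q\<close> is missed by some ball, so
    one deep enough contains none; its points then have equal distances to every root.\<close>
  have ev_const: "\<exists>t\<in>J. t \<noteq> 0 \<and> (\<forall>c\<in>C t. \<forall>c'\<in>C t. poly q c \<preceq> poly q c')" for q
  proof -
    have "\<exists>t\<in>J. t \<noteq> 0 \<and> (\<forall>r\<in>A. r \<notin> C t)" if "finite A" for A
      using that
    proof (induction rule: finite_induct)
      case empty
      obtain t where t: "t \<in> J" "0 \<notin> C t" using neg' by blast
      hence "t \<noteq> 0" using C0 by auto
      thus ?case using t(1) by blast
    next
      case (insert r A)
      then obtain t where t: "t \<in> J" "t \<noteq> 0" "\<forall>r\<in>A. r \<notin> C t" by blast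
      obtain s where s: "s \<in> J" "r \<notin> C s" using neg' by blast
      hence "s \<noteq> 0" using C0 by auto
      show ?case
      proof (cases "s \<preceq> t")
        case True
        thus ?thesis using mono[OF True] s t \<open>s \<noteq> 0\<close> by blast
      next
        case False
        hence "t \<preceq> s" by (rule vlt_imp_vle)
        thus ?thesis using mono[OF \<open>t \<preceq> s\<close>] s t by blast
      qed
    qed
    from this[of "set_mset (proots q)"] obtain t where "t \<in> J" "t \<noteq> 0" "\<forall>r\<in>#proots q. r \<notin> C t"
      by auto
    thus ?thesis using poly_vle_const[of q] ball by blast
  qed
  define P where "P e \<longleftrightarrow> R (e 1 * e 0) (e 0)" for e :: "nat \<Rightarrow> 'k"
  have "qf P"
  proof -
    have "(\<lambda>e. (case i of 0 \<Rightarrow> e 1 * e 0 | Suc _ \<Rightarrow> e (0::nat))) \<in> polyfun" for i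
      by (cases i) (auto intro: polyfun.intros)
    from qf_subst[OF qf, of "\<lambda>e i. case i of 0 \<Rightarrow> e 1 * e 0 | Suc _ \<Rightarrow> e 0", OF this]
    show ?thesis by (simp add: P_def[abs_def])
  qed
  then obtain T where T: "finite T" "T \<subseteq> polyfun" "\<And>e e'. agree T e e' \<Longrightarrow> P e = P e'"
    unfolding qf_def by (rule transfersE) (rule that)
  have "\<forall>\<tau>\<in>T. \<exists>d F. polyfam d F \<and> (\<forall>e a. \<tau> (case_nat a e) = poly (F e) a)"
    using polyfun_case_nat T(2) by (metis subsetD)
  from bchoice[OF this] obtain d where 
    "\<forall>\<tau>\<in>T. \<exists>F. polyfam (d \<tau>) F \<and> (\<forall>e a. \<tau> (case_nat a e) = poly (F e) a)" ..
  from bchoice[OF this] obtain F where 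
    F: "\<forall>\<tau>\<in>T. polyfam (d \<tau>) (F \<tau>) \<and> (\<forall>e a. \<tau> (case_nat a e) = poly (F \<tau> e) a)" ..
  define f where "f c \<tau> = F \<tau> (case_nat c (\<lambda>_. 0))" for c \<tau>
  have deg: "degree (f c \<tau>) \<le> sum d T" if "\<tau> \<in> T" for c \<tau>
  proof -
    have "degree (f c \<tau>) \<le> d \<tau>" using F that polyfam_degree unfolding f_def by blast
    also have "d \<tau> \<le> sum d T" using that T(1) by (intro member_le_sum) auto
    finally show ?thesis .
  qed
  \<comment> \<open>The coefficients of \<open>f c \<tau>\<close> are themselves polynomials in
    \<open>c\<close>, so their values stabilise along the family.\<close>
  have "\<forall>i\<in>T \<times> {..sum d T}. \<exists>t. t \<in> J \<and> t \<noteq> 0 \<and>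
    (\<forall>c\<in>C t. \<forall>c'\<in>C t. coeff (f c (fst i)) (snd i) \<preceq> coeff (f c' (fst i)) (snd i))"
  proof
    fix i assume "i \<in> T \<times> {..sum d T}"
    hence "polyfam (d (fst i)) (F (fst i))" using F by auto
    from polyfam_coeff[OF this] 
    obtain m G where "polyfam m G" "\<And>e c. coeff (F (fst i) (case_nat c e)) (snd i) = poly (G e) c"
      by (rule polyfun_case_nat) (rule that)
    thus "\<exists>t. t \<in> J \<and> t \<noteq> 0 \<and>
      (\<forall>c\<in>C t. \<forall>c'\<in>C t. coeff (f c (fst i)) (snd i) \<preceq> coeff (f c' (fst i)) (snd i))"
      using ev_const[of "G (\<lambda>_. 0)"] unfolding f_def by auto
  qed
  from bchoice[OF this] obtain \<theta> where \<theta>: "\<forall>i\<in>T \<times> {..sum d T}. \<theta> i \<in> J \<and> \<theta> i \<noteq> 0 \<and>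
    (\<forall>c\<in>C (\<theta> i). \<forall>c'\<in>C (\<theta> i). coeff (f c (fst i)) (snd i) \<preceq> coeff (f c' (fst i)) (snd i))" ..
  obtain tt where tt: "tt \<in> J" "tt \<noteq> 0" using ev_const[of 0] by blast
  have fin: "finite (insert tt (\<theta> ` (T \<times> {..sum d T})))" using T(1) by simp
  obtain t0 where t0: "t0 \<in> insert tt (\<theta> ` (T \<times> {..sum d T}))"
    "\<And>t. t \<in> insert tt (\<theta> ` (T \<times> {..sum d T})) \<Longrightarrow> t0 \<preceq> t"
    using finite_vle_minimum[OF fin, of "\<lambda>t. t"] by blast
  have t0J: "t0 \<in> J" "t0 \<noteq> 0" using t0(1) tt \<theta> by auto
  have coeff_const: "coeff (f c \<tau>) j \<preceq> coeff (f c' \<tau>) j" if "\<tau> \<in> T" "c \<in> C t0" "c' \<in> C t0" for \<tau> j c c'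
  proof (cases "j \<le> sum d T")
    case True
    hence i: "(\<tau>, j) \<in> T \<times> {..sum d T}" using that by simp
    hence "C t0 \<subseteq> C (\<theta> (\<tau>, j))" by (intro mono t0(2)) blast
    thus ?thesis using \<theta>[rule_format, OF i] that by auto
  next
    case False
    thus ?thesis using deg[OF that(1), of c] deg[OF that(1), of c'] by (simp add: coeff_eq_0)
  qed
  obtain c0 where c0: "c0 \<in> C t0" using ne[OF t0J(1)] by blast
  \<comment> \<open>Coefficients for all slopes in \<open>C t0\<close> have the same values as those
    for \<open>c0\<close>, so the critical values of \<open>c0\<close> serve for all of
    them.\<close>
  obtain Z where Z: "finite Z" "0 \<notin> Z"
    "\<And>\<tau> t. \<tau> \<in> T \<Longrightarrow> t \<noteq> 0 \<Longrightarrow> \<forall>z\<in>Z. \<not> (z \<preceq> t \<and> t \<preceq> z) \<Longrightarrow> noncritical (f c0 \<tau>) t"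
    by (rule critical_values_polys[of T "f c0" "sum d T", OF T(1) deg]) (assumption, rule that)
  have fin: "finite (insert t0 (Z \<inter> J))" using Z(1) by simp
  \<comment> \<open>Going below \<open>m\<close> passes all critical values in \<open>J\<close>.
    Critical values outside \<open>J\<close> do no harm, since \<open>J\<close> is closed
    upwards.\<close>
  obtain m where m: "m \<in> insert t0 (Z \<inter> J)" "\<And>z. z \<in> insert t0 (Z \<inter> J) \<Longrightarrow> m \<preceq> z"
    using finite_vle_minimum[OF fin, of "\<lambda>t. t"] by blast
  have "m \<in> J" "m \<noteq> 0" using m(1) t0J Z(2) by auto
  then obtain t1 where t1: "t1 \<in> J" "t1 \<noteq> 0" "t1 \<prec> m" using nomin by blast
  obtain c where c: "c \<in> C t1" using ne[OF t1(1)] by blast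
  \<comment> \<open>The slope \<open>c\<close> drops out of the family at \<open>t2\<close>, where
    \<open>c'\<close> is still admissible; yet at \<open>t2\<close> both produce the same
    comparisons.\<close>
  obtain t2 where t2: "t2 \<in> J" "c \<notin> C t2" using neg' by blast
  have t2_0: "t2 \<noteq> 0" using t2(2) C0 by auto
  have t21: "t2 \<prec> t1" using mono[of t1 t2] c t2(2) by blast
  obtain c' where c': "c' \<in> C t2" using ne[OF t2(1)] by blast
  have "m \<preceq> t0" by (rule m(2)) simp
  have "t1 \<preceq> t0" "t2 \<preceq> t0"
    using vle_trans[OF vlt_imp_vle[OF t1(3)] \<open>m \<preceq> t0\<close>] vle_trans[OF vlt_imp_vle[OF t21]] by blast+
  hence cc: "c \<in> C t0" "c' \<in> C t0" using mono c c' by blast+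
  have noncrit: "\<not> (z \<preceq> t2 \<and> t2 \<preceq> z)" if "z \<in> Z" for z
  proof
    assume z: "z \<preceq> t2 \<and> t2 \<preceq> z"
    hence "z \<in> J" using integral_submodule_upward[OF J t2(1)] by blast
    hence "m \<preceq> z" using that m(2) by blast
    hence "m \<preceq> t2" using z vle_trans by blast
    hence "m \<preceq> t1" using t21 vlt_imp_vle vle_trans by blast
    thus False using t1(3) by blast
  qed
  have nc0: "noncritical (f c0 \<tau>) t2" if "\<tau> \<in> T" for \<tau>
    by (rule Z(3)[OF that t2_0]) (use noncrit in blast)
  have mon: "coeff (f b \<tau>) j * t2 ^ j \<preceq> coeff (f b \<sigma>) l * t2 ^ l \<longleftrightarrow>
    coeff (f c0 \<tau>) j * t2 ^ j \<preceq> coeff (f c0 \<sigma>) l * t2 ^ l"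
    if "b \<in> C t0" "\<tau> \<in> T" "\<sigma> \<in> T" for b \<tau> \<sigma> j l
    unfolding mult.commute[of _ "t2 ^ j"] mult.commute[of _ "t2 ^ l"]
    by (intro vle_mult_equiv coeff_const that c0)
  have nc: "noncritical (f b \<tau>) t2" if "b \<in> C t0" "\<tau> \<in> T" for b \<tau>
  proof -
    have "coeff (f b \<tau>) j = 0 \<longleftrightarrow> coeff (f c0 \<tau>) j = 0" for j
      using coeff_const[OF that(2) that(1) c0, of j] coeff_const[OF that(2) c0 that(1), of j] by auto
    thus ?thesis using nc0[OF that(2)] mon[OF that(1) that(2) that(2)] by (simp add: noncritical_def)
  qed
  have val: "poly (f b \<tau>) t2 \<preceq> poly (f b \<sigma>) t2 \<longleftrightarrow>
    (\<exists>j. \<forall>l. coeff (f c0 \<tau>) j * t2 ^ j \<preceq> coeff (f c0 \<sigma>) l * t2 ^ l)"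
    if "b \<in> C t0" "\<tau> \<in> T" "\<sigma> \<in> T" for b \<tau> \<sigma>
    using noncritical_vle_iff[OF nc[OF that(1,2)] nc[OF that(1,3)] t2_0] mon[OF that] by simp
  have "agree T (case_nat t2 (case_nat c (\<lambda>_. 0))) (case_nat t2 (case_nat c' (\<lambda>_. 0)))"
    using F val[OF cc(1)] val[OF cc(2)] by (simp add: agree_def f_def)
  from T(3)[OF this] show False using c' t2(2) by (simp add: P_def C_def)
qed

end

section \<open>Splitting definable modules\<close>

context acvf
begin

text \<open>A submodule over the valuation ring, phrased on environments, so that quantifier
  elimination applies to it directly.\<close>

definition integral_predicate :: "((nat \<Rightarrow> 'k) \<Rightarrow> bool) \<Rightarrow> bool" where
  "integral_predicate F \<longleftrightarrow> F (\<lambda>_. 0) \<and> (\<forall>x y. F x \<longrightarrow> F y \<longrightarrow> F (\<lambda>i. x i + y i)) \<and>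
    (\<forall>x a. 1 \<preceq> a \<longrightarrow> F x \<longrightarrow> F (\<lambda>i. a * x i))"

definition combination :: "nat \<Rightarrow> (nat \<Rightarrow> nat \<Rightarrow> 'k) \<Rightarrow> (nat \<Rightarrow> 'k) \<Rightarrow> nat \<Rightarrow> 'k" where
  "combination k u y j = (\<Sum>i<k. y i * u i j)"

definition unit_at :: "nat \<Rightarrow> 'k \<Rightarrow> nat \<Rightarrow> 'k" where
  "unit_at k t j = (if j = k then t else 0)"

lemma combination_cong: "(\<And>i. i < k \<Longrightarrow> y i = z i) \<Longrightarrow> combination k u y = combination k u z"
  by (simp add: combination_def fun_eq_iff)

text \<open>The fibre over the new coordinate \<open>t\<close> is a coset of the product of the
  \<open>I i\<close>. Its projection to each coordinate is a definable relation with a linear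
  section \<open>c i\<close>, and the product form lets these sections be assembled into a point of
  the fibre.\<close>

lemma qf_section_step:
  assumes F: "integral_predicate F" and qf: "qf F"
    and split: "\<And>y. F (combination k u y) \<longleftrightarrow> (\<forall>i<k. y i \<in> I i)"
  obtains c J where "integral_submodule J" "qf (\<lambda>e. e 0 \<in> J)"
    "\<And>y t. F (\<lambda>j. combination k u y j + unit_at k t j) \<longleftrightarrow> t \<in> J \<and> (\<forall>i<k. y i - c i * t \<in> I i)"
proof -
  define G where "G y t \<longleftrightarrow> F (\<lambda>j. combination k u y j + unit_at k t j)" for y t
  have F0: "F (\<lambda>_. 0)" using F by (simp add: integral_predicate_def)
  have Fadd: "F (\<lambda>i. x i + y i)" if "F x" "F y" for x y
    using F that by (simp add: integral_predicate_def)
  have Fscale: "F (\<lambda>i. a * x i)" if "1 \<preceq> a" "F x" for a x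
    using F that by (simp add: integral_predicate_def)
  have Gadd: "G (\<lambda>i. x i + y i) (s + t)" if "G x s" "G y t" for x y s t
    using Fadd[OF that[unfolded G_def]]
    by (simp add: G_def combination_def unit_at_def algebra_simps sum.distrib if_distrib cong: if_cong)
  have Gscale: "G (\<lambda>i. a * x i) (a * t)" if "1 \<preceq> a" "G x t" for a x t
  proof -
    have "(\<lambda>j. a * (combination k u x j + unit_at k t j)) =
      (\<lambda>j. combination k u (\<lambda>i. a * x i) j + unit_at k (a * t) j)"
      by (auto simp: fun_eq_iff combination_def unit_at_def sum_distrib_left algebra_simps)
    thus ?thesis using Fscale[OF that(1) that(2)[unfolded G_def]] by (simp add: G_def)
  qed
  have Gdiff: "G (\<lambda>i. x i - y i) (s - t)" if "G x s" "G y t" for x y s t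
    using Gadd[OF that(1) Gscale[OF _ that(2), of "-1"]] by simp
  have G0: "G y 0 \<longleftrightarrow> (\<forall>i<k. y i \<in> I i)" for y
    using split[of y] by (simp add: G_def unit_at_def)
  have Gcong: "G y t \<longleftrightarrow> G z t" if "\<And>i. i < k \<Longrightarrow> y i = z i" for y z t
    using combination_cong[of k y z u] that by (simp add: G_def)
  have G00: "G (\<lambda>_. 0) 0" using F0 by (simp add: G_def combination_def unit_at_def)
  have qfG: "qf (\<lambda>e. G (\<sigma> e) (e m))" if "\<And>i. (\<lambda>e. \<sigma> e i) \<in> polyfun" for \<sigma> m
  proof -
    have "(\<lambda>e. combination k u (\<sigma> e) j + unit_at k (e m) j) \<in> polyfun" for j
      unfolding combination_def unit_at_def
      by (cases "j = k") (auto intro!: polyfun.add polyfun_sum polyfun.mult that intro: polyfun.const polyfun.var)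
    from qf_subst[OF qf, of "\<lambda>e j. combination k u (\<sigma> e) j + unit_at k (e m) j", OF this]
    show ?thesis by (simp add: G_def)
  qed
  \<comment> \<open>\<open>G\<close> depends on the first \<open>k\<close> values of
    \<open>y\<close> only, so the quantifier over functions is one over lists of length
    \<open>k\<close>.\<close>
  have ex: "(\<exists>y. y i = x \<and> G y t) \<longleftrightarrow> (\<exists>ys. length ys = k \<and> prepend ys e i = x \<and> G (prepend ys e) t)"
    if "i < k" for i x t e
  proof
    assume "\<exists>y. y i = x \<and> G y t"
    then obtain y where y: "y i = x" "G y t" by blast
    have "G (prepend (map y [0..<k]) e) t \<longleftrightarrow> G y t" by (rule Gcong) simp
    thus "\<exists>ys. length ys = k \<and> prepend ys e i = x \<and> G (prepend ys e) t"
      using y that by (intro exI[of _ "map y [0..<k]"]) simp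
  qed blast
  have "\<exists>c. \<forall>x t. (\<exists>y. y i = x \<and> G y t) \<longrightarrow> (\<exists>y. y i = c * t \<and> G y t)" if i: "i < k" for i
  proof (rule qf_linear_section)
    show "\<exists>y. y i = 0 \<and> G y 0" using G00 by (intro exI[of _ "\<lambda>_. 0"]) simp
    show "\<exists>z. z i = x + y \<and> G z (s + t)" if "\<exists>y. y i = x \<and> G y s" "\<exists>z. z i = y \<and> G z t" for x y s t
      using that Gadd by force
    show "\<exists>y. y i = a * x \<and> G y (a * t)" if "1 \<preceq> a" "\<exists>y. y i = x \<and> G y t" for x t a
      using that Gscale by force
    have "qf (\<lambda>X. X i = X k \<and> G X (X (k + 1)))"
      by (intro qf_conj qf_eq polyfun.var qfG)
    from qf_ex_list[OF this, of k]
    have "qf (\<lambda>e. \<exists>ys. length ys = k \<and> prepend ys e i = prepend ys e k \<and> G (prepend ys e) (prepend ys e (k + 1)))" .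
    moreover have "prepend ys e k = e 0" "prepend ys e (k + 1) = e 1" if "length ys = k" for ys and e :: "nat \<Rightarrow> 'k"
      using that by (simp_all add: prepend_def)
    hence "(\<exists>y. y i = e 0 \<and> G y (e 1)) \<longleftrightarrow>
      (\<exists>ys. length ys = k \<and> prepend ys e i = prepend ys e k \<and> G (prepend ys e) (prepend ys e (k + 1)))" for e
      unfolding ex[OF i, where x = "e 0" and t = "e 1" and e = e] by (metis (no_types, lifting))
    ultimately show "qf (\<lambda>e. \<exists>y. y i = e 0 \<and> G y (e 1))" by (simp only:)
  qed
  hence "\<forall>i. \<exists>c. i < k \<longrightarrow> (\<forall>x t. (\<exists>y. y i = x \<and> G y t) \<longrightarrow> (\<exists>y. y i = c * t \<and> G y t))" by blast
  from choice[OF this] obtain c where c: "\<And>i y t. i < k \<Longrightarrow> G y t \<Longrightarrow> \<exists>z. z i = c i * t \<and> G z t" by metis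
  define J where "J = {t. \<exists>y. G y t}"
  \<comment> \<open>For each \<open>i\<close> separately, \<open>c i * t\<close> is the coordinate
    of some point of the fibre, so it differs from \<open>y i\<close> by an element of
    \<open>I i\<close>. These differences together form an element of the kernel because the kernel
    is a product.\<close>
  have Gc: "G (\<lambda>i. c i * t) t" if y: "G y t" for y t
  proof -
    have "c i * t - y i \<in> I i" if i: "i < k" for i
    proof -
      obtain z where z: "z i = c i * t" "G z t" using c[OF i y] by blast
      have "G (\<lambda>i. z i - y i) 0" using Gdiff[OF z(2) y] by simp
      from iffD1[OF G0 this] have "z i - y i \<in> I i" using i by simp
      thus ?thesis by (simp add: z(1))
    qed
    hence "G (\<lambda>i. c i * t - y i) 0" by (simp add: G0)
    from Gadd[OF this y] show ?thesis by simp
  qed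
  have "integral_submodule J"
    unfolding integral_submodule_def J_def using G00 Gadd Gscale by blast
  moreover have "qf (\<lambda>e. e 0 \<in> J)"
  proof -
    \<comment> \<open>The section replaces the existential quantifier in the definition of
      \<open>J\<close>.\<close>
    have "e 0 \<in> J \<longleftrightarrow> G (\<lambda>i. c i * e 0) (e 0)" for e :: "nat \<Rightarrow> 'k" using Gc by (auto simp: J_def)
    moreover have "qf (\<lambda>e. G (\<lambda>i. c i * e 0) (e 0))"
      by (rule qfG[of "\<lambda>e i. c i * e 0"]) (intro polyfun.intros)
    ultimately show ?thesis by (simp only:)
  qed
  moreover have "F (\<lambda>j. combination k u y j + unit_at k t j) \<longleftrightarrow> t \<in> J \<and> (\<forall>i<k. y i - c i * t \<in> I i)" for y t
  proof
    assume "F (\<lambda>j. combination k u y j + unit_at k t j)"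
    hence y: "G y t" by (simp add: G_def)
    from Gdiff[OF y Gc[OF y]] show "t \<in> J \<and> (\<forall>i<k. y i - c i * t \<in> I i)"
      using y G0 by (auto simp: J_def)
  next
    assume *: "t \<in> J \<and> (\<forall>i<k. y i - c i * t \<in> I i)"
    hence "G (\<lambda>i. y i - c i * t) 0" "G (\<lambda>i. c i * t) t" using G0 Gc by (auto simp: J_def)
    from Gadd[OF this] show "F (\<lambda>j. combination k u y j + unit_at k t j)" by (simp add: G_def)
  qed
  ultimately show thesis by (rule that)
qed

definition standard_submodule :: "'k set \<Rightarrow> bool" where
  "standard_submodule I \<longleftrightarrow> I \<in> {{0}, UNIV, val_integers v, val_maximal_ideal v}"

lemma val_integers_eq: "val_integers v = {x. 1 \<preceq> x}"
  by (auto simp: val_integers_def val_le_def)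

lemma val_maximal_ideal_eq: "val_maximal_ideal v = {x. 1 \<prec> x}"
  by (auto simp: val_maximal_ideal_def val_le_def)

lemma qf_submodule_standard:
  assumes "integral_submodule J" "qf (\<lambda>e. e 0 \<in> J)"
  obtains a I where "a \<noteq> 0" "standard_submodule I" "\<And>x. a * x \<in> J \<longleftrightarrow> x \<in> I"
proof -
  consider "J = {0}" | "J = UNIV" | a where "a \<noteq> 0" "J = {x. a \<preceq> x}" | a where "a \<noteq> 0" "J = {x. a \<prec> x}"
    using qf_submodule_cases[OF assms] by blast
  thus thesis
  proof cases
    case 1
    thus thesis using that[of 1 "{0}"] by (simp add: standard_submodule_def)
  next
    case 2
    thus thesis using that[of 1 UNIV] by (simp add: standard_submodule_def)
  next
    case (3 a)
    have "a * x \<in> J \<longleftrightarrow> x \<in> val_integers v" for x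
      using vle_mult_cancel(1)[of a 1 x] 3 by (simp add: val_integers_eq)
    thus thesis using that[of a "val_integers v"] 3 by (simp add: standard_submodule_def)
  next
    case (4 a)
    have "a * x \<in> J \<longleftrightarrow> x \<in> val_maximal_ideal v" for x
      using vle_mult_cancel(1)[of a x 1] 4 by (simp add: val_maximal_ideal_eq)
    thus thesis using that[of a "val_maximal_ideal v"] 4 by (simp add: standard_submodule_def)
  qed
qed

text \<open>Coordinates are adjoined one by one. Each new vector is nonzero at its own coordinate
  and 0 beyond it, so the vectors form a basis in which the module is a product.\<close>

theorem qf_submodule_triangular:
  assumes F: "integral_predicate F" and qf: "qf F"
  shows "\<exists>u I. (\<forall>i<k. u i i \<noteq> 0 \<and> (\<forall>j>i. u i j = 0)) \<and> (\<forall>i<k. standard_submodule (I i)) \<and>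
    (\<forall>y. F (combination k u y) \<longleftrightarrow> (\<forall>i<k. y i \<in> I i))"
proof (induction k)
  case 0
  have "combination 0 u y = (\<lambda>_. 0)" for u y by (simp add: combination_def fun_eq_iff)
  thus ?case using F by (simp add: integral_predicate_def)
next
  case (Suc k)
  then obtain u I where u': "\<forall>i<k. u i i \<noteq> 0 \<and> (\<forall>j>i. u i j = 0)"
    and I: "\<forall>i<k. standard_submodule (I i)"
    and split': "\<forall>y. F (combination k u y) \<longleftrightarrow> (\<forall>i<k. y i \<in> I i)" by (elim exE conjE)
  have u: "\<And>i. i < k \<Longrightarrow> u i i \<noteq> 0" "\<And>i j. i < k \<Longrightarrow> i < j \<Longrightarrow> u i j = 0" using u' by auto
  note split = split'[THEN spec]
  obtain c J where J: "integral_submodule J" "qf (\<lambda>e. e 0 \<in> J)" and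
    step: "\<And>y t. F (\<lambda>j. combination k u y j + unit_at k t j) \<longleftrightarrow> t \<in> J \<and> (\<forall>i<k. y i - c i * t \<in> I i)"
    by (rule qf_section_step[OF F qf split]) (rule that)
  obtain a I' where a: "a \<noteq> 0" "standard_submodule I'" "\<And>x. a * x \<in> J \<longleftrightarrow> x \<in> I'"
    by (rule qf_submodule_standard[OF J]) (rule that)
  \<comment> \<open>The value of the linear section at 1 spans the complement; the factor
    \<open>a\<close> turns \<open>J\<close> into a standard submodule.\<close>
  define u' where "u' = u(k := (\<lambda>j. a * (combination k u c j + unit_at k 1 j)))"
  have comb: "combination (Suc k) u' y = 
    (\<lambda>j. combination k u (\<lambda>i. y i + c i * (a * y k)) j + unit_at k (a * y k) j)" for y
  proof
    fix j
    have "combination (Suc k) u' y j = (\<Sum>i<k. y i * u i j) + y k * (a * (combination k u c j + unit_at k 1 j))"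
      by (simp add: combination_def[of "Suc k"] u'_def)
    also have "\<dots> = (\<Sum>i<k. y i * u i j) + (\<Sum>i<k. c i * (a * y k) * u i j) + unit_at k (a * y k) j"
      by (simp add: combination_def unit_at_def sum_distrib_left algebra_simps)
    finally show "combination (Suc k) u' y j =
      combination k u (\<lambda>i. y i + c i * (a * y k)) j + unit_at k (a * y k) j"
      by (simp add: combination_def sum.distrib algebra_simps)
  qed
  have "u' i i \<noteq> 0 \<and> (\<forall>j>i. u' i j = 0)" if "i < Suc k" for i
  proof (cases "i = k")
    case True
    have "combination k u c j = 0" if "j \<ge> k" for j
      unfolding combination_def using u(2) that by (intro sum.neutral) auto
    thus ?thesis using True a(1) by (simp add: u'_def unit_at_def)
  next
    case False
    thus ?thesis using u that by (simp add: u'_def)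
  qed
  moreover have "standard_submodule ((I(k := I')) i)" if "i < Suc k" for i
    using I a(2) that by simp
  moreover have "F (combination (Suc k) u' y) \<longleftrightarrow> (\<forall>i<Suc k. y i \<in> (I(k := I')) i)" for y
    unfolding comb step using a(3)[of "y k"] by (auto simp: less_Suc_eq)
  ultimately show ?case
    by (intro exI[of _ u'] exI[of _ "I(k := I')"] conjI allI impI) simp_all
qed

lemma combination_zero_triangular:
  assumes u: "\<And>i. i < n \<Longrightarrow> u i i \<noteq> 0" "\<And>i j. i < n \<Longrightarrow> i < j \<Longrightarrow> u i j = 0"
    and zero: "\<And>j. j < n \<Longrightarrow> combination n u y j = 0" and i: "i < n"
  shows "y i = 0"
proof (rule ccontr)
  assume "y i \<noteq> 0"
  define S where "S = {i. i < n \<and> y i \<noteq> 0}"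
  have S: "finite S" "S \<noteq> {}" using i \<open>y i \<noteq> 0\<close> by (auto simp: S_def)
  define m where "m = Max S"
  have m: "m < n" "y m \<noteq> 0" using Max_in[OF S] by (auto simp: S_def m_def)
  have "y l * u l m = 0" if "l < n" "l \<noteq> m" for l
  proof (cases "l < m")
    case False
    hence "l \<notin> S" using Max_ge[OF S(1), of l] that by (auto simp: m_def)
    thus ?thesis using that by (simp add: S_def)
  qed (simp add: u(2) that)
  hence "combination n u y m = (\<Sum>l\<in>{m}. y l * u l m)"
    unfolding combination_def using m(1) by (intro sum.mono_neutral_right) auto
  thus False using zero[OF m(1)] m u(1) by simp
qed

lemma combination_surj_triangular:
  assumes u: "\<And>i. i < n \<Longrightarrow> u i i \<noteq> 0" "\<And>i j. i < n \<Longrightarrow> i < j \<Longrightarrow> u i j = 0"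
  shows "\<exists>y. \<forall>j<n. combination n u y j = x j"
  using assms
proof (induction n arbitrary: x)
  case (Suc k)
  define t where "t = x k / u k k"
  obtain y where y: "\<forall>j<k. combination k u y j = x j - t * u k j"
    using Suc.IH[of "\<lambda>j. x j - t * u k j"] Suc.prems by auto
  have c: "combination (Suc k) u (y(k := t)) j = combination k u y j + t * u k j" for j
    by (simp add: combination_def)
  have "combination k u y k = 0"
    unfolding combination_def using Suc.prems(2) by (intro sum.neutral) auto
  hence "combination (Suc k) u (y(k := t)) j = x j" if "j < Suc k" for j
    unfolding c using y that Suc.prems(1)[of k] by (cases "j = k") (auto simp: t_def)
  thus ?case by blast
qed simp

end

section \<open>Coordinates with respect to a basis\<close>

primrec vcomb :: "('k::field, 'v) module \<Rightarrow> (nat \<Rightarrow> 'v) \<Rightarrow> nat \<Rightarrow> (nat \<Rightarrow> 'k) \<Rightarrow> 'v" where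
  "vcomb V b 0 y = \<zero>\<^bsub>V\<^esub>"
| "vcomb V b (Suc k) y = vcomb V b k y \<oplus>\<^bsub>V\<^esub> (y k \<odot>\<^bsub>V\<^esub> b k)"

lemma vcomb_cong: "(\<And>i. i < k \<Longrightarrow> y i = z i) \<Longrightarrow> vcomb V b k y = vcomb V b k z"
  by (induction k) auto

locale class_vectorspace = vectorspace class_ring V for V :: "('c::field, 'v) module"
begin

lemma smult_mem: "x \<in> carrier V \<Longrightarrow> a \<odot>\<^bsub>V\<^esub> x \<in> carrier V"
  using smult_closed[of a x] by simp

lemma vcomb_closed: "(\<And>i. i < k \<Longrightarrow> b i \<in> carrier V) \<Longrightarrow> vcomb V b k y \<in> carrier V"
  by (induction k) (auto intro: smult_mem)

lemma vcomb_add: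
  assumes "\<And>i. i < k \<Longrightarrow> b i \<in> carrier V"
  shows "vcomb V b k (\<lambda>i. y i + z i) = vcomb V b k y \<oplus>\<^bsub>V\<^esub> vcomb V b k z"
  using assms
proof (induction k)
  case (Suc k)
  have b: "b k \<in> carrier V" "\<And>y. vcomb V b k y \<in> carrier V" using Suc.prems vcomb_closed[of k b] by auto
  have "(y k + z k) \<odot>\<^bsub>V\<^esub> b k = y k \<odot>\<^bsub>V\<^esub> b k \<oplus>\<^bsub>V\<^esub> z k \<odot>\<^bsub>V\<^esub> b k"
    using smult_l_distr[of "y k" "z k" "b k"] b by simp
  thus ?case using Suc b smult_mem by (simp add: M.a_ac)
qed simp

lemma vcomb_scale:
  assumes "\<And>i. i < k \<Longrightarrow> b i \<in> carrier V"
  shows "vcomb V b k (\<lambda>i. a * y i) = a \<odot>\<^bsub>V\<^esub> vcomb V b k y"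
  using assms
proof (induction k)
  case 0
  show ?case using smult_r_null[of a] by simp
next
  case (Suc k)
  have b: "b k \<in> carrier V" "\<And>y. vcomb V b k y \<in> carrier V" using Suc.prems vcomb_closed[of k b] by auto
  have "(a * y k) \<odot>\<^bsub>V\<^esub> b k = a \<odot>\<^bsub>V\<^esub> (y k \<odot>\<^bsub>V\<^esub> b k)"
    using smult_assoc1[of a "y k" "b k"] b by simp
  thus ?case using Suc b smult_mem smult_r_distr[of a "vcomb V b k y" "y k \<odot>\<^bsub>V\<^esub> b k"] by simp
qed

lemma vcomb_finsum:
  assumes "\<And>i. i < k \<Longrightarrow> b i \<in> carrier V"
  shows "vcomb V b k y = finsum V (\<lambda>i. y i \<odot>\<^bsub>V\<^esub> b i) {..<k}"
  using assms
proof (induction k)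
  case (Suc k)
  have "finsum V (\<lambda>i. y i \<odot>\<^bsub>V\<^esub> b i) {..<Suc k} =
    y k \<odot>\<^bsub>V\<^esub> b k \<oplus>\<^bsub>V\<^esub> finsum V (\<lambda>i. y i \<odot>\<^bsub>V\<^esub> b i) {..<k}"
    unfolding lessThan_Suc by (rule M.finsum_insert) (auto intro!: smult_mem Suc.prems)
  also have "\<dots> = vcomb V b (Suc k) y"
    using Suc smult_mem[of "b k"] by (simp add: M.a_comm vcomb_closed Pi_def smult_mem)
  finally show ?case ..
qed simp

text \<open>A basis given as a set with extensional coefficient functions is turned into an indexed
  family. Injectivity compares a representation of zero with the one by zero coefficients.\<close>

lemma basis_coordinates:
  assumes "fin_dim"
  obtains b where "\<And>i. i < dim \<Longrightarrow> b i \<in> carrier V"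
    "\<And>w. w \<in> carrier V \<Longrightarrow> \<exists>y. vcomb V b dim y = w"
    "\<And>y. vcomb V b dim y = \<zero>\<^bsub>V\<^esub> \<Longrightarrow> \<forall>i<dim. y i = 0"
proof -
  obtain \<beta> where \<beta>: "finite \<beta>" "basis \<beta>" using finite_basis_exists[OF assms] by blast
  have sub: "\<beta> \<subseteq> carrier V" using \<beta>(2) by (simp add: basis_def)
  have crit: "\<And>w. w \<in> carrier V \<Longrightarrow> \<exists>!a. a \<in> \<beta> \<rightarrow>\<^sub>E carrier class_ring \<and> lincomb a \<beta> = w"
    using basis_criterion[OF \<beta>(1) sub] \<beta>(2) by blast
  have "dim = card \<beta>" by (rule dim_basis[OF \<beta>])
  then obtain b where b: "bij_betw b {..<dim} \<beta>"
    using ex_bij_betw_nat_finite[OF \<beta>(1)] by (auto simp: atLeast0LessThan)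
  have bV: "b i \<in> carrier V" if "i < dim" for i
    using b sub that by (auto simp: bij_betw_def)
  have lin: "lincomb a \<beta> = vcomb V b dim (\<lambda>i. a (b i))" for a
  proof -
    have "lincomb a \<beta> = finsum V (\<lambda>w. a w \<odot>\<^bsub>V\<^esub> w) (b ` {..<dim})"
      using b by (simp add: lincomb_def bij_betw_def)
    also have "\<dots> = finsum V (\<lambda>i. a (b i) \<odot>\<^bsub>V\<^esub> b i) {..<dim}"
      by (rule M.finsum_reindex) (use b bV smult_mem in \<open>auto simp: bij_betw_def\<close>)
    also have "\<dots> = vcomb V b dim (\<lambda>i. a (b i))" by (rule vcomb_finsum[symmetric]) (rule bV)
    finally show ?thesis .
  qed
  show thesis
  proof (rule that[OF bV])
    fix w assume "w \<in> carrier V"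
    then obtain a where "lincomb a \<beta> = w" using crit by blast
    thus "\<exists>y. vcomb V b dim y = w" 
      by (intro exI[of _ "\<lambda>i. a (b i)"]) (simp add: lin)
  next
    fix y assume y: "vcomb V b dim y = \<zero>\<^bsub>V\<^esub>"
    define a where "a = restrict (\<lambda>w. y (the_inv_into {..<dim} b w)) \<beta>"
    have ab: "a (b i) = y i" if "i < dim" for i
      using b that by (auto simp: a_def bij_betw_def the_inv_into_f_f)
    have "lincomb a \<beta> = \<zero>\<^bsub>V\<^esub>"
      unfolding lin y[symmetric] by (rule vcomb_cong) (rule ab)
    moreover have "lincomb (restrict (\<lambda>_. 0) \<beta>) \<beta> = \<zero>\<^bsub>V\<^esub>"
    proof -
      have "lincomb (restrict (\<lambda>_. 0) \<beta>) \<beta> = vcomb V b dim (\<lambda>i. 0 * 0)"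
        unfolding lin by (rule vcomb_cong) (use b in \<open>auto simp: bij_betw_def\<close>)
      also have "\<dots> = 0 \<odot>\<^bsub>V\<^esub> vcomb V b dim (\<lambda>_. 0)" by (rule vcomb_scale) (rule bV)
      also have "\<dots> = \<zero>\<^bsub>V\<^esub>" using smult_l_null[OF vcomb_closed[OF bV]] by simp
      finally show ?thesis .
    qed
    moreover have "a \<in> \<beta> \<rightarrow>\<^sub>E carrier class_ring" "restrict (\<lambda>_. 0) \<beta> \<in> \<beta> \<rightarrow>\<^sub>E carrier class_ring"
      by (auto simp: a_def)
    ultimately have "a = restrict (\<lambda>_. 0) \<beta>" using crit[OF M.zero_closed] by blast
    thus "\<forall>i<dim. y i = 0" using ab b by (auto simp: bij_betw_def)
  qed
qed

end

section \<open>The preimage in coordinates\<close>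

lemma interpretable_set_classes:
  assumes "interpretable_set v m X"
  shows "A \<in> X \<Longrightarrow> B \<in> X \<Longrightarrow> x \<in> A \<Longrightarrow> x \<in> B \<Longrightarrow> A = B" "A \<in> X \<Longrightarrow> \<exists>x. x \<in> A"
    "A \<in> X \<Longrightarrow> x \<in> A \<Longrightarrow> length x = m"
proof -
  obtain D E where D: "definable v m D" "equiv D E" "X = D // E"
    using assms unfolding interpretable_set_def by blast
  show "A = B" if "A \<in> X" "B \<in> X" "x \<in> A" "x \<in> B"
    using quotient_disj[OF D(2), of A B] that D(3) by blast
  show "\<exists>x. x \<in> A" if "A \<in> X"
    using in_quotient_imp_non_empty[OF D(2), of A] that D(3) by blast
  show "length x = m" if "A \<in> X" "x \<in> A"
  proof -
    have "x \<in> D" using in_quotient_imp_subset[OF D(2), of A] that D(3) by blast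
    thus ?thesis using D(1) unfolding definable_def by blast
  qed
qed

lemma map_prepend: "length xs = l \<Longrightarrow> map (prepend xs e) [0..<l] = xs"
  by (rule nth_equalityI) auto

context acvf
begin

text \<open>Classes have no definable choice of representatives at hand, so the representatives of
  the partial sum and of the last multiple are quantified existentially. Only the fixed basis
  vectors are represented by parameters.\<close>

lemma qf_vcomb:
  assumes V: "definable_vector_space v m V" and b: "\<And>i. i < k \<Longrightarrow> b i \<in> carrier V"
    and a: "\<And>i. i < k \<Longrightarrow> a i \<in> polyfun" and f: "\<And>i. i < m \<Longrightarrow> f i \<in> polyfun"
  shows "qf (\<lambda>e. map (\<lambda>i. f i e) [0..<m] \<in> vcomb V b k (\<lambda>i. a i e))"
proof -
  interpret class_vectorspace V
    using V by (simp add: definable_vector_space_def class_vectorspace_def)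
  define Add where "Add = {x @ y @ z | x y z. \<exists>A \<in> carrier V. \<exists>B \<in> carrier V. x \<in> A \<and> y \<in> B \<and> z \<in> A \<oplus>\<^bsub>V\<^esub> B}"
  define Scal where "Scal = {a # x @ y | a x y. \<exists>A \<in> carrier V. x \<in> A \<and> y \<in> a \<odot>\<^bsub>V\<^esub> A}"
  have defs: "interpretable_set v m (carrier V)" "definable v (3 * m) Add" "definable v (1 + 2 * m) Scal"
    using V by (simp_all add: definable_vector_space_def Add_def Scal_def)
  note cls = interpretable_set_classes[OF defs(1)]
  have Scal: "c # x @ y \<in> Scal \<longleftrightarrow> y \<in> c \<odot>\<^bsub>V\<^esub> A" if A: "A \<in> carrier V" "x \<in> A" for c x y A
  proof
    assume "c # x @ y \<in> Scal"
    then obtain x' y' A' where *: "x @ y = x' @ y'" "A' \<in> carrier V" "x' \<in> A'" "y' \<in> c \<odot>\<^bsub>V\<^esub> A'"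
      unfolding Scal_def by blast
    hence "x = x'" "y = y'" using cls(3)[OF A] cls(3)[OF *(2,3)] by auto
    thus "y \<in> c \<odot>\<^bsub>V\<^esub> A" using cls(1)[OF A(1) *(2) A(2)] * by simp
  next
    assume "y \<in> c \<odot>\<^bsub>V\<^esub> A"
    thus "c # x @ y \<in> Scal" unfolding Scal_def using A by blast
  qed
  have Add: "x @ y @ z \<in> Add \<longleftrightarrow> z \<in> A \<oplus>\<^bsub>V\<^esub> B"
    if A: "A \<in> carrier V" "x \<in> A" and B: "B \<in> carrier V" "y \<in> B" for x y z A B
  proof
    assume "x @ y @ z \<in> Add"
    then obtain x' y' z' A' B' where *: "x @ y @ z = x' @ y' @ z'" "A' \<in> carrier V" "x' \<in> A'"
      "B' \<in> carrier V" "y' \<in> B'" "z' \<in> A' \<oplus>\<^bsub>V\<^esub> B'"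
      unfolding Add_def by blast
    hence "x = x'" "y = y'" "z = z'" 
      using cls(3)[OF A] cls(3)[OF B] cls(3)[OF *(2,3)] cls(3)[OF *(4,5)] by auto
    thus "z \<in> A \<oplus>\<^bsub>V\<^esub> B" using cls(1)[OF A(1) *(2) A(2)] cls(1)[OF B(1) *(4) B(2)] * by simp
  next
    assume "z \<in> A \<oplus>\<^bsub>V\<^esub> B"
    thus "x @ y @ z \<in> Add" unfolding Add_def using A B by blast
  qed
  show ?thesis using b a f
  proof (induction k arbitrary: a f)
    case 0
    \<comment> \<open>The zero class is described as 0 times itself, via the graph of scalar
      multiplication and a constant representative \<open>x\<close>.\<close>
    obtain x where x: "x \<in> \<zero>\<^bsub>V\<^esub>" using cls(2)[OF M.zero_closed] by blast
    have lx: "length x = m" by (rule cls(3)[OF M.zero_closed x])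
    have "map (\<lambda>i. f i e) [0..<m] \<in> \<zero>\<^bsub>V\<^esub> \<longleftrightarrow>
      map (\<lambda>i. (if i = 0 then \<lambda>_. 0 else if i < 1 + m then \<lambda>_. x ! (i - 1) else f (i - 1 - m)) e) [0..<1 + 2 * m] \<in> Scal"
      for e
    proof -
      have "map (\<lambda>i. (if i = 0 then \<lambda>_. 0 else if i < 1 + m then \<lambda>_. x ! (i - 1) else f (i - 1 - m)) e) [0..<1 + 2 * m] =
        0 # x @ map (\<lambda>i. f i e) [0..<m]"
        by (rule nth_equalityI) (auto simp: lx nth_Cons nth_append simp del: upt_Suc split: nat.split)
      thus ?thesis using Scal[OF M.zero_closed x, of 0 "map (\<lambda>i. f i e) [0..<m]"] smult_r_null[of 0] by simp
    qed
    moreover have "qf (\<lambda>e. map (\<lambda>i. (if i = 0 then \<lambda>_. 0 else if i < 1 + m then \<lambda>_. x ! (i - 1)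
      else f (i - 1 - m)) e) [0..<1 + 2 * m] \<in> Scal)"
      by (rule qf_definable[OF defs(3)]) (use 0 in \<open>auto intro: polyfun.const\<close>)
    ultimately show ?case by simp
  next
    case (Suc k)
    have bk: "b k \<in> carrier V" and bi: "\<And>i. i < k \<Longrightarrow> b i \<in> carrier V" using Suc.prems(1) by auto
    obtain x where x: "x \<in> b k" using cls(2)[OF bk] by blast
    have lx: "length x = m" by (rule cls(3)[OF bk x])
    define sh where "sh g X = g (\<lambda>j. X (j + 2 * m))" for g :: "(nat \<Rightarrow> 'k) \<Rightarrow> 'k" and X
    have sh: "sh g \<in> polyfun" if "g \<in> polyfun" for g
      unfolding sh_def[abs_def] by (rule polyfun_subst[OF that, of "\<lambda>X j. X (j + 2 * m)"]) (rule polyfun.var)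
    have sh_prepend: "sh g (prepend xs e) = g e" if "length xs = 2 * m" for g xs e
      using that by (simp add: sh_def)
    \<comment> \<open>The first \<open>m\<close> variables represent the partial sum, the next
      \<open>m\<close> the new multiple, and the given functions, shifted by \<open>2 * m\<close>,
      their sum.\<close>
    define P where "P X \<longleftrightarrow> map (\<lambda>i. X i) [0..<m] \<in> vcomb V b k (\<lambda>i. sh (a i) X) \<and>
      map (\<lambda>i. (if i = 0 then sh (a k) else if i < 1 + m then \<lambda>_. x ! (i - 1) else (\<lambda>X. X (i - 1))) X) [0..<1 + 2 * m] \<in> Scal \<and>
      map (\<lambda>i. (if i < 2 * m then (\<lambda>X. X i) else sh (f (i - 2 * m))) X) [0..<3 * m] \<in> Add" for X
    have "qf P"
      unfolding P_def[abs_def]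
    proof (intro qf_conj)
      show "qf (\<lambda>X. map (\<lambda>i. X i) [0..<m] \<in> vcomb V b k (\<lambda>i. sh (a i) X))"
        using bi by (intro Suc.IH[of "\<lambda>i. sh (a i)" "\<lambda>i X. X i"]) (auto intro!: sh Suc.prems polyfun.var)
    qed (rule qf_definable[OF defs(3)] qf_definable[OF defs(2)]; 
        use Suc.prems in \<open>auto intro!: polyfun.const polyfun.var sh Suc.prems\<close>)+
    moreover have "map (\<lambda>i. f i e) [0..<m] \<in> vcomb V b (Suc k) (\<lambda>i. a i e) \<longleftrightarrow>
      (\<exists>xs. length xs = 2 * m \<and> P (prepend xs e))" for e
    proof -
      define z where "z = map (\<lambda>i. f i e) [0..<m]"
      have P: "P (prepend xs e) \<longleftrightarrow> take m xs \<in> vcomb V b k (\<lambda>i. a i e) \<and>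
          a k e # x @ drop m xs \<in> Scal \<and> xs @ z \<in> Add" if xs: "length xs = 2 * m" for xs
      proof -
        have "map (\<lambda>i. prepend xs e i) [0..<m] = take m xs"
          by (rule nth_equalityI) (auto simp: xs)
        moreover have "map (\<lambda>i. (if i = 0 then sh (a k) else if i < 1 + m then \<lambda>_. x ! (i - 1) 
            else (\<lambda>X. X (i - 1))) (prepend xs e)) [0..<1 + 2 * m] = a k e # x @ drop m xs"
          by (rule nth_equalityI) (auto simp: xs lx nth_Cons nth_append sh_prepend simp del: upt_Suc split: nat.split)
        moreover have "map (\<lambda>i. (if i < 2 * m then (\<lambda>X. X i) else sh (f (i - 2 * m))) (prepend xs e)) [0..<3 * m] = xs @ z"
          by (rule nth_equalityI) (auto simp: xs nth_append sh_prepend z_def)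
        ultimately show ?thesis by (simp add: P_def sh_prepend[OF xs])
      qed
      have A: "vcomb V b k (\<lambda>i. a i e) \<in> carrier V" "a k e \<odot>\<^bsub>V\<^esub> b k \<in> carrier V"
        by (rule vcomb_closed[OF bi], assumption) (rule smult_mem[OF bk])
      show ?thesis unfolding z_def[symmetric]
      proof
        assume z: "z \<in> vcomb V b (Suc k) (\<lambda>i. a i e)"
        obtain p q where pq: "p \<in> vcomb V b k (\<lambda>i. a i e)" "q \<in> a k e \<odot>\<^bsub>V\<^esub> b k"
          using cls(2)[OF A(1)] cls(2)[OF A(2)] by blast
        have l: "length p = m" "length q = m" using cls(3)[OF A(1) pq(1)] cls(3)[OF A(2) pq(2)] .
        have "P (prepend (p @ q) e)"
          using P[of "p @ q"] l pq Scal[OF bk x, of "a k e" q] Add[OF A(1) pq(1) A(2) pq(2), of z] z by simp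
        thus "\<exists>xs. length xs = 2 * m \<and> P (prepend xs e)" using l by (intro exI[of _ "p @ q"]) simp
      next
        assume "\<exists>xs. length xs = 2 * m \<and> P (prepend xs e)"
        then obtain xs where xs: "length xs = 2 * m" "P (prepend xs e)" by blast
        hence "take m xs \<in> vcomb V b k (\<lambda>i. a i e)" "drop m xs \<in> a k e \<odot>\<^bsub>V\<^esub> b k" 
          "take m xs @ drop m xs @ z \<in> Add"
          using P[OF xs(1)] Scal[OF bk x] by (simp_all flip: append_assoc)
        thus "z \<in> vcomb V b (Suc k) (\<lambda>i. a i e)"
          using Add[OF A(1) _ A(2)] by simp
      qed
    qed
    ultimately show ?case using qf_ex_list[of P "2 * m"] by simp
  qed
qed

text \<open>Classes are nonempty and disjoint, so a class is in \<open>N\<close> as soon as one of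
  its points is in \<open>\<Union>N\<close>.\<close>

lemma qf_vcomb_mem:
  assumes V: "definable_vector_space v m V" and b: "\<And>i. i < k \<Longrightarrow> b i \<in> carrier V"
    and N: "interpretable_subset v m (carrier V) N"
  shows "qf (\<lambda>e. vcomb V b k e \<in> N)"
proof -
  interpret class_vectorspace V
    using V by (simp add: definable_vector_space_def class_vectorspace_def)
  have NV: "N \<subseteq> carrier V" "definable v m (\<Union>N)" 
    and "interpretable_set v m (carrier V)"
    using N V by (simp_all add: interpretable_subset_def definable_vector_space_def)
  note cls = interpretable_set_classes[OF this(3)]
  define P where "P X \<longleftrightarrow> map (\<lambda>i. X i) [0..<m] \<in> vcomb V b k (\<lambda>i. X (i + m)) \<and> map (\<lambda>i. X i) [0..<m] \<in> \<Union>N" for X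
  have "qf P" unfolding P_def[abs_def]
    by (intro qf_conj qf_vcomb[OF V, where a = "\<lambda>i X. X (i + m)" and f = "\<lambda>i X. X i"] 
        qf_definable[OF NV(2), where f = "\<lambda>i X. X i"] polyfun.var b)
  moreover have "vcomb V b k e \<in> N \<longleftrightarrow> (\<exists>xs. length xs = m \<and> P (prepend xs e))" for e
  proof -
    have A: "vcomb V b k e \<in> carrier V" by (rule vcomb_closed) (rule b)
    have P: "P (prepend xs e) \<longleftrightarrow> xs \<in> vcomb V b k e \<and> xs \<in> \<Union>N" if "length xs = m" for xs
      using map_prepend[OF that, of e] that by (simp add: P_def)
    show ?thesis
    proof
      assume "vcomb V b k e \<in> N"
      moreover obtain x where "x \<in> vcomb V b k e" using cls(2)[OF A] by blast
      ultimately show "\<exists>xs. length xs = m \<and> P (prepend xs e)"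
        using P[of x] cls(3)[OF A] by blast
    next
      assume "\<exists>xs. length xs = m \<and> P (prepend xs e)"
      then obtain x B where "x \<in> vcomb V b k e" "B \<in> N" "x \<in> B" using P by blast
      thus "vcomb V b k e \<in> N" using cls(1)[OF A, of B x] NV(1) by blast
    qed
  qed
  ultimately show ?thesis using qf_ex_list[of P m] by simp
qed

section \<open>Sorting coordinates by type\<close>

lemma integral_submodule_standard:
  "integral_submodule UNIV" "integral_submodule (val_integers v)" "integral_submodule (val_maximal_ideal v)"
proof -
  have "1 \<prec> a * x" if "1 \<preceq> a" "1 \<prec> x" for a x
    using vle_vlt_trans[OF that(1), of "a * x"] that vle_mult_cancel(1)[of a x 1] by (cases "a = 0") auto
  moreover have "1 \<prec> x + y" if "1 \<prec> x" "1 \<prec> y" for x y using that by (rule vlt_add)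
  ultimately show "integral_submodule UNIV" "integral_submodule (val_integers v)" "integral_submodule (val_maximal_ideal v)"
    using vle_mult[of 1 _ 1] unfolding integral_submodule_def val_integers_eq val_maximal_ideal_eq
    by (auto intro: vle_add)
qed

lemma module_power_module:
  assumes "cring (valuation_ring v)" "integral_submodule S"
  shows "module (valuation_ring v) (power_module S n)"
proof -
  have S: "0 \<in> S" "\<And>x y. x \<in> S \<Longrightarrow> y \<in> S \<Longrightarrow> x + y \<in> S" "\<And>a x. 1 \<preceq> a \<Longrightarrow> x \<in> S \<Longrightarrow> a * x \<in> S"
    using assms(2) by (auto simp: integral_submodule_def)
  have neg: "- x \<in> S" if "x \<in> S" for x using S(3)[of "-1" x] that by simp
  show ?thesis
  proof (rule moduleI[OF assms(1)])
    show "abelian_group (power_module S n)"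
    proof (rule abelian_groupI)
      fix x assume x: "x \<in> carrier (power_module S n)"
      show "\<exists>y\<in>carrier (power_module S n). y \<oplus>\<^bsub>power_module S n\<^esub> x = \<zero>\<^bsub>power_module S n\<^esub>"
        by (rule bexI[of _ "- x"]) (use x neg in \<open>auto simp: power_module_def module_vec_simps\<close>)
    qed (auto simp: power_module_def module_vec_simps S intro: comm_add_vec)
  qed (auto simp: power_module_def module_vec_simps valuation_ring_def val_integers_eq S
      add_smult_distrib_vec smult_add_distrib_vec smult_smult_assoc)
qed

text \<open>Coordinates with the same submodule are collected into one power; those with submodule 0
  are dropped.\<close>

lemma standard_decomposition:
  fixes g :: "(nat \<Rightarrow> 'k) \<Rightarrow> 'v" and V :: "('k, 'v) module"
  assumes N: "module (valuation_ring v) (V\<lparr>carrier := N\<rparr>)"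
    and g_add: "\<And>y z. g (\<lambda>i. y i + z i) = g y \<oplus>\<^bsub>V\<^esub> g z"
    and g_scale: "\<And>a y. g (\<lambda>i. a * y i) = a \<odot>\<^bsub>V\<^esub> g y"
    and g_surj: "\<And>w. w \<in> N \<Longrightarrow> \<exists>y. g y = w"
    and g_eq_iff: "\<And>y z. g y = g z \<longleftrightarrow> (\<forall>i<n. y i = z i)"
    and g_N: "\<And>y. g y \<in> N \<longleftrightarrow> (\<forall>i<n. y i \<in> I i)"
    and I: "\<And>i. i < n \<Longrightarrow> standard_submodule (I i)"
  shows "\<exists>n\<^sub>1 n\<^sub>2 n\<^sub>3. n\<^sub>1 \<le> n \<and> n\<^sub>2 \<le> n \<and> n\<^sub>3 \<le> n \<and>
    module_isomorphic (valuation_ring v) (V\<lparr>carrier := N\<rparr>)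
      (direct_sum (power_module UNIV n\<^sub>1)
        (direct_sum (power_module (val_integers v) n\<^sub>2)
          (power_module (val_maximal_ideal v) n\<^sub>3)))"
proof -
  define S1 where "S1 = {i. i < n \<and> I i = UNIV}"
  \<comment> \<open>Subtraction makes the index sets disjoint without a proof that the three
    submodules differ.\<close>
  define S2 where "S2 = {i. i < n \<and> I i = val_integers v} - S1"
  define S3 where "S3 = {i. i < n \<and> I i = val_maximal_ideal v} - S1 - S2"
  have sub: "S1 \<subseteq> {..<n}" "S2 \<subseteq> {..<n}" "S3 \<subseteq> {..<n}" by (auto simp: S1_def S2_def S3_def)
  have fin: "finite S1" "finite S2" "finite S3" using sub finite_subset by blast+
  have card: "card S1 \<le> n" "card S2 \<le> n" "card S3 \<le> n"
    using sub[THEN card_mono[OF finite_lessThan]] by simp_all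
  have Ifun: "I i = UNIV" if "i \<in> S1" for i using that by (simp add: S1_def)
  have IO: "I i = val_integers v" if "i \<in> S2" for i using that by (simp add: S2_def)
  have IM: "I i = val_maximal_ideal v" if "i \<in> S3" for i using that by (simp add: S3_def)
  have I0: "I i = {0}" if "i < n" "i \<notin> S1" "i \<notin> S2" "i \<notin> S3" for i
    using I[OF that(1)] that by (auto simp: standard_submodule_def S1_def S2_def S3_def)
  have disj: "S1 \<inter> S2 = {}" "S1 \<inter> S3 = {}" "S2 \<inter> S3 = {}" by (auto simp: S2_def S3_def)
  obtain h1 where h1: "bij_betw h1 {..<card S1} S1"
    using ex_bij_betw_nat_finite[OF fin(1)] by (auto simp: atLeast0LessThan)
  obtain h2 where h2: "bij_betw h2 {..<card S2} S2"
    using ex_bij_betw_nat_finite[OF fin(2)] by (auto simp: atLeast0LessThan)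
  obtain h3 where h3: "bij_betw h3 {..<card S3} S3"
    using ex_bij_betw_nat_finite[OF fin(3)] by (auto simp: atLeast0LessThan)
  have h: "\<And>j. j < card S1 \<Longrightarrow> h1 j \<in> S1" "\<And>j. j < card S2 \<Longrightarrow> h2 j \<in> S2" "\<And>j. j < card S3 \<Longrightarrow> h3 j \<in> S3"
    using h1 h2 h3 by (auto simp: bij_betw_def)
  have hsurj: "\<And>i. i \<in> S1 \<Longrightarrow> \<exists>j<card S1. i = h1 j" "\<And>i. i \<in> S2 \<Longrightarrow> \<exists>j<card S2. i = h2 j"
    "\<And>i. i \<in> S3 \<Longrightarrow> \<exists>j<card S3. i = h3 j"
    using h1 h2 h3 unfolding bij_betw_def by blast+
  have hn: "\<And>j. j < card S1 \<Longrightarrow> h1 j < n" "\<And>j. j < card S2 \<Longrightarrow> h2 j < n" "\<And>j. j < card S3 \<Longrightarrow> h3 j < n"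
    using h(1) sub(1) h(2) sub(2) h(3) sub(3) by (blast dest: subsetD[THEN lessThan_iff[THEN iffD1]])+
  \<comment> \<open>Only the values below \<open>n\<close> are determined by \<open>w\<close>; the
    choice fixes the others arbitrarily.\<close>
  define coord where "coord w = (SOME y. g y = w)" for w
  have coord: "g (coord w) = w" if "w \<in> N" for w
    unfolding coord_def using someI_ex[OF g_surj[OF that]] .
  have coord_g: "coord (g y) i = y i" if "g y \<in> N" "i < n" for y i
    using coord[OF that(1)] g_eq_iff that(2) by blast
  define f where "f w = (vec (card S1) (\<lambda>j. coord w (h1 j)), vec (card S2) (\<lambda>j. coord w (h2 j)),
    vec (card S3) (\<lambda>j. coord w (h3 j)))" for w
  let ?P = "direct_sum (power_module UNIV (card S1)) (direct_sum (power_module (val_integers v) (card S2))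
    (power_module (val_maximal_ideal v) (card S3)))"
  interpret N: Module.module "valuation_ring v" "V\<lparr>carrier := N\<rparr>" by (rule N)
  have cring: "cring (valuation_ring v)" by unfold_locales
  have closed: "w \<oplus>\<^bsub>V\<^esub> w' \<in> N" if "w \<in> N" "w' \<in> N" for w w'
    using N.M.add.m_closed[of w w'] that by simp
  have sclosed: "a \<odot>\<^bsub>V\<^esub> w \<in> N" if "a \<in> val_integers v" "w \<in> N" for a w
    using N.smult_closed[of a w] that by (simp add: valuation_ring_def)
  have coord_add: "coord (w \<oplus>\<^bsub>V\<^esub> w') i = coord w i + coord w' i" if "w \<in> N" "w' \<in> N" "i < n" for w w' i
    using coord_g[of "\<lambda>i. coord w i + coord w' i" i] that closed by (simp add: g_add coord)
  have coord_scale: "coord (a \<odot>\<^bsub>V\<^esub> w) i = a * coord w i" if "a \<in> val_integers v" "w \<in> N" "i < n" for a w i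
    using coord_g[of "\<lambda>i. a * coord w i" i] that sclosed by (simp add: g_scale coord)
  have coord_I: "coord w i \<in> I i" if "w \<in> N" "i < n" for w i
    using g_N[of "coord w"] coord[OF that(1)] that by simp
  have f_closed: "f w \<in> carrier ?P" if "w \<in> N" for w
    using coord_I[OF that] hn h IO IM
    by (auto simp: f_def direct_sum_def power_module_def module_vec_simps) (metis+)
  have hom: "mod_hom (valuation_ring v) (V\<lparr>carrier := N\<rparr>) ?P f"
    unfolding mod_hom_def mod_hom_axioms_def
  proof (intro conjI N direct_sum_is_module module_power_module cring integral_submodule_standard)
    show "f \<in> LinearCombinations.module_hom (valuation_ring v) (V\<lparr>carrier := N\<rparr>) ?P"
      unfolding LinearCombinations.module_hom_def
      using f_closed hn
      by (auto simp: valuation_ring_def f_def direct_sum_def power_module_def module_vec_simps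
          coord_add coord_scale)
  qed
  have inj: "inj_on f N"
  proof (rule inj_onI)
    fix w w' assume w: "w \<in> N" "w' \<in> N" "f w = f w'"
    have c1: "coord w (h1 j) = coord w' (h1 j)" if "j < card S1" for j
      using w(3) that by (simp add: f_def) (metis index_vec)
    have c2: "coord w (h2 j) = coord w' (h2 j)" if "j < card S2" for j
      using w(3) that by (simp add: f_def) (metis index_vec)
    have c3: "coord w (h3 j) = coord w' (h3 j)" if "j < card S3" for j
      using w(3) that by (simp add: f_def) (metis index_vec)
    have "coord w i = coord w' i" if "i < n" for i
    proof -
      consider "i \<in> S1" | "i \<in> S2" | "i \<in> S3" | "I i = {0}" using I0[OF \<open>i < n\<close>] by blast
      thus ?thesis
      proof cases
        case 1
        thus ?thesis using c1 hsurj(1)[of i] by auto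
      next
        case 2
        thus ?thesis using c2 hsurj(2)[of i] by auto
      next
        case 3
        thus ?thesis using c3 hsurj(3)[of i] by auto
      next
        case 4
        thus ?thesis using coord_I[OF w(1) that] coord_I[OF w(2) that] by simp
      qed
    qed
    hence "g (coord w) = g (coord w')" using g_eq_iff by blast
    thus "w = w'" using coord w by simp
  qed
  have surj: "carrier ?P \<subseteq> f ` N"
  proof
    fix p assume "p \<in> carrier ?P"
    then obtain p1 p2 p3 where p: "p = (p1, p2, p3)" "p1 \<in> carrier_vec (card S1)"
      "p2 \<in> carrier_vec (card S2)" "\<And>j. j < card S2 \<Longrightarrow> p2 $ j \<in> val_integers v"
      "p3 \<in> carrier_vec (card S3)" "\<And>j. j < card S3 \<Longrightarrow> p3 $ j \<in> val_maximal_ideal v"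
      by (auto simp: direct_sum_def power_module_def module_vec_simps)
    define y where "y i = (if i \<in> S1 then p1 $ the_inv_into {..<card S1} h1 i
      else if i \<in> S2 then p2 $ the_inv_into {..<card S2} h2 i
      else if i \<in> S3 then p3 $ the_inv_into {..<card S3} h3 i else 0)" for i
    have y1: "y (h1 j) = p1 $ j" if "j < card S1" for j
      using h(1)[OF that] h1 that by (simp add: y_def bij_betw_def the_inv_into_f_f)
    have y2: "y (h2 j) = p2 $ j" if "j < card S2" for j
    proof -
      have "h2 j \<notin> S1" using h(2)[OF that] disj by blast
      thus ?thesis using h(2)[OF that] h2 that by (simp add: y_def bij_betw_def the_inv_into_f_f)
    qed
    have y3: "y (h3 j) = p3 $ j" if "j < card S3" for j
    proof -
      have "h3 j \<notin> S1" "h3 j \<notin> S2" using h(3)[OF that] disj by blast+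
      thus ?thesis using h(3)[OF that] h3 that by (simp add: y_def bij_betw_def the_inv_into_f_f)
    qed
    have "y i \<in> I i" if "i < n" for i
    proof -
      consider "i \<in> S1" | "i \<in> S2" | "i \<in> S3" | "i \<notin> S1" "i \<notin> S2" "i \<notin> S3" by blast
      thus ?thesis
      proof cases
        case 1
        thus ?thesis by (simp add: Ifun)
      next
        case 2
        then obtain j where "j < card S2" "i = h2 j" using hsurj(2) by blast
        thus ?thesis using y2 p(4) IO[OF 2] by simp
      next
        case 3
        then obtain j where "j < card S3" "i = h3 j" using hsurj(3) by blast
        thus ?thesis using y3 p(6) IM[OF 3] by simp
      next
        case 4
        thus ?thesis using I0[OF that 4] by (simp add: y_def)
      qed
    qed
    hence gN: "g y \<in> N" using g_N by blast
    have "f (g y) = p"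
      unfolding f_def p(1) using p(2,3,5) coord_g[OF gN] hn y1 y2 y3 by (auto intro!: eq_vecI)
    thus "p \<in> f ` N" using gN by blast
  qed
  have "bij_betw f N (carrier ?P)"
    unfolding bij_betw_def using inj surj f_closed by blast
  hence "module_isomorphic (valuation_ring v) (V\<lparr>carrier := N\<rparr>) ?P"
    unfolding module_isomorphic_def using hom by (intro exI[of _ f]) simp
  thus ?thesis using card by blast
qed

end

theorem theorem1p6:
  fixes v :: "'k::alg_closed_field \<Rightarrow> 'g::linordered_ab_group_add"
    and V :: "('k, 'k list set) module"
    and N :: "'k list set set"
    and m n :: nat
  assumes "acvf v"
    and "definable_vector_space v m V"
    and "vectorspace.fin_dim class_ring V"
    and "n = vectorspace.dim class_ring V"
    and "submodule (valuation_ring v) N V"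
    and "interpretable_subset v m (carrier V) N"
  shows "\<exists>n\<^sub>1 n\<^sub>2 n\<^sub>3. n\<^sub>1 \<le> n \<and> n\<^sub>2 \<le> n \<and> n\<^sub>3 \<le> n \<and>
    module_isomorphic (valuation_ring v) (V\<lparr>carrier := N\<rparr>)
      (direct_sum (power_module UNIV n\<^sub>1)
        (direct_sum (power_module (val_integers v) n\<^sub>2)
          (power_module (val_maximal_ideal v) n\<^sub>3)))"
proof -
  have N: "module (valuation_ring v) (V\<lparr>carrier := N\<rparr>)"
    by (rule module.submodule_is_module[OF submodule.module[OF assms(5)] assms(5)])
  interpret acvf v by fact
  interpret class_vectorspace V
    using assms(2) by (simp add: definable_vector_space_def class_vectorspace_def)
  interpret N: submodule "valuation_ring v" N V by fact
  obtain b where b: "\<And>i. i < n \<Longrightarrow> b i \<in> carrier V"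
    "\<And>w. w \<in> carrier V \<Longrightarrow> \<exists>y. vcomb V b n y = w"
    "\<And>y. vcomb V b n y = \<zero>\<^bsub>V\<^esub> \<Longrightarrow> \<forall>i<n. y i = 0"
    by (rule basis_coordinates[OF assms(3), folded assms(4)]) (rule that)
  \<comment> \<open>The preimage of \<open>N\<close> in coordinates, as a predicate on environments
    of which the first \<open>n\<close> values matter.\<close>
  define F where "F y \<longleftrightarrow> vcomb V b n y \<in> N" for y
  have qfF: "qf F" unfolding F_def[abs_def] by (rule qf_vcomb_mem[OF assms(2) _ assms(6)]) (rule b(1))
  have vadd: "vcomb V b n (\<lambda>i. y i + z i) = vcomb V b n y \<oplus>\<^bsub>V\<^esub> vcomb V b n z" for y z
    by (rule vcomb_add) (rule b(1))
  have vscale: "vcomb V b n (\<lambda>i. a * y i) = a \<odot>\<^bsub>V\<^esub> vcomb V b n y" for a y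
    by (rule vcomb_scale) (rule b(1))
  have vclosed: "vcomb V b n y \<in> carrier V" for y by (rule vcomb_closed) (rule b(1))
  have v0: "vcomb V b n (\<lambda>_. 0) = \<zero>\<^bsub>V\<^esub>"
    using vscale[of 0 "\<lambda>_. 0"] smult_l_null[OF vclosed, of "\<lambda>_. 0"] by simp
  have F: "integral_predicate F"
    unfolding integral_predicate_def F_def vadd vscale v0
    using N.zero_closed N.m_closed N.smult_closed by (auto simp: valuation_ring_def val_integers_eq)
  obtain u I where u: "\<forall>i<n. u i i \<noteq> 0 \<and> (\<forall>j>i. u i j = 0)" and I: "\<forall>i<n. standard_submodule (I i)"
    and FI: "\<forall>y. F (combination n u y) \<longleftrightarrow> (\<forall>i<n. y i \<in> I i)"
    using qf_submodule_triangular[OF F qfF, of n] by (elim exE conjE)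
  have u': "\<And>i. i < n \<Longrightarrow> u i i \<noteq> 0" "\<And>i j. i < n \<Longrightarrow> i < j \<Longrightarrow> u i j = 0" using u by auto
  define g where "g y = vcomb V b n (combination n u y)" for y
  have cadd: "combination n u (\<lambda>i. y i + z i) = (\<lambda>j. combination n u y j + combination n u z j)" for y z
    by (simp add: combination_def fun_eq_iff algebra_simps sum.distrib)
  have c0: "combination n u (\<lambda>_. 0) = (\<lambda>_. 0)"
    by (simp add: combination_def fun_eq_iff)
  have cscale: "combination n u (\<lambda>i. a * y i) = (\<lambda>j. a * combination n u y j)" for a y
    by (simp add: combination_def fun_eq_iff sum_distrib_left mult.assoc)
  show ?thesis
  proof (rule standard_decomposition[OF N, where g = g and I = I])
    show g_add: "g (\<lambda>i. y i + z i) = g y \<oplus>\<^bsub>V\<^esub> g z" for y z by (simp add: g_def cadd vadd)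
    show g_scale: "g (\<lambda>i. a * y i) = a \<odot>\<^bsub>V\<^esub> g y" for a y by (simp add: g_def cscale vscale)
    show "\<exists>y. g y = w" if w: "w \<in> N" for w
    proof -
      obtain x where x: "vcomb V b n x = w" using b(2)[OF subsetD[OF N.subset w]] ..
      have "\<exists>y. \<forall>j<n. combination n u y j = x j"
        by (rule combination_surj_triangular) (rule u'; assumption)+
      then obtain y where "\<forall>j<n. combination n u y j = x j" ..
      hence "g y = w" unfolding g_def x[symmetric] by (intro vcomb_cong) simp
      thus ?thesis by (intro exI[of _ y])
    qed
    show "g y = g z \<longleftrightarrow> (\<forall>i<n. y i = z i)" for y z
    proof
      assume eq: "g y = g z"
      \<comment> \<open>The difference is written with the scalar \<open>-1\<close> so that
        linearity of \<open>g\<close> applies; injectivity then reduces to the kernel.\<close>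
      have "g (\<lambda>i. y i + -1 * z i) = g (\<lambda>i. z i + -1 * z i)" unfolding g_add g_scale eq by (rule refl)
      also have "\<dots> = \<zero>\<^bsub>V\<^esub>" using v0 by (simp add: g_def c0)
      finally have "\<forall>j<n. combination n u (\<lambda>i. y i + -1 * z i) j = 0" unfolding g_def by (rule b(3))
      hence zero: "\<And>j. j < n \<Longrightarrow> combination n u (\<lambda>i. y i + -1 * z i) j = 0" by blast
      have "y i + -1 * z i = 0" if "i < n" for i
        by (rule combination_zero_triangular[where y = "\<lambda>i. y i + -1 * z i", OF _ _ zero that])
          (rule u'; assumption)+
      thus "\<forall>i<n. y i = z i" by simp
    next
      assume "\<forall>i<n. y i = z i"
      thus "g y = g z" using combination_cong[of n y z u] by (simp add: g_def)
    qed
    show "g y \<in> N \<longleftrightarrow> (\<forall>i<n. y i \<in> I i)" for y using FI by (simp add: F_def g_def)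
  qed (use I in blast)
qed

end
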